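(* Let $X$ be a paracompact Hausdorff filtered space of (filtered) dimension $n$ which has finite cohomological dimension with respect to the ring $R$, let $\bar p$ be a traditional perversity or a superperversity, and let $\mathcal G$ be a local coefficient system of $R$-modules on $X-X^{n-1}$. Let $\mathcal{IS}^*$ be the sheaf complex of intersection chains on $X$. Then $$I^{\bar p}H^{\infty}_{n-*}(X;\mathcal G_0)\cong H^*(\Gamma(X;\mathcal{IS}^* )).$$
   Context: Filtered spaces. A filtered space of dimension $n$ is a space $X$ with closed subspaces $\emptyset=X^{-1}\subset X^0\subset\cdots\subset X^n=X$ (equalities allowed); the strata are the sets $X^j-X^{j-1}$. Perversities. A perversity is $\bar p:\mathbb Z^{\ge 1}\to\mathbb Z$ with $\bar p(k)\le\bar p(k+1)\le\bar p(k)+1$; it is traditional if $\bar p(1)=\bar p(2)=0$ and a superperversity if $\bar p(2)>0$. Coefficients $\mathcal G_0$ and intersection chains. For a local coefficient system (bundle of $R$-modules) $\mathcal G$ on $X-X^{n-1}$, $\mathcal G_0$ denotes the pair consisting of $\mathcal G$ on $X-X^{n-1}$ and the zero system on $X^{n-1}$. A coefficient in $\mathcal G_0$ of a singular simplex $\sigma:\Delta^i\to X$ is a continuous lift $n$ of $\sigma|_{\sigma^{-1}(X-X^{n-1})}$ to $\mathcal G$ (points of $\sigma^{-1}(X^{n-1})$ carry $0$), with stalkwise operations; it is the zero coefficient if it is zero everywhere. Locally-finite chains are possibly infinite formal sums $\sum n_j\sigma_j$ such that each point of $X$ has a neighborhood meeting the images of only finitely many $\sigma_j$ with $n_j\ne0$.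 Simplices with zero coefficient are discarded; the support $|\xi|$ of a chain is the union of the images of its simplices with nonzero coefficient. The boundary is $\partial(n\sigma)=\sum_j(-1)^j(n\circ\mathfrak i_j)(\sigma\circ\mathfrak i_j)$, $\mathfrak i_j$ the face maps, the coefficient being restricted to the face. $\sigma:\Delta^i\to X$ is $\bar p$ allowable if for each $k\ge1$ the set $\sigma^{-1}(X^{n-k}-X^{n-k-1})$ lies in the $(i-k+\bar p(k))$-skeleton of $\Delta^i$. A chain $\xi$ is allowable if every simplex with nonzero coefficient in $\xi$ and in $\partial\xi$ is allowable. $I^{\bar p}C^\infty_*(X;\mathcal G_0)$ is the complex of locally-finite allowable chains, with homology $I^{\bar p}H^\infty_*(X;\mathcal G_0)$. For a subspace $U\subset X$, $I^{\bar p}C^\infty_*(X,U;\mathcal G_0)$ is the quotient of $I^{\bar p}C^\infty_*(X;\mathcal G_0)$ by the subcomplex of allowable chains of $X$ with support in $U$. The sheaf $\mathcal{IS}^*$. $IS^*$ is the differential graded presheaf $U\mapsto IS^j(U)=I^{\bar p}C^\infty_{n-j}(X,X-\bar U;\mathcal G_0)$, with restriction maps the quotient maps and differential induced by $\partial$; $\mathcal{IS}^*$ is its sheafification. *)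

theory Defs
  imports "HOL-Homology.Simplices" "HOL-Analysis.Abstract_Limits" "HOL-Algebra.Module"
    "HOL-Algebra.AbelCoset"
begin

section \<open>Modules over a ring with unit\<close>

text \<open>The library locale \<^locale>\<open>module\<close> requires a commutative ring of scalars. No
  commutativity is needed here, so the same axioms are stated for left modules over an arbitrary
  ring with unit, on the same record type.\<close>

locale left_module = R?: ring R + M?: abelian_group M
  for R (structure) and M :: "('r, 'm) module" (structure) +
  assumes smult_closed:
      "\<lbrakk>a \<in> carrier R; x \<in> carrier M\<rbrakk> \<Longrightarrow> a \<odot>\<^bsub>M\<^esub> x \<in> carrier M"
    and smult_l_distr:
      "\<lbrakk>a \<in> carrier R; b \<in> carrier R; x \<in> carrier M\<rbrakk> \<Longrightarrow>
        (a \<oplus>\<^bsub>R\<^esub> b) \<odot>\<^bsub>M\<^esub> x = a \<odot>\<^bsub>M\<^esub> x \<oplus>\<^bsub>M\<^esub> b \<odot>\<^bsub>M\<^esub> x"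
    and smult_r_distr:
      "\<lbrakk>a \<in> carrier R; x \<in> carrier M; y \<in> carrier M\<rbrakk> \<Longrightarrow>
        a \<odot>\<^bsub>M\<^esub> (x \<oplus>\<^bsub>M\<^esub> y) = a \<odot>\<^bsub>M\<^esub> x \<oplus>\<^bsub>M\<^esub> a \<odot>\<^bsub>M\<^esub> y"
    and smult_assoc:
      "\<lbrakk>a \<in> carrier R; b \<in> carrier R; x \<in> carrier M\<rbrakk> \<Longrightarrow>
        (a \<otimes>\<^bsub>R\<^esub> b) \<odot>\<^bsub>M\<^esub> x = a \<odot>\<^bsub>M\<^esub> (b \<odot>\<^bsub>M\<^esub> x)"
    and smult_one: "x \<in> carrier M \<Longrightarrow> \<one>\<^bsub>R\<^esub> \<odot>\<^bsub>M\<^esub> x = x"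

lemma left_module_cring_iff:
  assumes "cring R"
  shows "left_module R M \<longleftrightarrow> module R M"
  using assms
  by (auto simp: left_module_def left_module_axioms_def module_def module_axioms_def
      cring.axioms(1))

definition lmod_hom ::
    "('r, 'k) ring_scheme \<Rightarrow> ('r, 'm) module \<Rightarrow> ('r, 'n) module \<Rightarrow> ('m \<Rightarrow> 'n) set" where
  "lmod_hom R M N = {h \<in> carrier M \<rightarrow> carrier N.
     (\<forall>x\<in>carrier M. \<forall>y\<in>carrier M. h (x \<oplus>\<^bsub>M\<^esub> y) = h x \<oplus>\<^bsub>N\<^esub> h y) \<and>
     (\<forall>r\<in>carrier R. \<forall>x\<in>carrier M. h (r \<odot>\<^bsub>M\<^esub> x) = r \<odot>\<^bsub>N\<^esub> h x)}"

definition lmod_iso ::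
    "('r, 'k) ring_scheme \<Rightarrow> ('r, 'm) module \<Rightarrow> ('r, 'n) module \<Rightarrow> ('m \<Rightarrow> 'n) set" where
  "lmod_iso R M N = {h \<in> lmod_hom R M N. bij_betw h (carrier M) (carrier N)}"

definition lmod_isomorphic ::
    "('r, 'k) ring_scheme \<Rightarrow> ('r, 'm) module \<Rightarrow> ('r, 'n) module \<Rightarrow> bool" where
  "lmod_isomorphic R M N \<longleftrightarrow> lmod_iso R M N \<noteq> {}"

text \<open>Modules live on the record type of the library, whose ring multiplication fields carry no
  meaning for a module and are left \<^const>\<open>undefined\<close> below.\<close>

definition prod_module :: "'i set \<Rightarrow> ('i \<Rightarrow> ('r, 'm) module) \<Rightarrow> ('r, 'i \<Rightarrow> 'm) module" where
  "prod_module I M =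
     \<lparr>carrier = (\<Pi>\<^sub>E i\<in>I. carrier (M i)), mult = undefined, one = undefined,
      zero = (\<lambda>i\<in>I. \<zero>\<^bsub>M i\<^esub>), add = (\<lambda>f g. \<lambda>i\<in>I. f i \<oplus>\<^bsub>M i\<^esub> g i),
      smult = (\<lambda>r f. \<lambda>i\<in>I. r \<odot>\<^bsub>M i\<^esub> f i)\<rparr>"

definition quot_module :: "('r, 'm) module \<Rightarrow> 'm set \<Rightarrow> ('r, 'm set) module" where
  "quot_module M N =
     \<lparr>carrier = a_rcosets\<^bsub>M\<^esub> N, mult = undefined, one = undefined,
      zero = N, add = (\<lambda>C D. C <+>\<^bsub>M\<^esub> D),
      smult = (\<lambda>r C. \<Union>c\<in>C. N +>\<^bsub>M\<^esub> (r \<odot>\<^bsub>M\<^esub> c))\<rparr>"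

text \<open>The map induced by \<open>f\<close> on cosets, with values in the quotient of \<open>M\<close> by \<open>N\<close>.\<close>

definition quot_map :: "('r, 'm) module \<Rightarrow> 'm set \<Rightarrow> ('l \<Rightarrow> 'm) \<Rightarrow> 'l set \<Rightarrow> 'm set" where
  "quot_map M N f C = (\<Union>c\<in>C. N +>\<^bsub>M\<^esub> f c)"

definition ker_mod :: "('r, 'm) module \<Rightarrow> ('m \<Rightarrow> 'n) \<Rightarrow> ('r, 'n) module \<Rightarrow> ('r, 'm) module" where
  "ker_mod M g N = M\<lparr>carrier := {x \<in> carrier M. g x = \<zero>\<^bsub>N\<^esub>}\<rparr>"

text \<open>Homology at the middle term of \<open>L \<rightarrow> M \<rightarrow> N\<close>.\<close>

definition homology_at ::
    "('r, 'l) module \<Rightarrow> ('l \<Rightarrow> 'm) \<Rightarrow> ('r, 'm) module \<Rightarrow> ('m \<Rightarrow> 'n) \<Rightarrow> ('r, 'n) module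
      \<Rightarrow> ('r, 'm set) module" where
  "homology_at L f M g N = quot_module (ker_mod M g N) (f ` carrier L)"

definition alt_sign :: "('r, 'm) module \<Rightarrow> nat \<Rightarrow> 'm \<Rightarrow> 'm" where
  "alt_sign M k a = (if even k then a else \<ominus>\<^bsub>M\<^esub> a)"


section \<open>Presheaves, sheaves and sheafification\<close>

text \<open>Only the values on open sets are meaningful; \<open>res F U V\<close> is the restriction from \<open>U\<close> to
  \<open>V \<subseteq> U\<close>.\<close>

record ('a, 'r, 'm) presheaf =
  sec :: "'a set \<Rightarrow> ('r, 'm) module"
  res :: "'a set \<Rightarrow> 'a set \<Rightarrow> 'm \<Rightarrow> 'm"

definition presheaf_of_modules ::
    "('r, 'k) ring_scheme \<Rightarrow> 'a topology \<Rightarrow> ('a, 'r, 'm) presheaf \<Rightarrow> bool" where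
  "presheaf_of_modules R X F \<longleftrightarrow>
     (\<forall>U. openin X U \<longrightarrow> left_module R (sec F U)) \<and>
     (\<forall>U V. openin X U \<and> openin X V \<and> V \<subseteq> U \<longrightarrow> res F U V \<in> lmod_hom R (sec F U) (sec F V)) \<and>
     (\<forall>U. openin X U \<longrightarrow> (\<forall>s\<in>carrier (sec F U). res F U U s = s)) \<and>
     (\<forall>U V W. openin X U \<and> openin X V \<and> openin X W \<and> W \<subseteq> V \<and> V \<subseteq> U \<longrightarrow>
        (\<forall>s\<in>carrier (sec F U). res F V W (res F U V s) = res F U W s))"

definition sheaf_of_modules ::
    "('r, 'k) ring_scheme \<Rightarrow> 'a topology \<Rightarrow> ('a, 'r, 'm) presheaf \<Rightarrow> bool" where
  "sheaf_of_modules R X F \<longleftrightarrow> presheaf_of_modules R X F \<and>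
     (\<forall>\<U> s. (\<forall>U\<in>\<U>. openin X U \<and> s U \<in> carrier (sec F U)) \<and>
        (\<forall>U\<in>\<U>. \<forall>V\<in>\<U>. res F U (U \<inter> V) (s U) = res F V (U \<inter> V) (s V)) \<longrightarrow>
        (\<exists>!t. t \<in> carrier (sec F (\<Union>\<U>)) \<and> (\<forall>U\<in>\<U>. res F (\<Union>\<U>) U t = s U)))"

definition germ ::
    "'a topology \<Rightarrow> ('a, 'r, 'm) presheaf \<Rightarrow> 'a \<Rightarrow> 'a set \<Rightarrow> 'm \<Rightarrow> ('a set \<times> 'm) set" where
  "germ X F x U s = {(V, t). openin X V \<and> x \<in> V \<and> t \<in> carrier (sec F V) \<and>
     (\<exists>W. openin X W \<and> x \<in> W \<and> W \<subseteq> U \<inter> V \<and> res F U W s = res F V W t)}"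

text \<open>Operations on germs are defined through representatives; all representatives give the same
  germ, so the unions below are unions of equal sets.\<close>

definition stalk ::
    "'a topology \<Rightarrow> ('a, 'r, 'm) presheaf \<Rightarrow> 'a \<Rightarrow> ('r, ('a set \<times> 'm) set) module" where
  "stalk X F x =
     \<lparr>carrier = {germ X F x U s | U s. openin X U \<and> x \<in> U \<and> s \<in> carrier (sec F U)},
      mult = undefined, one = undefined,
      zero = germ X F x (topspace X) \<zero>\<^bsub>sec F (topspace X)\<^esub>,
      add = (\<lambda>a b. \<Union>(U, s)\<in>a. \<Union>(V, t)\<in>b.
               germ X F x (U \<inter> V) (res F U (U \<inter> V) s \<oplus>\<^bsub>sec F (U \<inter> V)\<^esub> res F V (U \<inter> V) t)),
      smult = (\<lambda>r a. \<Union>(U, s)\<in>a. germ X F x U (r \<odot>\<^bsub>sec F U\<^esub> s))\<rparr>"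

definition sheafify ::
    "'a topology \<Rightarrow> ('a, 'r, 'm) presheaf \<Rightarrow> ('a, 'r, 'a \<Rightarrow> ('a set \<times> 'm) set) presheaf" where
  "sheafify X F =
     \<lparr>sec = (\<lambda>U. (prod_module U (stalk X F))
        \<lparr>carrier := {s \<in> \<Pi>\<^sub>E x\<in>U. carrier (stalk X F x).
           \<forall>x\<in>U. \<exists>V t. openin X V \<and> x \<in> V \<and> V \<subseteq> U \<and> t \<in> carrier (sec F V) \<and>
             (\<forall>y\<in>V. s y = germ X F y V t)}\<rparr>),
      res = (\<lambda>U V s. restrict s V)\<rparr>"

text \<open>The map that a presheaf morphism \<open>\<phi>\<close> with target \<open>F'\<close> induces on germs at \<open>x\<close>, and on
  the sections over \<open>U\<close> of the sheafifications.\<close>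

definition stalk_map ::
    "'a topology \<Rightarrow> ('a, 'r, 'n) presheaf \<Rightarrow> ('a set \<Rightarrow> 'm \<Rightarrow> 'n) \<Rightarrow> 'a
      \<Rightarrow> ('a set \<times> 'm) set \<Rightarrow> ('a set \<times> 'n) set" where
  "stalk_map X F' \<phi> x a = (\<Union>(U, s)\<in>a. germ X F' x U (\<phi> U s))"

definition sheafify_map ::
    "'a topology \<Rightarrow> ('a, 'r, 'n) presheaf \<Rightarrow> ('a set \<Rightarrow> 'm \<Rightarrow> 'n) \<Rightarrow> 'a set
      \<Rightarrow> ('a \<Rightarrow> ('a set \<times> 'm) set) \<Rightarrow> ('a \<Rightarrow> ('a set \<times> 'n) set)" where
  "sheafify_map X F' \<phi> U s = (\<lambda>x\<in>U. stalk_map X F' \<phi> x (s x))"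


section \<open>Sheaf cohomology and cohomological dimension\<close>

text \<open>Sheaf cohomology is the cohomology of the global sections of Godement's canonical
  (simplicial) flabby resolution. Let \<open>(T A) U = (\<Prod>x\<in>U. A\<^sub>x)\<close>, with unit
  \<open>\<eta> : A \<rightarrow> T A\<close> sending a section to its family of germs. The resolution has terms
  \<open>T\<^bsup>p+1\<^esup> A\<close> and differential \<open>\<Sum>i\<le>p+1. (-1)\<^sup>i T\<^sup>i \<eta> T\<^bsup>p+1-i\<^esup>\<close>. Unfolding the iterated
  products and germs, a global section of \<open>T\<^bsup>p+1\<^esup> A\<close> is represented by a function \<open>f\<close> with
  \<open>f(x\<^sub>0,\<dots>,x\<^sub>p)\<close> in the stalk of \<open>A\<close> at \<open>x\<^sub>p\<close>, and \<open>f\<close> represents \<open>0\<close> iff for all \<open>x\<^sub>0\<close>, for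
  all \<open>x\<^sub>1\<close> near \<open>x\<^sub>0\<close>, \<dots>, for all \<open>x\<^sub>p\<close> near \<open>x\<^bsub>p-1\<^esub>\<close>, one has \<open>f(x\<^sub>0,\<dots>,x\<^sub>p) = 0\<close>.\<close>

definition godement_points :: "'a topology \<Rightarrow> nat \<Rightarrow> 'a list set" where
  "godement_points X p = {xs. set xs \<subseteq> topspace X \<and> length xs = Suc p}"

definition godement_functions ::
    "'a topology \<Rightarrow> ('a, 'r, 'm) presheaf \<Rightarrow> nat \<Rightarrow> ('r, 'a list \<Rightarrow> ('a set \<times> 'm) set) module" where
  "godement_functions X A p = prod_module (godement_points X p) (\<lambda>xs. stalk X A (last xs))"

fun iter_near :: "'a topology \<Rightarrow> nat \<Rightarrow> 'a list \<Rightarrow> ('a list \<Rightarrow> bool) \<Rightarrow> bool" where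
  "iter_near X 0 xs P = P xs"
| "iter_near X (Suc k) xs P = (\<forall>\<^sub>F y in nhdsin X (last xs). iter_near X k (xs @ [y]) P)"

definition godement_negligible ::
    "'a topology \<Rightarrow> ('a, 'r, 'm) presheaf \<Rightarrow> nat \<Rightarrow> ('a list \<Rightarrow> ('a set \<times> 'm) set) set" where
  "godement_negligible X A p = {f \<in> carrier (godement_functions X A p).
     \<forall>x\<in>topspace X. iter_near X p [x] (\<lambda>xs. f xs = \<zero>\<^bsub>stalk X A (last xs)\<^esub>)}"

definition godement_module ::
    "'a topology \<Rightarrow> ('a, 'r, 'm) presheaf \<Rightarrow> nat
      \<Rightarrow> ('r, ('a list \<Rightarrow> ('a set \<times> 'm) set) set) module" where
  "godement_module X A p = quot_module (godement_functions X A p) (godement_negligible X A p)"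

text \<open>The germ at \<open>y\<close> of a chosen section representing the germ \<open>a\<close>. For \<open>y\<close> close to the
  base point of \<open>a\<close> it does not depend on the choice, and only such \<open>y\<close> matter.\<close>

definition spread_germ ::
    "'a topology \<Rightarrow> ('a, 'r, 'm) presheaf \<Rightarrow> ('a set \<times> 'm) set \<Rightarrow> 'a \<Rightarrow> ('a set \<times> 'm) set" where
  "spread_germ X A a y =
     (let (U, s) = (SOME Us. Us \<in> a)
      in if y \<in> U then germ X A y U s else \<zero>\<^bsub>stalk X A y\<^esub>)"

definition godement_diff_fun ::
    "'a topology \<Rightarrow> ('a, 'r, 'm) presheaf \<Rightarrow> nat
      \<Rightarrow> ('a list \<Rightarrow> ('a set \<times> 'm) set) \<Rightarrow> ('a list \<Rightarrow> ('a set \<times> 'm) set)" where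
  "godement_diff_fun X A p f =
     (\<lambda>xs\<in>godement_points X (Suc p).
        \<Oplus>\<^bsub>stalk X A (last xs)\<^esub> i\<in>{..Suc p}.
          alt_sign (stalk X A (last xs)) i
            (if i \<le> p then f (take i xs @ drop (Suc i) xs)
             else spread_germ X A (f (butlast xs)) (last xs)))"

definition godement_diff ::
    "'a topology \<Rightarrow> ('a, 'r, 'm) presheaf \<Rightarrow> nat
      \<Rightarrow> ('a list \<Rightarrow> ('a set \<times> 'm) set) set \<Rightarrow> ('a list \<Rightarrow> ('a set \<times> 'm) set) set" where
  "godement_diff X A p =
     quot_map (godement_functions X A (Suc p)) (godement_negligible X A (Suc p))
       (godement_diff_fun X A p)"

definition sheaf_cohomology ::
    "'a topology \<Rightarrow> ('a, 'r, 'm) presheaf \<Rightarrow> nat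
      \<Rightarrow> ('r, ('a list \<Rightarrow> ('a set \<times> 'm) set) set set) module" where
  "sheaf_cohomology X A p =
     quot_module (ker_mod (godement_module X A p) (godement_diff X A p) (godement_module X A (Suc p)))
       (case p of 0 \<Rightarrow> {\<zero>\<^bsub>godement_module X A 0\<^esub>}
        | Suc q \<Rightarrow> godement_diff X A q ` carrier (godement_module X A q))"

text \<open>HOL cannot quantify over all types inside a formula, so \<open>all sheaves of R-modules\<close> means
  all sheaves whose stalks are carried by a type \<open>'s\<close>; sections of such a sheaf are, up to
  isomorphism, functions from points to \<open>'s\<close>. On a paracompact Hausdorff space this is equivalent to
  the condition for sheaves of arbitrary size as soon as \<open>'s\<close> has at least as many elements as
  the ring and as the power set of the space: cohomology classes are given by Cech cocycles, and a
  Cech cocycle has values in the subsheaf of modules generated by its components, whose stalks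
  have at most that many elements (the bound is infinite unless the space is finite, hence
  discrete, when all higher cohomology vanishes).\<close>

definition finite_cohomological_dimension ::
    "'s itself \<Rightarrow> ('r, 'k) ring_scheme \<Rightarrow> 'a topology \<Rightarrow> bool" where
  "finite_cohomological_dimension _ R X \<longleftrightarrow>
     (\<exists>N. \<forall>A :: ('a, 'r, 'a \<Rightarrow> 's) presheaf. sheaf_of_modules R X A \<longrightarrow>
        (\<forall>p>N. carrier (sheaf_cohomology X A p) = {\<zero>\<^bsub>sheaf_cohomology X A p\<^esub>}))"


section \<open>Filtered spaces, perversities and local coefficients\<close>

definition paracompact_space :: "'a topology \<Rightarrow> bool" where
  "paracompact_space X \<longleftrightarrow>
     (\<forall>\<U>. (\<forall>U\<in>\<U>. openin X U) \<and> \<Union>\<U> = topspace X \<longrightarrow>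
        (\<exists>\<V>. (\<forall>V\<in>\<V>. openin X V) \<and> \<Union>\<V> = topspace X \<and>
             (\<forall>V\<in>\<V>. \<exists>U\<in>\<U>. V \<subseteq> U) \<and> locally_finite_in X \<V>))"

record 'a filtered_space =
  fs_top :: "'a topology"
  fs_dim :: nat
  fs_filt :: "int \<Rightarrow> 'a set"

text \<open>The terms of index below \<open>-1\<close> are set to be empty, as the one of index \<open>-1\<close>; thus
  \<open>X\<^bsup>n-k\<^esup> - X\<^bsup>n-k-1\<^esup>\<close> is empty for \<open>k > n\<close>.\<close>

definition is_filtered_space :: "'a filtered_space \<Rightarrow> bool" where
  "is_filtered_space X \<longleftrightarrow>
     (\<forall>j<0. fs_filt X j = {}) \<and>
     (\<forall>j<int (fs_dim X). fs_filt X j \<subseteq> fs_filt X (j + 1)) \<and>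
     (\<forall>j\<le>int (fs_dim X). closedin (fs_top X) (fs_filt X j)) \<and>
     fs_filt X (int (fs_dim X)) = topspace (fs_top X)"

definition sing_set :: "'a filtered_space \<Rightarrow> 'a set" where
  "sing_set X = fs_filt X (int (fs_dim X) - 1)"

text \<open>Only the values at arguments \<open>k \<ge> 1\<close> are meaningful.\<close>

type_synonym perversity = "nat \<Rightarrow> int"

definition is_perversity :: "perversity \<Rightarrow> bool" where
  "is_perversity p \<longleftrightarrow> (\<forall>k\<ge>1. p k \<le> p (k + 1) \<and> p (k + 1) \<le> p k + 1)"

definition traditional_perversity :: "perversity \<Rightarrow> bool" where
  "traditional_perversity p \<longleftrightarrow> is_perversity p \<and> p 1 = 0 \<and> p 2 = 0"

definition superperversity :: "perversity \<Rightarrow> bool" where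
  "superperversity p \<longleftrightarrow> is_perversity p \<and> p 2 > 0"

record ('a, 'r, 'e) module_bundle =
  total :: "'e topology"
  proj :: "'e \<Rightarrow> 'a"
  fibre :: "'a \<Rightarrow> ('r, 'e) module"

definition local_coefficient_system ::
    "('r, 'k) ring_scheme \<Rightarrow> 'a topology \<Rightarrow> ('a, 'r, 'e) module_bundle \<Rightarrow> bool" where
  "local_coefficient_system R B G \<longleftrightarrow>
     proj G \<in> topspace (total G) \<rightarrow> topspace B \<and>
     (\<forall>x\<in>topspace B. left_module R (fibre G x) \<and>
        carrier (fibre G x) = {e \<in> topspace (total G). proj G e = x}) \<and>
     (\<forall>x\<in>topspace B. \<exists>U h. openin B U \<and> x \<in> U \<and>
        homeomorphic_map
          (prod_topology (subtopology B U) (discrete_topology (carrier (fibre G x))))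
          (subtopology (total G) {e \<in> topspace (total G). proj G e \<in> U}) h \<and>
        (\<forall>y\<in>U. (\<lambda>v. h (y, v)) \<in> lmod_iso R (fibre G x) (fibre G y)))"


section \<open>Locally finite intersection chains\<close>

text \<open>Degrees are integers; there are no simplices, hence only the zero chain, in negative
  degrees.\<close>

type_synonym 'a simplex = "(nat \<Rightarrow> real) \<Rightarrow> 'a"
type_synonym ('a, 'e) lf_chain = "'a simplex \<Rightarrow> (nat \<Rightarrow> real) \<Rightarrow> 'e"

definition simplices :: "'a filtered_space \<Rightarrow> int \<Rightarrow> 'a simplex set" where
  "simplices X i = {\<sigma>. 0 \<le> i \<and> singular_simplex (nat i) (fs_top X) \<sigma>}"

definition regular_part :: "'a filtered_space \<Rightarrow> int \<Rightarrow> 'a simplex \<Rightarrow> (nat \<Rightarrow> real) set" where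
  "regular_part X i \<sigma> = {t \<in> standard_simplex (nat i). \<sigma> t \<notin> sing_set X}"

text \<open>The coefficients in \<open>\<G>\<^sub>0\<close> of a simplex: continuous lifts of its restriction to the regular
  part. The lifting condition is that the value at \<open>t\<close> lies in the fibre over \<open>\<sigma> t\<close>.\<close>

definition coeff_module ::
    "'a filtered_space \<Rightarrow> ('a, 'r, 'e) module_bundle \<Rightarrow> int \<Rightarrow> 'a simplex
      \<Rightarrow> ('r, (nat \<Rightarrow> real) \<Rightarrow> 'e) module" where
  "coeff_module X G i \<sigma> =
     (prod_module (regular_part X i \<sigma>) (\<lambda>t. fibre G (\<sigma> t)))
       \<lparr>carrier := {c \<in> \<Pi>\<^sub>E t\<in>regular_part X i \<sigma>. carrier (fibre G (\<sigma> t)).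
          continuous_map (subtopology (powertop_real UNIV) (regular_part X i \<sigma>)) (total G) c}\<rparr>"

definition chain_simplices ::
    "'a filtered_space \<Rightarrow> ('a, 'r, 'e) module_bundle \<Rightarrow> int \<Rightarrow> ('a, 'e) lf_chain
      \<Rightarrow> 'a simplex set" where
  "chain_simplices X G i \<xi> = {\<sigma> \<in> simplices X i. \<xi> \<sigma> \<noteq> \<zero>\<^bsub>coeff_module X G i \<sigma>\<^esub>}"

definition chain_support ::
    "'a filtered_space \<Rightarrow> ('a, 'r, 'e) module_bundle \<Rightarrow> int \<Rightarrow> ('a, 'e) lf_chain \<Rightarrow> 'a set" where
  "chain_support X G i \<xi> = (\<Union>\<sigma>\<in>chain_simplices X G i \<xi>. \<sigma> ` standard_simplex (nat i))"

text \<open>A formal sum is recorded by the coefficient of each singular simplex.\<close>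

definition lf_chains ::
    "'a filtered_space \<Rightarrow> ('a, 'r, 'e) module_bundle \<Rightarrow> int \<Rightarrow> ('r, ('a, 'e) lf_chain) module" where
  "lf_chains X G i =
     (prod_module (simplices X i) (coeff_module X G i))
       \<lparr>carrier := {\<xi> \<in> \<Pi>\<^sub>E \<sigma>\<in>simplices X i. carrier (coeff_module X G i \<sigma>).
          \<forall>x\<in>topspace (fs_top X). \<exists>V. openin (fs_top X) V \<and> x \<in> V \<and>
            finite {\<sigma> \<in> chain_simplices X G i \<xi>. \<sigma> ` standard_simplex (nat i) \<inter> V \<noteq> {}}}\<rparr>"

text \<open>The coefficient of \<open>\<tau>\<close> in the boundary collects the restrictions to the face of the
  coefficients of all pairs \<open>(\<sigma>, j)\<close> such that the \<open>j\<close>-th face of \<open>\<sigma>\<close> is \<open>\<tau>\<close>; local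
  finiteness makes the sum finite.\<close>

definition lf_boundary ::
    "'a filtered_space \<Rightarrow> ('a, 'r, 'e) module_bundle \<Rightarrow> int
      \<Rightarrow> ('a, 'e) lf_chain \<Rightarrow> ('a, 'e) lf_chain" where
  "lf_boundary X G i \<xi> =
     (\<lambda>\<tau>\<in>simplices X (i - 1). \<lambda>t\<in>regular_part X (i - 1) \<tau>.
        finsum (fibre G (\<tau> t))
          (\<lambda>(\<sigma>, j). alt_sign (fibre G (\<tau> t)) j (\<xi> \<sigma> (simplical_face j t)))
          {(\<sigma>, j). \<sigma> \<in> chain_simplices X G i \<xi> \<and> j \<le> nat i \<and> singular_face (nat i) j \<sigma> = \<tau>})"

text \<open>The \<open>m\<close>-skeleton of the standard \<open>i\<close>-simplex: at most \<open>m + 1\<close> nonzero barycentric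
  coordinates. It is empty for \<open>m < 0\<close>.\<close>

definition simplex_skeleton :: "nat \<Rightarrow> int \<Rightarrow> (nat \<Rightarrow> real) set" where
  "simplex_skeleton i m = {t \<in> standard_simplex i. int (card {l. t l \<noteq> 0}) \<le> m + 1}"

definition allowable_simplex ::
    "'a filtered_space \<Rightarrow> perversity \<Rightarrow> int \<Rightarrow> 'a simplex \<Rightarrow> bool" where
  "allowable_simplex X p i \<sigma> \<longleftrightarrow>
     (\<forall>k\<ge>1. {t \<in> standard_simplex (nat i).
               \<sigma> t \<in> fs_filt X (int (fs_dim X) - int k) - fs_filt X (int (fs_dim X) - int k - 1)}
            \<subseteq> simplex_skeleton (nat i) (i - int k + p k))"

definition allowable_chain ::
    "'a filtered_space \<Rightarrow> perversity \<Rightarrow> ('a, 'r, 'e) module_bundle \<Rightarrow> int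
      \<Rightarrow> ('a, 'e) lf_chain \<Rightarrow> bool" where
  "allowable_chain X p G i \<xi> \<longleftrightarrow>
     (\<forall>\<sigma>\<in>chain_simplices X G i \<xi>. allowable_simplex X p i \<sigma>) \<and>
     (\<forall>\<tau>\<in>chain_simplices X G (i - 1) (lf_boundary X G i \<xi>). allowable_simplex X p (i - 1) \<tau>)"

definition intersection_chains ::
    "'a filtered_space \<Rightarrow> perversity \<Rightarrow> ('a, 'r, 'e) module_bundle \<Rightarrow> int
      \<Rightarrow> ('r, ('a, 'e) lf_chain) module" where
  "intersection_chains X p G i =
     (lf_chains X G i)\<lparr>carrier := {\<xi> \<in> carrier (lf_chains X G i). allowable_chain X p G i \<xi>}\<rparr>"

definition intersection_homology ::
    "'a filtered_space \<Rightarrow> perversity \<Rightarrow> ('a, 'r, 'e) module_bundle \<Rightarrow> int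
      \<Rightarrow> ('r, ('a, 'e) lf_chain set) module" where
  "intersection_homology X p G i =
     homology_at
       (intersection_chains X p G (i + 1)) (lf_boundary X G (i + 1))
       (intersection_chains X p G i) (lf_boundary X G i)
       (intersection_chains X p G (i - 1))"

definition supported_chains ::
    "'a filtered_space \<Rightarrow> perversity \<Rightarrow> ('a, 'r, 'e) module_bundle \<Rightarrow> int \<Rightarrow> 'a set
      \<Rightarrow> ('a, 'e) lf_chain set" where
  "supported_chains X p G i S =
     {\<xi> \<in> carrier (intersection_chains X p G i). chain_support X G i \<xi> \<subseteq> S}"

definition relative_intersection_chains ::
    "'a filtered_space \<Rightarrow> perversity \<Rightarrow> ('a, 'r, 'e) module_bundle \<Rightarrow> int \<Rightarrow> 'a set
      \<Rightarrow> ('r, ('a, 'e) lf_chain set) module" where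
  "relative_intersection_chains X p G i S =
     quot_module (intersection_chains X p G i) (supported_chains X p G i S)"


section \<open>The sheaf complex of intersection chains\<close>

definition outside :: "'a filtered_space \<Rightarrow> 'a set \<Rightarrow> 'a set" where
  "outside X U = topspace (fs_top X) - (fs_top X) closure_of U"

definition IS_presheaf ::
    "'a filtered_space \<Rightarrow> perversity \<Rightarrow> ('a, 'r, 'e) module_bundle \<Rightarrow> int
      \<Rightarrow> ('a, 'r, ('a, 'e) lf_chain set) presheaf" where
  "IS_presheaf X p G j =
     \<lparr>sec = (\<lambda>U. relative_intersection_chains X p G (int (fs_dim X) - j) (outside X U)),
      res = (\<lambda>U V. quot_map (intersection_chains X p G (int (fs_dim X) - j))
               (supported_chains X p G (int (fs_dim X) - j) (outside X V)) (\<lambda>\<xi>. \<xi>))\<rparr>"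

definition IS_presheaf_diff ::
    "'a filtered_space \<Rightarrow> perversity \<Rightarrow> ('a, 'r, 'e) module_bundle \<Rightarrow> int \<Rightarrow> 'a set
      \<Rightarrow> ('a, 'e) lf_chain set \<Rightarrow> ('a, 'e) lf_chain set" where
  "IS_presheaf_diff X p G j U =
     quot_map (intersection_chains X p G (int (fs_dim X) - (j + 1)))
       (supported_chains X p G (int (fs_dim X) - (j + 1)) (outside X U))
       (lf_boundary X G (int (fs_dim X) - j))"

definition IS_sheaf ::
    "'a filtered_space \<Rightarrow> perversity \<Rightarrow> ('a, 'r, 'e) module_bundle \<Rightarrow> int
      \<Rightarrow> ('a, 'r, 'a \<Rightarrow> ('a set \<times> ('a, 'e) lf_chain set) set) presheaf" where
  "IS_sheaf X p G j = sheafify (fs_top X) (IS_presheaf X p G j)"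

definition IS_sheaf_diff ::
    "'a filtered_space \<Rightarrow> perversity \<Rightarrow> ('a, 'r, 'e) module_bundle \<Rightarrow> int \<Rightarrow> 'a set
      \<Rightarrow> ('a \<Rightarrow> ('a set \<times> ('a, 'e) lf_chain set) set)
      \<Rightarrow> ('a \<Rightarrow> ('a set \<times> ('a, 'e) lf_chain set) set)" where
  "IS_sheaf_diff X p G j =
     sheafify_map (fs_top X) (IS_presheaf X p G (j + 1)) (IS_presheaf_diff X p G j)"

definition IS_global_sections ::
    "'a filtered_space \<Rightarrow> perversity \<Rightarrow> ('a, 'r, 'e) module_bundle \<Rightarrow> int
      \<Rightarrow> ('r, 'a \<Rightarrow> ('a set \<times> ('a, 'e) lf_chain set) set) module" where
  "IS_global_sections X p G j = sec (IS_sheaf X p G j) (topspace (fs_top X))"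

definition IS_global_cohomology ::
    "'a filtered_space \<Rightarrow> perversity \<Rightarrow> ('a, 'r, 'e) module_bundle \<Rightarrow> int
      \<Rightarrow> ('r, ('a \<Rightarrow> ('a set \<times> ('a, 'e) lf_chain set) set) set) module" where
  "IS_global_cohomology X p G j =
     homology_at
       (IS_global_sections X p G (j - 1)) (IS_sheaf_diff X p G (j - 1) (topspace (fs_top X)))
       (IS_global_sections X p G j) (IS_sheaf_diff X p G j (topspace (fs_top X)))
       (IS_global_sections X p G (j + 1))"

text \<open>A stalk type large enough for \<^const>\<open>finite_cohomological_dimension\<close>: it has at least as
  many elements as the ring and as the power set of the space, and the stalks of
  \<^const>\<open>IS_sheaf\<close> have their elements in the second component.\<close>

type_synonym ('a, 'r, 'e) stalk_universe =
  "'r \<times> ('a set \<times> ('a, 'e) lf_chain set) set"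

end

theory Submission
  imports Defs "HOL-Analysis.Abstract_Topological_Spaces"
begin

text \<open>Sending a chain to the section formed by its germs is an isomorphism from the complex of allowable
  locally finite chains onto the global sections of the sheafification, so no subdivision is needed.
  A paracompact Hausdorff space is regular, and local finiteness then shows that two chains have the
  same germ at \<open>x\<close> iff they have the same coefficient on every simplex through \<open>x\<close>. Hence the map is
  injective. Given a section, the coefficient that its germs assign to a fixed simplex is locally
  constant along the image of the simplex, which is connected; these constants define the chain
  with the given germs.\<close>

section \<open>Left modules\<close>

text \<open>The presheaf divides by chains supported off the closure of an open set. Equality of
  germs therefore asks for a neighborhood whose closure misses every simplex on which two chains
  differ. Agreement at the point supplies one because images of simplices are closed and only
  finitely many of the relevant ones come near the point. The glued chain must also be allowable.
  Allowability is tested simplex by simplex, and the coefficient of a face in the boundary involves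
  only simplices that contain the face. All of these pass through any chosen point of the face, so
  one local representative decides that coefficient. On the algebraic side most of the work is
  well-definedness: operations on cosets and germs are unions over representatives, and negation in
  a module record is a chosen inverse, not a formula. This explains the frequent multiples by the
  scalar -1.\<close>

lemma (in left_module) smult_zero: "a \<in> carrier R \<Longrightarrow> a \<odot>\<^bsub>M\<^esub> \<zero>\<^bsub>M\<^esub> = \<zero>\<^bsub>M\<^esub>"
  by (metis M.add.r_cancel_one' M.zero_closed smult_closed smult_r_distr M.r_zero)

lemma (in left_module) zero_smult: "x \<in> carrier M \<Longrightarrow> \<zero>\<^bsub>R\<^esub> \<odot>\<^bsub>M\<^esub> x = \<zero>\<^bsub>M\<^esub>"
  by (metis M.add.r_cancel_one' R.zero_closed R.r_zero smult_closed smult_l_distr)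

text \<open>The operation \<open>\<ominus>\<close> is an inverse picked out in the additive monoid,
  so it cannot be read off componentwise in a product or after the carrier is shrunk. Scalar
  multiples can, and this identity exchanges the one for the other.\<close>

lemma (in left_module) smult_minus_one:
  assumes "x \<in> carrier M"
  shows "(\<ominus>\<^bsub>R\<^esub> \<one>\<^bsub>R\<^esub>) \<odot>\<^bsub>M\<^esub> x = \<ominus>\<^bsub>M\<^esub> x"
proof -
  have "(\<ominus>\<^bsub>R\<^esub> \<one>\<^bsub>R\<^esub>) \<odot>\<^bsub>M\<^esub> x \<oplus>\<^bsub>M\<^esub> x = \<zero>\<^bsub>M\<^esub>"
    by (metis assms R.add.inv_closed R.l_neg R.one_closed smult_l_distr smult_one zero_smult)
  then show ?thesis
    using assms by (simp add: M.minus_equality smult_closed)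
qed

lemma (in left_module) smult_minus:
  assumes "a \<in> carrier R" "x \<in> carrier M"
  shows "a \<odot>\<^bsub>M\<^esub> (\<ominus>\<^bsub>M\<^esub> x) = \<ominus>\<^bsub>M\<^esub> (a \<odot>\<^bsub>M\<^esub> x)"
  by (metis assms M.add.inv_closed M.l_neg M.minus_equality smult_closed smult_r_distr smult_zero)

text \<open>Over an infinite index set both sums are zero by convention, so that case of the
  induction reduces to \<open>smult_zero\<close>.\<close>

lemma (in left_module) smult_finsum:
  assumes "a \<in> carrier R" "f \<in> A \<rightarrow> carrier M"
  shows "a \<odot>\<^bsub>M\<^esub> finsum M f A = finsum M (\<lambda>x. a \<odot>\<^bsub>M\<^esub> f x) A"
  using assms(2)
proof (induction A rule: infinite_finite_induct)
  case (insert x F)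
  then show ?case
    by (simp add: assms(1) smult_closed smult_r_distr Pi_iff)
qed (use assms(1) in \<open>simp_all add: smult_zero\<close>)

lemma (in left_module) alt_sign_closed: "x \<in> carrier M \<Longrightarrow> alt_sign M k x \<in> carrier M"
  by (simp add: alt_sign_def)

lemma (in left_module) alt_sign_zero: "alt_sign M k \<zero>\<^bsub>M\<^esub> = \<zero>\<^bsub>M\<^esub>"
  by (simp add: alt_sign_def)

lemma (in left_module) alt_sign_add:
  "x \<in> carrier M \<Longrightarrow> y \<in> carrier M \<Longrightarrow>
    alt_sign M k (x \<oplus>\<^bsub>M\<^esub> y) = alt_sign M k x \<oplus>\<^bsub>M\<^esub> alt_sign M k y"
  by (simp add: alt_sign_def M.minus_add)

lemma (in left_module) alt_sign_smult:
  "a \<in> carrier R \<Longrightarrow> x \<in> carrier M \<Longrightarrow>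
    alt_sign M k (a \<odot>\<^bsub>M\<^esub> x) = a \<odot>\<^bsub>M\<^esub> alt_sign M k x"
  by (simp add: alt_sign_def smult_minus)

lemma (in left_module) finsum_minus:
  assumes "f \<in> A \<rightarrow> carrier M"
  shows "finsum M (\<lambda>x. \<ominus>\<^bsub>M\<^esub> f x) A = \<ominus>\<^bsub>M\<^esub> finsum M f A"
proof -
  have "\<ominus>\<^bsub>M\<^esub> finsum M f A = finsum M (\<lambda>x. (\<ominus>\<^bsub>R\<^esub> \<one>\<^bsub>R\<^esub>) \<odot>\<^bsub>M\<^esub> f x) A"
    using assms by (simp add: smult_finsum flip: smult_minus_one)
  also have "\<dots> = finsum M (\<lambda>x. \<ominus>\<^bsub>M\<^esub> f x) A"
    by (rule M.finsum_cong') (use assms in \<open>auto simp: smult_minus_one Pi_iff\<close>)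
  finally show ?thesis by simp
qed

lemma (in left_module) alt_sign_finsum:
  assumes "f \<in> A \<rightarrow> carrier M"
  shows "alt_sign M k (finsum M f A) = finsum M (\<lambda>x. alt_sign M k (f x)) A"
  using assms by (simp add: alt_sign_def finsum_minus)

text \<open>Inverses are demanded through an equation in sums and scalar multiples only. Such an
  equation can be checked componentwise in a product, and it passes to a submodule without any
  statement about \<open>\<ominus>\<close>.\<close>

lemma left_moduleI:
  fixes M :: "('r, 'm) module"
  assumes "ring R"
    and "\<And>x y. x \<in> carrier M \<Longrightarrow> y \<in> carrier M \<Longrightarrow> x \<oplus>\<^bsub>M\<^esub> y \<in> carrier M"
    and "\<zero>\<^bsub>M\<^esub> \<in> carrier M"
    and "\<And>x y z. x \<in> carrier M \<Longrightarrow> y \<in> carrier M \<Longrightarrow> z \<in> carrier M \<Longrightarrow>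
      (x \<oplus>\<^bsub>M\<^esub> y) \<oplus>\<^bsub>M\<^esub> z = x \<oplus>\<^bsub>M\<^esub> (y \<oplus>\<^bsub>M\<^esub> z)"
    and "\<And>x y. x \<in> carrier M \<Longrightarrow> y \<in> carrier M \<Longrightarrow> x \<oplus>\<^bsub>M\<^esub> y = y \<oplus>\<^bsub>M\<^esub> x"
    and "\<And>x. x \<in> carrier M \<Longrightarrow> \<zero>\<^bsub>M\<^esub> \<oplus>\<^bsub>M\<^esub> x = x"
    and "\<And>x. x \<in> carrier M \<Longrightarrow> (\<ominus>\<^bsub>R\<^esub> \<one>\<^bsub>R\<^esub>) \<odot>\<^bsub>M\<^esub> x \<oplus>\<^bsub>M\<^esub> x = \<zero>\<^bsub>M\<^esub>"
    and "\<And>a x. a \<in> carrier R \<Longrightarrow> x \<in> carrier M \<Longrightarrow> a \<odot>\<^bsub>M\<^esub> x \<in> carrier M"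
    and "\<And>a b x. a \<in> carrier R \<Longrightarrow> b \<in> carrier R \<Longrightarrow> x \<in> carrier M \<Longrightarrow>
      (a \<oplus>\<^bsub>R\<^esub> b) \<odot>\<^bsub>M\<^esub> x = a \<odot>\<^bsub>M\<^esub> x \<oplus>\<^bsub>M\<^esub> b \<odot>\<^bsub>M\<^esub> x"
    and "\<And>a x y. a \<in> carrier R \<Longrightarrow> x \<in> carrier M \<Longrightarrow> y \<in> carrier M \<Longrightarrow>
      a \<odot>\<^bsub>M\<^esub> (x \<oplus>\<^bsub>M\<^esub> y) = a \<odot>\<^bsub>M\<^esub> x \<oplus>\<^bsub>M\<^esub> a \<odot>\<^bsub>M\<^esub> y"
    and "\<And>a b x. a \<in> carrier R \<Longrightarrow> b \<in> carrier R \<Longrightarrow> x \<in> carrier M \<Longrightarrow>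
      (a \<otimes>\<^bsub>R\<^esub> b) \<odot>\<^bsub>M\<^esub> x = a \<odot>\<^bsub>M\<^esub> (b \<odot>\<^bsub>M\<^esub> x)"
    and "\<And>x. x \<in> carrier M \<Longrightarrow> \<one>\<^bsub>R\<^esub> \<odot>\<^bsub>M\<^esub> x = x"
  shows "left_module R M"
proof -
  interpret R: ring R by fact
  have "abelian_group M"
  proof (rule abelian_groupI)
    show "\<exists>y\<in>carrier M. y \<oplus>\<^bsub>M\<^esub> x = \<zero>\<^bsub>M\<^esub>" if "x \<in> carrier M" for x
      using that assms(7,8) R.add.inv_closed[OF R.one_closed] by blast
  qed (fact assms)+
  then show ?thesis
    by (intro left_module.intro left_module_axioms.intro) (use assms in simp_all)
qed

text \<open>Families are extensional, so an equation between them has to be checked only at indices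
  in \<open>I\<close>, where it is the corresponding axiom of the factor.\<close>

lemma prod_module_left_module:
  assumes "ring R" "\<And>i. i \<in> I \<Longrightarrow> left_module R (M i)"
  shows "left_module R (prod_module I M)"
proof (rule left_moduleI)
  interpret R: ring R by fact
  note M = left_module.axioms(2)[OF assms(2)]
  note g = abelian_group.axioms(1)[OF M]
  show "x \<oplus>\<^bsub>prod_module I M\<^esub> y \<in> carrier (prod_module I M)"
    if "x \<in> carrier (prod_module I M)" "y \<in> carrier (prod_module I M)" for x y
    using that by (auto simp: prod_module_def PiE_iff abelian_monoid.a_closed g)
  show "\<zero>\<^bsub>prod_module I M\<^esub> \<in> carrier (prod_module I M)"
    by (auto simp: prod_module_def abelian_monoid.zero_closed g)
  show "\<zero>\<^bsub>prod_module I M\<^esub> \<oplus>\<^bsub>prod_module I M\<^esub> x = x"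
    if "x \<in> carrier (prod_module I M)" for x
    by (rule extensionalityI[of _ I])
      (use that in \<open>auto simp: prod_module_def PiE_iff abelian_monoid.l_zero g\<close>)
  show "(x \<oplus>\<^bsub>prod_module I M\<^esub> y) \<oplus>\<^bsub>prod_module I M\<^esub> z = x \<oplus>\<^bsub>prod_module I M\<^esub> (y \<oplus>\<^bsub>prod_module I M\<^esub> z)"
    if "x \<in> carrier (prod_module I M)" "y \<in> carrier (prod_module I M)" "z \<in> carrier (prod_module I M)" for x y z
    by (rule extensionalityI[of _ I])
      (use that in \<open>auto simp: prod_module_def PiE_iff abelian_monoid.a_assoc g\<close>)
  show "x \<oplus>\<^bsub>prod_module I M\<^esub> y = y \<oplus>\<^bsub>prod_module I M\<^esub> x"
    if "x \<in> carrier (prod_module I M)" "y \<in> carrier (prod_module I M)" for x y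
    by (rule extensionalityI[of _ I])
      (use that in \<open>auto simp: prod_module_def PiE_iff abelian_monoid.a_comm g\<close>)
  show "(\<ominus>\<^bsub>R\<^esub> \<one>\<^bsub>R\<^esub>) \<odot>\<^bsub>prod_module I M\<^esub> x \<oplus>\<^bsub>prod_module I M\<^esub> x = \<zero>\<^bsub>prod_module I M\<^esub>"
    if "x \<in> carrier (prod_module I M)" for x
    by (rule extensionalityI[of _ I])
      (use that in \<open>auto simp: prod_module_def PiE_iff left_module.smult_minus_one[OF assms(2)] abelian_group.l_neg M\<close>)
  show "a \<odot>\<^bsub>prod_module I M\<^esub> x \<in> carrier (prod_module I M)"
    if "a \<in> carrier R" "x \<in> carrier (prod_module I M)" for a x
    using that by (auto simp: prod_module_def PiE_iff left_module.smult_closed[OF assms(2)])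
  show "(a \<oplus>\<^bsub>R\<^esub> b) \<odot>\<^bsub>prod_module I M\<^esub> x = a \<odot>\<^bsub>prod_module I M\<^esub> x \<oplus>\<^bsub>prod_module I M\<^esub> b \<odot>\<^bsub>prod_module I M\<^esub> x"
    if "a \<in> carrier R" "b \<in> carrier R" "x \<in> carrier (prod_module I M)" for a b x
    by (rule extensionalityI[of _ I])
      (use that in \<open>auto simp: prod_module_def PiE_iff left_module.smult_l_distr[OF assms(2)]\<close>)
  show "a \<odot>\<^bsub>prod_module I M\<^esub> (x \<oplus>\<^bsub>prod_module I M\<^esub> y) = a \<odot>\<^bsub>prod_module I M\<^esub> x \<oplus>\<^bsub>prod_module I M\<^esub> a \<odot>\<^bsub>prod_module I M\<^esub> y"
    if "a \<in> carrier R" "x \<in> carrier (prod_module I M)" "y \<in> carrier (prod_module I M)" for a x y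
    by (rule extensionalityI[of _ I])
      (use that in \<open>auto simp: prod_module_def PiE_iff left_module.smult_r_distr[OF assms(2)]\<close>)
  show "(a \<otimes>\<^bsub>R\<^esub> b) \<odot>\<^bsub>prod_module I M\<^esub> x = a \<odot>\<^bsub>prod_module I M\<^esub> (b \<odot>\<^bsub>prod_module I M\<^esub> x)"
    if "a \<in> carrier R" "b \<in> carrier R" "x \<in> carrier (prod_module I M)" for a b x
    by (rule extensionalityI[of _ I])
      (use that in \<open>auto simp: prod_module_def PiE_iff left_module.smult_assoc[OF assms(2)]\<close>)
  show "\<one>\<^bsub>R\<^esub> \<odot>\<^bsub>prod_module I M\<^esub> x = x"
    if "x \<in> carrier (prod_module I M)" for x
    by (rule extensionalityI[of _ I])
      (use that in \<open>auto simp: prod_module_def PiE_iff left_module.smult_one[OF assms(2)]\<close>)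
qed (fact assms(1))

text \<open>Scalar multiples of cosets, quotient maps, operations on germs and maps of stalks are
  all unions over representatives. Each is evaluated by exhibiting one representative and showing
  that all of them give the same set.\<close>

lemma UN_eq_constant:
  "a \<in> C \<Longrightarrow> (\<And>c. c \<in> C \<Longrightarrow> g c = B) \<Longrightarrow> (\<Union>c\<in>C. g c) = B"
  by auto

section \<open>Submodules, cosets and maps between quotients\<close>

definition lsubmodule :: "('r, 'k) ring_scheme \<Rightarrow> 'm set \<Rightarrow> ('r, 'm) module \<Rightarrow> bool" where
  "lsubmodule R N M \<longleftrightarrow> N \<subseteq> carrier M \<and> \<zero>\<^bsub>M\<^esub> \<in> N \<and>
     (\<forall>x\<in>N. \<forall>y\<in>N. x \<oplus>\<^bsub>M\<^esub> y \<in> N) \<and> (\<forall>r\<in>carrier R. \<forall>x\<in>N. r \<odot>\<^bsub>M\<^esub> x \<in> N)"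

text \<open>Coefficients, locally finite chains and allowable chains each arise from a larger module
  by shrinking the carrier field of the record. This lemma gives all three their module
  structure.\<close>

lemma lsubmodule_left_module:
  assumes "left_module R M" "lsubmodule R N M"
  shows "left_module R (M\<lparr>carrier := N\<rparr>)"
proof -
  interpret left_module R M by fact
  show ?thesis
  proof (rule left_moduleI)
    show "(\<ominus>\<^bsub>R\<^esub> \<one>\<^bsub>R\<^esub>) \<odot>\<^bsub>M\<lparr>carrier := N\<rparr>\<^esub> x \<oplus>\<^bsub>M\<lparr>carrier := N\<rparr>\<^esub> x = \<zero>\<^bsub>M\<lparr>carrier := N\<rparr>\<^esub>"
      if "x \<in> carrier (M\<lparr>carrier := N\<rparr>)" for x
      using that assms(2) by (auto simp: lsubmodule_def smult_minus_one M.l_neg)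
    show "x \<oplus>\<^bsub>M\<lparr>carrier := N\<rparr>\<^esub> y = y \<oplus>\<^bsub>M\<lparr>carrier := N\<rparr>\<^esub> x"
      if "x \<in> carrier (M\<lparr>carrier := N\<rparr>)" "y \<in> carrier (M\<lparr>carrier := N\<rparr>)" for x y
      using that assms(2) by (auto simp: lsubmodule_def M.a_comm subset_iff)
  qed (use assms(2) in \<open>auto simp: lsubmodule_def R.ring_axioms subset_iff M.a_assoc smult_l_distr
      smult_r_distr smult_assoc smult_one\<close>)
qed

locale left_submodule = left_module R M
  for R and M :: "('r, 'm) module" (structure) +
  fixes N
  assumes lsubmodule: "lsubmodule R N M"
begin

lemma in_module: "x \<in> N \<Longrightarrow> x \<in> carrier M"
  using lsubmodule by (auto simp: lsubmodule_def)

text \<open>Closure under negatives comes from the scalar -1. With it the coset theory of abelian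
  groups applies to \<open>N\<close>.\<close>

lemma subgroup: "subgroup N (add_monoid M)"
proof (rule M.add.subgroupI)
  show "\<ominus> a \<in> N" if "a \<in> N" for a
    using that lsubmodule smult_minus_one[OF in_module[OF that]] R.add.inv_closed[OF R.one_closed]
    unfolding lsubmodule_def by metis
qed (use lsubmodule in \<open>auto simp: lsubmodule_def\<close>)

sublocale abelian_subgroup N M
  using subgroup abelian_subgroupI3 additive_subgroupI M.abelian_group_axioms by blast

lemma mem_coset_iff:
  assumes "a \<in> carrier M"
  shows "c \<in> N +> a \<longleftrightarrow> c \<in> carrier M \<and> c \<oplus> ((\<ominus>\<^bsub>R\<^esub> \<one>\<^bsub>R\<^esub>) \<odot>\<^bsub>M\<^esub> a) \<in> N"
proof
  assume "c \<in> N +> a"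
  then obtain n where n: "n \<in> N" "c = n \<oplus> a" by (auto simp: a_r_coset_def')
  then show "c \<in> carrier M \<and> c \<oplus> ((\<ominus>\<^bsub>R\<^esub> \<one>\<^bsub>R\<^esub>) \<odot>\<^bsub>M\<^esub> a) \<in> N"
    using assms in_module by (simp add: smult_minus_one M.a_assoc M.r_neg)
next
  assume c: "c \<in> carrier M \<and> c \<oplus> ((\<ominus>\<^bsub>R\<^esub> \<one>\<^bsub>R\<^esub>) \<odot>\<^bsub>M\<^esub> a) \<in> N"
  then have "c = (c \<oplus> ((\<ominus>\<^bsub>R\<^esub> \<one>\<^bsub>R\<^esub>) \<odot>\<^bsub>M\<^esub> a)) \<oplus> a"
    using assms by (simp add: smult_minus_one M.a_assoc M.l_neg)
  with c show "c \<in> N +> a" by (auto simp: a_r_coset_def')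
qed

lemma coset_mem_eq: "a \<in> carrier M \<Longrightarrow> c \<in> N +> a \<Longrightarrow> N +> c = N +> a"
  by (rule M.a_repr_independence[OF _ _ subgroup, symmetric])

lemma coset_self: "a \<in> carrier M \<Longrightarrow> a \<in> N +> a"
  by (simp add: mem_coset_iff smult_minus_one M.r_neg)

text \<open>The difference is spelled with the scalar -1 so that the criterion applies verbatim to
  \<open>chain_diff\<close>.\<close>

lemma coset_eq_iff:
  assumes "a \<in> carrier M" "b \<in> carrier M"
  shows "N +> a = N +> b \<longleftrightarrow> a \<oplus> ((\<ominus>\<^bsub>R\<^esub> \<one>\<^bsub>R\<^esub>) \<odot>\<^bsub>M\<^esub> b) \<in> N"
  using coset_mem_eq[OF assms(2), of a] coset_self[OF assms(1)] mem_coset_iff[OF assms(2), of a] assms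
  by auto

lemma coset_zero: "N +> \<zero> = N"
  by (simp add: a_subset)

lemma quot_module_carrier: "carrier (quot_module M N) = {N +> a | a. a \<in> carrier M}"
  by (auto simp: quot_module_def A_RCOSETS_def')

lemma quot_module_add:
  "a \<in> carrier M \<Longrightarrow> b \<in> carrier M \<Longrightarrow> (N +> a) \<oplus>\<^bsub>quot_module M N\<^esub> (N +> b) = N +> (a \<oplus> b)"
  by (simp add: quot_module_def a_rcos_sum)

text \<open>The left side is a union over all representatives of the coset. Changing a
  representative by an element of \<open>N\<close> changes its multiple by an element of
  \<open>N\<close>, so every term of the union is the same coset.\<close>

lemma quot_module_smult:
  assumes "r \<in> carrier R" "a \<in> carrier M"
  shows "r \<odot>\<^bsub>quot_module M N\<^esub> (N +> a) = N +> (r \<odot>\<^bsub>M\<^esub> a)"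
proof -
  have "N +> (r \<odot>\<^bsub>M\<^esub> c) = N +> (r \<odot>\<^bsub>M\<^esub> a)" if "c \<in> N +> a" for c
  proof -
    from that obtain n where n: "n \<in> N" "c = n \<oplus> a" by (auto simp: a_r_coset_def')
    then have "r \<odot>\<^bsub>M\<^esub> c = r \<odot>\<^bsub>M\<^esub> n \<oplus> r \<odot>\<^bsub>M\<^esub> a" "r \<odot>\<^bsub>M\<^esub> n \<in> N"
      using assms lsubmodule in_module by (auto simp: smult_r_distr lsubmodule_def)
    then have "r \<odot>\<^bsub>M\<^esub> c \<in> N +> (r \<odot>\<^bsub>M\<^esub> a)" by (auto simp: a_r_coset_def')
    then show ?thesis by (simp add: assms coset_mem_eq smult_closed)
  qed
  then show ?thesis
    using UN_eq_constant[OF coset_self[OF assms(2)], of "\<lambda>c. N +> (r \<odot>\<^bsub>M\<^esub> c)"]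
    by (simp add: quot_module_def)
qed

text \<open>Independence of the representative holds because \<open>f\<close> maps \<open>K\<close>
  into \<open>N\<close>. Two instances matter: the identity with a larger \<open>N\<close>, which
  gives the restriction maps, and the boundary, which gives the presheaf differential.\<close>

lemma quot_map_coset:
  assumes "left_submodule R L K" "a \<in> carrier L"
    and f: "f \<in> lmod_hom R L M" and K: "\<And>x. x \<in> K \<Longrightarrow> f x \<in> N"
  shows "quot_map M N f (K +>\<^bsub>L\<^esub> a) = N +> f a"
proof -
  interpret L: left_submodule R L K by fact
  have "N +> f c = N +> f a" if "c \<in> K +>\<^bsub>L\<^esub> a" for c
  proof -
    from that obtain n where n: "n \<in> K" "c = n \<oplus>\<^bsub>L\<^esub> a" by (auto simp: a_r_coset_def')
    then have "f c = f n \<oplus> f a"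
      using f assms(2) L.in_module by (auto simp: lmod_hom_def)
    then have "f c \<in> N +> f a" using n K by (auto simp: a_r_coset_def')
    then show ?thesis
      using f assms(2) by (auto intro!: coset_mem_eq simp: lmod_hom_def)
  qed
  then show ?thesis
    unfolding quot_map_def by (rule UN_eq_constant[OF L.coset_self[OF assms(2)]])
qed

end

section \<open>Regularity and lifts to a local coefficient system\<close>

text \<open>Cover the space by the complement of \<open>C\<close> and by the open sets that miss
  some neighborhood of \<open>a\<close>; the Hausdorff property puts each point of \<open>C\<close>
  into a set of the second kind. In a locally finite refinement, the members meeting
  \<open>C\<close> lie in such sets, so their closures avoid \<open>a\<close>. Local finiteness
  makes the closure of their union the union of their closures, so this union and the complement of
  its closure separate \<open>C\<close> from \<open>a\<close>.\<close>

lemma paracompact_Hausdorff_imp_regular_space: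
  assumes "paracompact_space X" "Hausdorff_space X"
  shows "regular_space X"
  unfolding regular_space_def
proof (intro allI impI)
  fix C a
  assume "closedin X C \<and> a \<in> topspace X - C"
  then have C: "closedin X C" "a \<in> topspace X" "a \<notin> C" by auto
  define \<U> where "\<U> = insert (topspace X - C)
    {U. openin X U \<and> (\<exists>V. openin X V \<and> a \<in> V \<and> disjnt U V)}"
  have "\<Union>\<U> = topspace X"
  proof (intro equalityI subsetI)
    fix x assume x: "x \<in> topspace X"
    show "x \<in> \<Union>\<U>"
    proof (cases "x \<in> C")
      case True
      then have "x \<noteq> a" using C by auto
      then obtain U V where "openin X U" "openin X V" "x \<in> U" "a \<in> V" "disjnt U V"
        using assms(2) x C by (metis Hausdorff_space_def)
      then show ?thesis unfolding \<U>_def by blast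
    qed (use x in \<open>auto simp: \<U>_def\<close>)
  qed (use openin_subset in \<open>force simp: \<U>_def\<close>)
  moreover have "\<forall>U\<in>\<U>. openin X U"
    using C by (auto simp: \<U>_def)
  ultimately have "\<exists>\<V>. (\<forall>V\<in>\<V>. openin X V) \<and> \<Union>\<V> = topspace X \<and>
      (\<forall>V\<in>\<V>. \<exists>U\<in>\<U>. V \<subseteq> U) \<and> locally_finite_in X \<V>"
    using assms(1) by (simp add: paracompact_space_def)
  then obtain \<V> where \<V>: "\<And>V. V \<in> \<V> \<Longrightarrow> openin X V" "\<Union>\<V> = topspace X"
      "\<And>V. V \<in> \<V> \<Longrightarrow> \<exists>U\<in>\<U>. V \<subseteq> U" "locally_finite_in X \<V>"
    by metis
  define \<W> where "\<W> = {V \<in> \<V>. V \<inter> C \<noteq> {}}"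
  have lf: "locally_finite_in X \<W>"
    by (rule locally_finite_in_subset[OF \<V>(4)]) (auto simp: \<W>_def)
  have "a \<notin> X closure_of V" if V: "V \<in> \<W>" for V
  proof -
    obtain U where U: "U \<in> \<U>" "V \<subseteq> U" using V \<V>(3) by (auto simp: \<W>_def)
    then obtain W where "openin X W" "a \<in> W" "disjnt U W"
      using V by (auto simp: \<U>_def \<W>_def)
    then show ?thesis using U by (auto simp: in_closure_of disjnt_iff)
  qed
  then have a: "a \<notin> X closure_of (\<Union>\<W>)"
    by (simp add: closure_of_locally_finite_Union[OF lf])
  have op: "openin X (\<Union>\<W>)" using \<V>(1) by (auto simp: \<W>_def)
  show "\<exists>U V. openin X U \<and> openin X V \<and> a \<in> U \<and> C \<subseteq> V \<and> disjnt U V"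
  proof (intro exI conjI)
    show "openin X (topspace X - X closure_of (\<Union>\<W>))"
      by (rule openin_diff) simp_all
    show "C \<subseteq> \<Union>\<W>"
      using \<V>(2) closedin_subset[OF C(1)] by (fastforce simp: \<W>_def)
    show "disjnt (topspace X - X closure_of (\<Union>\<W>)) (\<Union>\<W>)"
      using closure_of_subset[OF openin_subset[OF op]] by (auto simp: disjnt_iff)
  qed (use a C op in auto)
qed

text \<open>Control of the closure is what matters: the presheaf value at \<open>W\<close> divides
  by the chains supported outside the closure of \<open>W\<close>, not outside \<open>W\<close>
  itself.\<close>

lemma regular_space_closure_nbhd:
  assumes "regular_space X" "openin X V" "x \<in> V"
  obtains W where "openin X W" "x \<in> W" "X closure_of W \<subseteq> V"
proof -
  have "neighbourhood_base_of (closedin X) X"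
    using assms(1) neighbourhood_base_of_closedin by blast
  then obtain W K where "openin X W" "closedin X K" "x \<in> W" "W \<subseteq> K" "K \<subseteq> V"
    using assms(2,3) unfolding neighbourhood_base_of by metis
  then show ?thesis
    using that closure_of_minimal by (metis subset_trans)
qed

text \<open>This is the pasting lemma with the same function on every piece of the cover.\<close>

lemma continuous_map_locally:
  assumes "\<And>x. x \<in> topspace X \<Longrightarrow> \<exists>W. openin X W \<and> x \<in> W \<and> continuous_map (subtopology X W) Y f"
  shows "continuous_map X Y f"
proof -
  define I where "I = {W. openin X W \<and> continuous_map (subtopology X W) Y f}"
  show ?thesis
    by (rule pasting_lemma[where I=I and T=id and f="\<lambda>_. f"]) (use assms in \<open>auto simp: I_def\<close>)
qed

section \<open>Lifts to the bundle, through local constancy in charts\<close>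

locale local_coefficients =
  fixes R :: "('r, 'k) ring_scheme" and B :: "'a topology" and G :: "('a, 'r, 'e) module_bundle"
  assumes lcs: "local_coefficient_system R B G"
begin

lemma fibre_module: "x \<in> topspace B \<Longrightarrow> left_module R (fibre G x)"
  using lcs by (simp add: local_coefficient_system_def)

lemma carrier_fibre: "x \<in> topspace B \<Longrightarrow> carrier (fibre G x) = {e \<in> topspace (total G). proj G e = x}"
  using lcs by (simp add: local_coefficient_system_def)

definition trivialization :: "'a \<Rightarrow> 'a set \<Rightarrow> ('a \<times> 'e \<Rightarrow> 'e) \<Rightarrow> bool" where
  "trivialization x U h \<longleftrightarrow> openin B U \<and> x \<in> U \<and>
        homeomorphic_map
          (prod_topology (subtopology B U) (discrete_topology (carrier (fibre G x))))
          (subtopology (total G) {e \<in> topspace (total G). proj G e \<in> U}) h \<and>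
        (\<forall>y\<in>U. (\<lambda>v. h (y, v)) \<in> lmod_iso R (fibre G x) (fibre G y))"

lemma trivialization_exists: "x \<in> topspace B \<Longrightarrow> \<exists>U h. trivialization x U h"
  using lcs unfolding local_coefficient_system_def trivialization_def by blast

text \<open>Membership in the fibre encodes that \<open>c\<close> covers \<open>f\<close>. Nothing
  is said about points outside \<open>T\<close>; for coefficients of simplices extensionality is
  added separately in \<open>coeff_carrier_iff\<close>.\<close>

definition is_lift :: "'t topology \<Rightarrow> ('t \<Rightarrow> 'a) \<Rightarrow> ('t \<Rightarrow> 'e) \<Rightarrow> bool" where
  "is_lift T f c \<longleftrightarrow> continuous_map T (total G) c \<and> (\<forall>t\<in>topspace T. c t \<in> carrier (fibre G (f t)))"

text \<open>In a chart a lift becomes a pair of a base point and a fibre element. The second entry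
  is a continuous map into a discrete space, hence constant near \<open>t0\<close>.\<close>

lemma lift_locally_constant:
  assumes f: "continuous_map T B f" and c: "is_lift T f c" and t0: "t0 \<in> topspace T"
    and h: "trivialization (f t0) U h"
  shows "\<exists>W v. openin T W \<and> t0 \<in> W \<and> f ` W \<subseteq> U \<and> v \<in> carrier (fibre G (f t0)) \<and>
    (\<forall>t\<in>W. c t = h (f t, v))"
proof -
  let ?P = "prod_topology (subtopology B U) (discrete_topology (carrier (fibre G (f t0))))"
  let ?E = "subtopology (total G) {e \<in> topspace (total G). proj G e \<in> U}"
  obtain g where g: "homeomorphic_maps ?P ?E h g"
    using h by (auto simp: trivialization_def homeomorphic_map_maps)
  then have gc: "continuous_map ?E ?P g" and hg: "\<And>e. e \<in> topspace ?E \<Longrightarrow> h (g e) = e"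
    by (auto simp: homeomorphic_maps_def)
  have U: "openin B U" "f t0 \<in> U" using h by (auto simp: trivialization_def)
  have fB: "f t \<in> topspace B" if "t \<in> topspace T" for t
    using f that by (auto simp: continuous_map_def)
  define T' where "T' = {t \<in> topspace T. f t \<in> U}"
  have T': "openin T T'"
    unfolding T'_def using f U by (auto simp: continuous_map_def)
  have cE: "c t \<in> topspace (total G)" "proj G (c t) = f t" if "t \<in> topspace T" for t
    using c that carrier_fibre[OF fB[OF that]] by (auto simp: is_lift_def)
  have c': "continuous_map (subtopology T T') ?E c"
    using c cE by (auto simp: is_lift_def continuous_map_in_subtopology continuous_map_from_subtopology T'_def)
  define v where "v = snd (g (c t0))"
  have sc: "continuous_map (subtopology T T') (discrete_topology (carrier (fibre G (f t0)))) (\<lambda>t. snd (g (c t)))"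
    using continuous_map_compose[OF continuous_map_compose[OF c' gc] continuous_map_snd]
    by (simp add: o_def)
  have "t0 \<in> topspace (subtopology T T')" using t0 U by (simp add: T'_def)
  then have v: "v \<in> carrier (fibre G (f t0))"
    using continuous_map_funspace[OF sc] by (auto simp: v_def)
  have "openin (subtopology T T') {t \<in> topspace (subtopology T T'). snd (g (c t)) \<in> {v}}"
    by (rule openin_continuous_map_preimage[OF sc]) (use v in simp)
  then have "openin T {t \<in> topspace (subtopology T T'). snd (g (c t)) \<in> {v}}"
    using T' openin_trans_full by blast
  moreover have "{t \<in> topspace (subtopology T T'). snd (g (c t)) \<in> {v}} = {t \<in> T'. snd (g (c t)) = v}"
    by (auto simp: T'_def)
  ultimately have W: "openin T {t \<in> T'. snd (g (c t)) = v}" by simp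
  have eq: "c t = h (f t, v)" if "t \<in> T'" "snd (g (c t)) = v" for t
  proof -
    have t: "t \<in> topspace T" "f t \<in> U" using that by (auto simp: T'_def)
    have "c t \<in> topspace ?E" using cE t by auto
    then have e: "h (g (c t)) = c t" "g (c t) \<in> topspace ?P"
      using hg gc by (auto simp: continuous_map_def)
    then have y: "fst (g (c t)) \<in> U" "fst (g (c t)) \<in> topspace B"
      by (auto simp: mem_Times_iff)
    have "h (fst (g (c t)), v) \<in> carrier (fibre G (fst (g (c t))))"
      using h v y by (auto simp: trivialization_def lmod_iso_def lmod_hom_def)
    \<comment> \<open>The map \<open>h\<close> carries the slice over \<open>y\<close> into the
      fibre over \<open>y\<close>, so the first entry of \<open>g (c t)\<close> is the projection of
      \<open>c t\<close>, which is \<open>f t\<close>.\<close>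
    then have "proj G (c t) = fst (g (c t))"
      using carrier_fibre[OF y(2)] e that by (metis (mono_tags, lifting) mem_Collect_eq prod.collapse)
    then show ?thesis using cE(2)[OF t(1)] e that by (metis prod.collapse)
  qed
  show ?thesis
    by (rule exI[of _ "{t \<in> T'. snd (g (c t)) = v}"], rule exI[of _ v])
      (use W v eq t0 U in \<open>auto simp: T'_def v_def\<close>)
qed

text \<open>With the converse above, continuity of a lift turns into a condition on constants in
  charts. This is how continuity of module operations is obtained: the definition of the bundle
  speaks only of charts that are linear on fibres. The chart may vary with the point.\<close>

lemma locally_constant_lift:
  assumes f: "continuous_map T B f"
    and *: "\<And>t0. t0 \<in> topspace T \<Longrightarrow> \<exists>W v U h. trivialization (f t0) U h \<and> openin T W \<and> t0 \<in> W \<and>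
      f ` W \<subseteq> U \<and> v \<in> carrier (fibre G (f t0)) \<and> (\<forall>t\<in>W. c t = h (f t, v))"
  shows "is_lift T f c"
proof -
  have "(\<exists>W. openin T W \<and> t0 \<in> W \<and> continuous_map (subtopology T W) (total G) c) \<and>
      c t0 \<in> carrier (fibre G (f t0))" if t0: "t0 \<in> topspace T" for t0
  proof -
    obtain W v U h where h: "trivialization (f t0) U h" and W: "openin T W" "t0 \<in> W" "f ` W \<subseteq> U"
      "v \<in> carrier (fibre G (f t0))" "\<forall>t\<in>W. c t = h (f t, v)"
      using *[OF t0] by blast
    let ?P = "prod_topology (subtopology B U) (discrete_topology (carrier (fibre G (f t0))))"
    have "continuous_map (subtopology T W) ?P (\<lambda>t. (f t, v))"
      using f W(3,4) by (auto simp: continuous_map_paired continuous_map_in_subtopology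
          continuous_map_from_subtopology)
    moreover have "continuous_map ?P (total G) h"
      using h by (auto simp: trivialization_def continuous_map_in_subtopology
          dest: homeomorphic_imp_continuous_map)
    ultimately have "continuous_map (subtopology T W) (total G) (\<lambda>t. h (f t, v))"
      using continuous_map_compose by (fastforce simp: o_def)
    then have "continuous_map (subtopology T W) (total G) c"
      by (rule continuous_map_eq) (use W in auto)
    moreover have "c t0 \<in> carrier (fibre G (f t0))"
      using h W by (auto simp: trivialization_def lmod_iso_def lmod_hom_def)
    ultimately show ?thesis using W by blast
  qed
  then show ?thesis
    by (auto simp: is_lift_def intro: continuous_map_locally)
qed

text \<open>In a common chart the two lifts are given by constants \<open>v\<close> and
  \<open>w\<close>. Since every \<open>h (y, -)\<close> is additive, their sum is given by the sum
  of \<open>v\<close> and \<open>w\<close>.\<close>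

lemma lift_add:
  assumes f: "continuous_map T B f" and c: "is_lift T f c" and d: "is_lift T f d"
  shows "is_lift T f (\<lambda>t. c t \<oplus>\<^bsub>fibre G (f t)\<^esub> d t)"
proof (rule locally_constant_lift[OF f])
  fix t0 assume t0: "t0 \<in> topspace T"
  have x: "f t0 \<in> topspace B" using f t0 by (auto simp: continuous_map_def)
  interpret left_module R "fibre G (f t0)" using fibre_module[OF x] .
  obtain U h where h: "trivialization (f t0) U h" using trivialization_exists[OF x] by blast
  obtain W1 v where 1: "openin T W1" "t0 \<in> W1" "f ` W1 \<subseteq> U" "v \<in> carrier (fibre G (f t0))"
      "\<forall>t\<in>W1. c t = h (f t, v)"
    using lift_locally_constant[OF f c t0 h] by blast
  obtain W2 w where 2: "openin T W2" "t0 \<in> W2" "f ` W2 \<subseteq> U" "w \<in> carrier (fibre G (f t0))"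
      "\<forall>t\<in>W2. d t = h (f t, w)"
    using lift_locally_constant[OF f d t0 h] by blast
  have "c t \<oplus>\<^bsub>fibre G (f t)\<^esub> d t = h (f t, v \<oplus>\<^bsub>fibre G (f t0)\<^esub> w)" if "t \<in> W1 \<inter> W2" for t
    using h 1 2 that by (auto simp: trivialization_def lmod_iso_def lmod_hom_def)
  then show "\<exists>W v U h. trivialization (f t0) U h \<and> openin T W \<and> t0 \<in> W \<and>
      f ` W \<subseteq> U \<and> v \<in> carrier (fibre G (f t0)) \<and>
      (\<forall>t\<in>W. c t \<oplus>\<^bsub>fibre G (f t)\<^esub> d t = h (f t, v))"
    using h 1 2
    by (intro exI[of _ "W1 \<inter> W2"] exI[of _ "v \<oplus>\<^bsub>fibre G (f t0)\<^esub> w"] exI[of _ U] exI[of _ h])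
      (auto simp: M.a_closed)
qed

lemma lift_smult:
  assumes f: "continuous_map T B f" and c: "is_lift T f c" and r: "r \<in> carrier R"
  shows "is_lift T f (\<lambda>t. r \<odot>\<^bsub>fibre G (f t)\<^esub> c t)"
proof (rule locally_constant_lift[OF f])
  fix t0 assume t0: "t0 \<in> topspace T"
  have x: "f t0 \<in> topspace B" using f t0 by (auto simp: continuous_map_def)
  interpret left_module R "fibre G (f t0)" using fibre_module[OF x] .
  obtain U h where h: "trivialization (f t0) U h" using trivialization_exists[OF x] by blast
  obtain W v where 1: "openin T W" "t0 \<in> W" "f ` W \<subseteq> U" "v \<in> carrier (fibre G (f t0))"
      "\<forall>t\<in>W. c t = h (f t, v)"
    using lift_locally_constant[OF f c t0 h] by blast
  have "r \<odot>\<^bsub>fibre G (f t)\<^esub> c t = h (f t, r \<odot>\<^bsub>fibre G (f t0)\<^esub> v)" if "t \<in> W" for t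
    using h 1 that r by (auto simp: trivialization_def lmod_iso_def lmod_hom_def)
  then show "\<exists>W v U h. trivialization (f t0) U h \<and> openin T W \<and> t0 \<in> W \<and>
      f ` W \<subseteq> U \<and> v \<in> carrier (fibre G (f t0)) \<and>
      (\<forall>t\<in>W. r \<odot>\<^bsub>fibre G (f t)\<^esub> c t = h (f t, v))"
    using h 1 r
    by (intro exI[of _ W] exI[of _ "r \<odot>\<^bsub>fibre G (f t0)\<^esub> v"] exI[of _ U] exI[of _ h])
      (auto simp: smult_closed)
qed

lemma lift_zero:
  assumes f: "continuous_map T B f"
  shows "is_lift T f (\<lambda>t. \<zero>\<^bsub>fibre G (f t)\<^esub>)"
proof (rule locally_constant_lift[OF f])
  fix t0 assume t0: "t0 \<in> topspace T"
  have x: "f t0 \<in> topspace B" using f t0 by (auto simp: continuous_map_def)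
  interpret left_module R "fibre G (f t0)" using fibre_module[OF x] .
  obtain U h where h: "trivialization (f t0) U h" using trivialization_exists[OF x] by blast
  have U: "openin B U" "f t0 \<in> U" using h by (auto simp: trivialization_def)
  have W: "openin T {t \<in> topspace T. f t \<in> U}" using f U by (auto simp: continuous_map_def)
  have eq: "\<zero>\<^bsub>fibre G y\<^esub> = h (y, \<zero>\<^bsub>fibre G (f t0)\<^esub>)" if y: "y \<in> U" for y
  proof -
    interpret y: left_module R "fibre G y"
      using fibre_module y openin_subset[OF U(1)] by blast
    have "(\<lambda>v. h (y, v)) \<in> lmod_hom R (fibre G (f t0)) (fibre G y)"
      using h y by (auto simp: trivialization_def lmod_iso_def)
    \<comment> \<open>\<open>lmod_hom\<close> mentions only sums and scalar multiples. That zero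
      goes to zero is obtained by writing zero as its own multiple by the scalar zero.\<close>
    then have "h (y, \<zero>\<^bsub>R\<^esub> \<odot>\<^bsub>fibre G (f t0)\<^esub> \<zero>\<^bsub>fibre G (f t0)\<^esub>) =
        \<zero>\<^bsub>R\<^esub> \<odot>\<^bsub>fibre G y\<^esub> h (y, \<zero>\<^bsub>fibre G (f t0)\<^esub>)"
      and "h (y, \<zero>\<^bsub>fibre G (f t0)\<^esub>) \<in> carrier (fibre G y)"
      using R.zero_closed M.zero_closed unfolding lmod_hom_def by blast+
    then show ?thesis using y.zero_smult zero_smult[OF M.zero_closed] by simp
  qed
  show "\<exists>W v U h. trivialization (f t0) U h \<and> openin T W \<and> t0 \<in> W \<and>
      f ` W \<subseteq> U \<and> v \<in> carrier (fibre G (f t0)) \<and>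
      (\<forall>t\<in>W. \<zero>\<^bsub>fibre G (f t)\<^esub> = h (f t, v))"
  proof (intro exI conjI ballI)
    show "\<zero>\<^bsub>fibre G (f t)\<^esub> = h (f t, \<zero>\<^bsub>fibre G (f t0)\<^esub>)" if "t \<in> {t \<in> topspace T. f t \<in> U}" for t
      using eq that by blast
  qed (use h W t0 U M.zero_closed in auto)
qed

lemma lift_cong:
  assumes "is_lift T f c" "\<And>t. t \<in> topspace T \<Longrightarrow> c t = d t"
  shows "is_lift T f d"
  using assms by (auto simp: is_lift_def intro: continuous_map_eq)

lemma lift_alt_sign:
  assumes f: "continuous_map T B f" and c: "is_lift T f c"
  shows "is_lift T f (\<lambda>t. alt_sign (fibre G (f t)) k (c t))"
\<comment> \<open>For odd \<open>k\<close> the sign is multiplication by -1, and the ring axioms of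
  \<open>R\<close> are extracted from a fibre. That requires a point of \<open>T\<close>, so an
  empty \<open>T\<close> is set apart.\<close>
proof (cases "even k \<or> topspace T = {}")
  case True
  then show ?thesis using c by (auto simp: alt_sign_def is_lift_def)
next
  case False
  have m: "left_module R (fibre G (f t))" if "t \<in> topspace T" for t
    using f that fibre_module by (auto simp: continuous_map_def)
  then interpret R: ring R using False by (meson ex_in_conv left_module.axioms(1))
  show ?thesis
    by (rule lift_cong[OF lift_smult[OF f c R.add.inv_closed[OF R.one_closed]]])
      (use c False m in \<open>auto simp: alt_sign_def is_lift_def left_module.smult_minus_one\<close>)
qed

lemma lift_finsum:
  assumes f: "continuous_map T B f" and c: "\<And>i. i \<in> A \<Longrightarrow> is_lift T f (c i)"
  shows "is_lift T f (\<lambda>t. finsum (fibre G (f t)) (\<lambda>i. c i t) A)"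
  using c
proof (induction A rule: infinite_finite_induct)
  case (insert a A)
  have m: "left_module R (fibre G (f t))" if "t \<in> topspace T" for t
    using f that fibre_module by (auto simp: continuous_map_def)
  have "is_lift T f (\<lambda>t. c a t \<oplus>\<^bsub>fibre G (f t)\<^esub> finsum (fibre G (f t)) (\<lambda>i. c i t) A)"
    using insert by (intro lift_add[OF f]) auto
  then show ?case
  proof (rule lift_cong)
    fix t assume t: "t \<in> topspace T"
    interpret left_module R "fibre G (f t)" using m[OF t] .
    show "c a t \<oplus>\<^bsub>fibre G (f t)\<^esub> finsum (fibre G (f t)) (\<lambda>i. c i t) A =
        finsum (fibre G (f t)) (\<lambda>i. c i t) (insert a A)"
      using insert t by (subst M.finsum_insert) (auto simp: is_lift_def)
  qed
next
  case (infinite A)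
  have "finsum (fibre G (f t)) (\<lambda>i. c i t) A = \<zero>\<^bsub>fibre G (f t)\<^esub>" for t
    using infinite by (simp add: finsum_def finprod_def)
  then show ?case using lift_zero[OF f] by simp
next
  case empty
  have "finsum (fibre G (f t)) (\<lambda>i. c i t) {} = \<zero>\<^bsub>fibre G (f t)\<^esub>" if "t \<in> topspace T" for t
  proof -
    interpret left_module R "fibre G (f t)" using f that fibre_module by (auto simp: continuous_map_def)
    show ?thesis by simp
  qed
  then show ?case by (intro lift_cong[OF lift_zero[OF f]]) auto
qed

end

section \<open>Locally finite chains and their boundary\<close>

text \<open>Grouping by the value of \<open>h\<close> is used to flatten the double sum in the
  iterated boundary into one sum over triples.\<close>

lemma (in abelian_monoid) finsum_fibres:
  assumes "finite D" "g \<in> D \<rightarrow> carrier G"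
  shows "finsum G g D = finsum G (\<lambda>y. finsum G g {x \<in> D. h x = y}) (h ` D)"
proof -
  have "finsum G g (\<Union>y\<in>h ` D. {x \<in> D. h x = y}) = finsum G (\<lambda>y. finsum G g {x \<in> D. h x = y}) (h ` D)"
    by (rule add.finprod_UN_disjoint) (use assms in \<open>auto simp: pairwise_def disjnt_iff\<close>)
  moreover have "(\<Union>y\<in>h ` D. {x \<in> D. h x = y}) = D" by auto
  ultimately show ?thesis by simp
qed

text \<open>\<open>D1\<close> holds one member of each cancelling pair, and \<open>\<phi>\<close>
  produces its partner.\<close>

lemma (in left_module) finsum_cancel:
  assumes "finite D1" "D1 \<inter> \<phi> ` D1 = {}" "inj_on \<phi> D1"
    and "\<And>x. x \<in> D1 \<Longrightarrow> g x \<in> carrier M"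
    and "\<And>x. x \<in> D1 \<Longrightarrow> g (\<phi> x) = \<ominus>\<^bsub>M\<^esub> g x"
  shows "finsum M g (D1 \<union> \<phi> ` D1) = \<zero>\<^bsub>M\<^esub>"
proof -
  have "finsum M g (\<phi> ` D1) = finsum M (\<lambda>x. g (\<phi> x)) D1"
    by (rule M.finsum_reindex) (use assms in auto)
  also have "\<dots> = finsum M (\<lambda>x. \<ominus>\<^bsub>M\<^esub> g x) D1"
    by (rule M.finsum_cong') (use assms in auto)
  also have "\<dots> = \<ominus>\<^bsub>M\<^esub> finsum M g D1"
    by (rule finsum_minus) (use assms in auto)
  finally have *: "finsum M g (\<phi> ` D1) = \<ominus>\<^bsub>M\<^esub> finsum M g D1" .
  have "finsum M g (D1 \<union> \<phi> ` D1) = finsum M g D1 \<oplus>\<^bsub>M\<^esub> finsum M g (\<phi> ` D1)"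
    by (rule M.finsum_Un_disjoint) (use assms in auto)
  also have "\<dots> = \<zero>\<^bsub>M\<^esub>"
    unfolding * using assms by (intro M.r_neg M.finsum_closed) auto
  finally show ?thesis .
qed

text \<open>This is the cosimplicial identity. \<open>simplical_face k\<close> inserts a zero at
  position \<open>k\<close>; inserting the later zero first requires its position to be lowered by
  one.\<close>

lemma simplical_face_simplical_face:
  "j < k \<Longrightarrow> simplical_face k (simplical_face j t) = simplical_face j (simplical_face (k - 1) t)"
proof (rule ext)
  fix i assume "j < k"
  then obtain m where k: "k = Suc m" "j \<le> m" by (cases k) auto
  consider "i < j" | "i = j" | "j < i" "i < k" | "j < i" "i = k" | "j < i" "k < i" by linarith
  then show "simplical_face k (simplical_face j t) i = simplical_face j (simplical_face (k - 1) t) i"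
    using k by cases (auto simp: simplical_face_def)
qed

lemma continuous_map_simplical_face:
  "continuous_map (powertop_real UNIV) (powertop_real UNIV) (simplical_face k)"
proof -
  have "continuous_map (powertop_real UNIV) euclideanreal (\<lambda>x. simplical_face k x i)" for i
    unfolding simplical_face_def by (auto intro: continuous_map_product_projection)
  then show ?thesis
    by (simp add: continuous_map_componentwise_UNIV)
qed

lemma singular_face_apply:
  "t \<in> standard_simplex (n - Suc 0) \<Longrightarrow> singular_face n j \<sigma> t = \<sigma> (simplical_face j t)"
  by (simp add: singular_face_def)

abbreviation (input) "regular_stratum X \<equiv> subtopology (fs_top X) (topspace (fs_top X) - sing_set X)"

text \<open>Allowability is left to a later locale: the boundary and its square concern all locally
  finite chains. The Hausdorff assumption makes the compact images of simplices closed.\<close>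

locale filtered_coefficients =
  fixes R :: "('r, 'k) ring_scheme" and X :: "'a filtered_space" and G :: "('a, 'r, 'e) module_bundle"
  assumes ring: "ring R" and Hausdorff: "Hausdorff_space (fs_top X)"
    and coefficients: "local_coefficient_system R (regular_stratum X) G"
begin

sublocale local_coefficients R "regular_stratum X" G
  by standard (rule coefficients)

abbreviation regular_top where
  "regular_top i \<sigma> \<equiv> subtopology (powertop_real UNIV) (regular_part X i \<sigma>)"

lemma simplex_continuous:
  "\<sigma> \<in> simplices X i \<Longrightarrow> continuous_map (subtopology (powertop_real UNIV) (standard_simplex (nat i))) (fs_top X) \<sigma>"
  by (simp add: simplices_def singular_simplex_def)

lemma simplex_mem: "\<sigma> \<in> simplices X i \<Longrightarrow> t \<in> standard_simplex (nat i) \<Longrightarrow> \<sigma> t \<in> topspace (fs_top X)"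
  using simplex_continuous[THEN continuous_map_funspace] by fastforce

lemma simplex_image_mem:
  "\<sigma> \<in> simplices X i \<Longrightarrow> x \<in> \<sigma> ` standard_simplex (nat i) \<Longrightarrow> x \<in> topspace (fs_top X)"
  using simplex_mem by auto

lemma simplex_compact:
  "\<sigma> \<in> simplices X i \<Longrightarrow> compactin (fs_top X) (\<sigma> ` standard_simplex (nat i))"
  by (rule image_compactin[OF _ simplex_continuous[of _ i]])
    (simp_all add: compactin_subtopology compactin_standard_simplex)

lemma simplex_closed:
  "\<sigma> \<in> simplices X i \<Longrightarrow> closedin (fs_top X) (\<sigma> ` standard_simplex (nat i))"
  using simplex_compact Hausdorff compactin_imp_closedin by blast

lemma simplex_connected:
  "\<sigma> \<in> simplices X i \<Longrightarrow> connectedin (fs_top X) (\<sigma> ` standard_simplex (nat i))"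
  by (rule connectedin_continuous_map_image[OF simplex_continuous[of _ i]])
    (simp_all add: connectedin_subtopology connectedin_standard_simplex)

lemma regular_continuous:
  assumes "\<sigma> \<in> simplices X i"
  shows "continuous_map (regular_top i \<sigma>) (regular_stratum X) \<sigma>"
proof -
  have "regular_part X i \<sigma> \<subseteq> standard_simplex (nat i)" by (auto simp: regular_part_def)
  then have "continuous_map (regular_top i \<sigma>) (fs_top X) \<sigma>"
    using simplex_continuous[OF assms] continuous_map_from_subtopology_mono by blast
  then show ?thesis
    using simplex_mem[OF assms] by (auto simp: continuous_map_in_subtopology regular_part_def)
qed

lemma regular_point:
  "\<sigma> \<in> simplices X i \<Longrightarrow> t \<in> regular_part X i \<sigma> \<Longrightarrow> \<sigma> t \<in> topspace (regular_stratum X)"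
  using simplex_mem by (auto simp: regular_part_def)

lemma regular_fibre:
  "\<sigma> \<in> simplices X i \<Longrightarrow> t \<in> regular_part X i \<sigma> \<Longrightarrow> left_module R (fibre G (\<sigma> t))"
  using regular_point fibre_module by blast

lemma coeff_carrier_iff:
  "c \<in> carrier (coeff_module X G i \<sigma>) \<longleftrightarrow> c \<in> extensional (regular_part X i \<sigma>) \<and> is_lift (regular_top i \<sigma>) \<sigma> c"
  by (auto simp: coeff_module_def is_lift_def PiE_iff)

lemma restrict_lift:
  "is_lift (regular_top i \<sigma>) \<sigma> c \<Longrightarrow> (\<lambda>t\<in>regular_part X i \<sigma>. c t) \<in> carrier (coeff_module X G i \<sigma>)"
  unfolding coeff_carrier_iff by (auto intro: lift_cong)

lemma coeff_ops:
  "\<zero>\<^bsub>coeff_module X G i \<sigma>\<^esub> = (\<lambda>t\<in>regular_part X i \<sigma>. \<zero>\<^bsub>fibre G (\<sigma> t)\<^esub>)"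
  "c \<oplus>\<^bsub>coeff_module X G i \<sigma>\<^esub> d = (\<lambda>t\<in>regular_part X i \<sigma>. c t \<oplus>\<^bsub>fibre G (\<sigma> t)\<^esub> d t)"
  "r \<odot>\<^bsub>coeff_module X G i \<sigma>\<^esub> c = (\<lambda>t\<in>regular_part X i \<sigma>. r \<odot>\<^bsub>fibre G (\<sigma> t)\<^esub> c t)"
  by (simp_all add: coeff_module_def prod_module_def)

lemma coeff_left_module:
  assumes \<sigma>: "\<sigma> \<in> simplices X i"
  shows "left_module R (coeff_module X G i \<sigma>)"
proof -
  let ?P = "prod_module (regular_part X i \<sigma>) (\<lambda>t. fibre G (\<sigma> t))"
  have eq: "coeff_module X G i \<sigma> = ?P\<lparr>carrier := carrier (coeff_module X G i \<sigma>)\<rparr>"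
    by (simp add: coeff_module_def)
  note cont = regular_continuous[OF \<sigma>]
  have "lsubmodule R (carrier (coeff_module X G i \<sigma>)) ?P"
    unfolding lsubmodule_def
  proof (intro conjI ballI)
    show "carrier (coeff_module X G i \<sigma>) \<subseteq> carrier ?P"
      by (auto simp: coeff_module_def prod_module_def)
    show "\<zero>\<^bsub>?P\<^esub> \<in> carrier (coeff_module X G i \<sigma>)"
      using restrict_lift[OF lift_zero[OF cont]] by (simp add: prod_module_def)
    show "c \<oplus>\<^bsub>?P\<^esub> d \<in> carrier (coeff_module X G i \<sigma>)"
      if "c \<in> carrier (coeff_module X G i \<sigma>)" "d \<in> carrier (coeff_module X G i \<sigma>)" for c d
      using restrict_lift[OF lift_add[OF cont]] that by (simp add: prod_module_def coeff_carrier_iff)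
    show "r \<odot>\<^bsub>?P\<^esub> c \<in> carrier (coeff_module X G i \<sigma>)"
      if "r \<in> carrier R" "c \<in> carrier (coeff_module X G i \<sigma>)" for c r
      using restrict_lift[OF lift_smult[OF cont]] that by (simp add: prod_module_def coeff_carrier_iff)
  qed
  moreover have "left_module R ?P"
    by (rule prod_module_left_module[OF ring regular_fibre[OF \<sigma>]])
  ultimately show ?thesis
    by (subst eq) (rule lsubmodule_left_module)
qed

section \<open>The module of locally finite chains\<close>

lemma lf_chains_iff:
  "\<xi> \<in> carrier (lf_chains X G i) \<longleftrightarrow> \<xi> \<in> (\<Pi>\<^sub>E \<sigma>\<in>simplices X i. carrier (coeff_module X G i \<sigma>)) \<and>
    (\<forall>x\<in>topspace (fs_top X). \<exists>V. openin (fs_top X) V \<and> x \<in> V \<and>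
      finite {\<sigma> \<in> chain_simplices X G i \<xi>. \<sigma> ` standard_simplex (nat i) \<inter> V \<noteq> {}})"
  by (simp add: lf_chains_def)

lemma lf_chains_ops:
  "\<zero>\<^bsub>lf_chains X G i\<^esub> = (\<lambda>\<sigma>\<in>simplices X i. \<zero>\<^bsub>coeff_module X G i \<sigma>\<^esub>)"
  "\<xi> \<oplus>\<^bsub>lf_chains X G i\<^esub> \<eta> = (\<lambda>\<sigma>\<in>simplices X i. \<xi> \<sigma> \<oplus>\<^bsub>coeff_module X G i \<sigma>\<^esub> \<eta> \<sigma>)"
  "r \<odot>\<^bsub>lf_chains X G i\<^esub> \<xi> = (\<lambda>\<sigma>\<in>simplices X i. r \<odot>\<^bsub>coeff_module X G i \<sigma>\<^esub> \<xi> \<sigma>)"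
  by (simp_all add: lf_chains_def prod_module_def)

lemma lf_chain_coeff:
  "\<xi> \<in> carrier (lf_chains X G i) \<Longrightarrow> \<sigma> \<in> simplices X i \<Longrightarrow> \<xi> \<sigma> \<in> carrier (coeff_module X G i \<sigma>)"
  by (auto simp: lf_chains_iff)

lemma lf_chain_value:
  "\<xi> \<in> carrier (lf_chains X G i) \<Longrightarrow> \<sigma> \<in> simplices X i \<Longrightarrow> t \<in> regular_part X i \<sigma> \<Longrightarrow>
    \<xi> \<sigma> t \<in> carrier (fibre G (\<sigma> t))"
  using lf_chain_coeff by (fastforce simp: coeff_carrier_iff is_lift_def)

lemma lf_chain_eqI:
  assumes "\<xi> \<in> carrier (lf_chains X G i)" "\<eta> \<in> carrier (lf_chains X G i)"
    and "\<And>\<sigma>. \<sigma> \<in> simplices X i \<Longrightarrow> \<xi> \<sigma> = \<eta> \<sigma>"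
  shows "\<xi> = \<eta>"
  by (rule extensionalityI[of _ "simplices X i"]) (use assms in \<open>auto simp: lf_chains_iff PiE_iff\<close>)

lemma chain_simplices_subset: "chain_simplices X G i \<xi> \<subseteq> simplices X i"
  by (auto simp: chain_simplices_def)

lemma chain_simplices_zero: "chain_simplices X G i \<zero>\<^bsub>lf_chains X G i\<^esub> = {}"
  by (auto simp: chain_simplices_def lf_chains_ops)

lemma chain_simplices_add:
  "chain_simplices X G i (\<xi> \<oplus>\<^bsub>lf_chains X G i\<^esub> \<eta>) \<subseteq> chain_simplices X G i \<xi> \<union> chain_simplices X G i \<eta>"
proof
  fix \<sigma> assume *: "\<sigma> \<in> chain_simplices X G i (\<xi> \<oplus>\<^bsub>lf_chains X G i\<^esub> \<eta>)"
  then have \<sigma>: "\<sigma> \<in> simplices X i" by (simp add: chain_simplices_def)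
  interpret left_module R "coeff_module X G i \<sigma>" using coeff_left_module[OF \<sigma>] .
  show "\<sigma> \<in> chain_simplices X G i \<xi> \<union> chain_simplices X G i \<eta>"
    using * by (auto simp: chain_simplices_def lf_chains_ops)
qed

lemma chain_simplices_smult:
  assumes "r \<in> carrier R"
  shows "chain_simplices X G i (r \<odot>\<^bsub>lf_chains X G i\<^esub> \<xi>) \<subseteq> chain_simplices X G i \<xi>"
proof
  fix \<sigma> assume *: "\<sigma> \<in> chain_simplices X G i (r \<odot>\<^bsub>lf_chains X G i\<^esub> \<xi>)"
  then have \<sigma>: "\<sigma> \<in> simplices X i" by (simp add: chain_simplices_def)
  interpret left_module R "coeff_module X G i \<sigma>" using coeff_left_module[OF \<sigma>] .
  show "\<sigma> \<in> chain_simplices X G i \<xi>"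
    using * assms by (auto simp: chain_simplices_def lf_chains_ops smult_zero)
qed

lemma lf_chains_left_module: "left_module R (lf_chains X G i)"
proof -
  let ?P = "prod_module (simplices X i) (coeff_module X G i)"
  let ?L = "lf_chains X G i"
  have eq: "?L = ?P\<lparr>carrier := carrier ?L\<rparr>" by (simp add: lf_chains_def)
  have P: "left_module R ?P"
    by (rule prod_module_left_module[OF ring coeff_left_module])
  interpret P: left_module R ?P by (fact P)
  have ops: "\<zero>\<^bsub>?P\<^esub> = \<zero>\<^bsub>?L\<^esub>" "\<xi> \<oplus>\<^bsub>?P\<^esub> \<eta> = \<xi> \<oplus>\<^bsub>?L\<^esub> \<eta>" "r \<odot>\<^bsub>?P\<^esub> \<xi> = r \<odot>\<^bsub>?L\<^esub> \<xi>" for r \<xi> \<eta>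
    by (simp_all add: lf_chains_def)
  have sub: "carrier ?L \<subseteq> carrier ?P"
    by (auto simp: lf_chains_def prod_module_def)
  have Pc: "carrier ?P = (\<Pi>\<^sub>E \<sigma>\<in>simplices X i. carrier (coeff_module X G i \<sigma>))"
    by (simp add: prod_module_def)
  have "lsubmodule R (carrier ?L) ?P"
    unfolding lsubmodule_def
  proof (intro conjI ballI)
    show "\<zero>\<^bsub>?P\<^esub> \<in> carrier ?L"
      using P.M.zero_closed unfolding lf_chains_iff Pc[symmetric] unfolding ops
      by (auto simp: chain_simplices_zero)
    show "\<xi> \<oplus>\<^bsub>?P\<^esub> \<eta> \<in> carrier ?L" if \<xi>: "\<xi> \<in> carrier ?L" and \<eta>: "\<eta> \<in> carrier ?L" for \<xi> \<eta>
      unfolding lf_chains_iff Pc[symmetric]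
    proof (intro conjI ballI)
      show "\<xi> \<oplus>\<^bsub>?P\<^esub> \<eta> \<in> carrier ?P" using sub that by auto
      fix x assume x: "x \<in> topspace (fs_top X)"
      obtain V where V: "openin (fs_top X) V" "x \<in> V"
          "finite {\<sigma> \<in> chain_simplices X G i \<xi>. \<sigma> ` standard_simplex (nat i) \<inter> V \<noteq> {}}"
        using \<xi> x unfolding lf_chains_iff by blast
      obtain W where W: "openin (fs_top X) W" "x \<in> W"
          "finite {\<sigma> \<in> chain_simplices X G i \<eta>. \<sigma> ` standard_simplex (nat i) \<inter> W \<noteq> {}}"
        using \<eta> x unfolding lf_chains_iff by blast
      have "finite {\<sigma> \<in> chain_simplices X G i (\<xi> \<oplus>\<^bsub>?L\<^esub> \<eta>). \<sigma> ` standard_simplex (nat i) \<inter> (V \<inter> W) \<noteq> {}}"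
        by (rule finite_subset[OF _ finite_UnI[OF V(3) W(3)]]) (use chain_simplices_add in blast)
      then show "\<exists>V. openin (fs_top X) V \<and> x \<in> V \<and>
          finite {\<sigma> \<in> chain_simplices X G i (\<xi> \<oplus>\<^bsub>?P\<^esub> \<eta>). \<sigma> ` standard_simplex (nat i) \<inter> V \<noteq> {}}"
        using V W unfolding ops by blast
    qed
    show "r \<odot>\<^bsub>?P\<^esub> \<xi> \<in> carrier ?L" if \<xi>: "\<xi> \<in> carrier ?L" and r: "r \<in> carrier R" for \<xi> r
      unfolding lf_chains_iff Pc[symmetric]
    proof (intro conjI ballI)
      show "r \<odot>\<^bsub>?P\<^esub> \<xi> \<in> carrier ?P" using sub that by (auto simp: P.smult_closed)
      fix x assume x: "x \<in> topspace (fs_top X)"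
      obtain V where V: "openin (fs_top X) V" "x \<in> V"
          "finite {\<sigma> \<in> chain_simplices X G i \<xi>. \<sigma> ` standard_simplex (nat i) \<inter> V \<noteq> {}}"
        using \<xi> x unfolding lf_chains_iff by blast
      have "finite {\<sigma> \<in> chain_simplices X G i (r \<odot>\<^bsub>?L\<^esub> \<xi>). \<sigma> ` standard_simplex (nat i) \<inter> V \<noteq> {}}"
        by (rule finite_subset[OF _ V(3)]) (use chain_simplices_smult[OF r] in blast)
      then show "\<exists>V. openin (fs_top X) V \<and> x \<in> V \<and>
          finite {\<sigma> \<in> chain_simplices X G i (r \<odot>\<^bsub>?P\<^esub> \<xi>). \<sigma> ` standard_simplex (nat i) \<inter> V \<noteq> {}}"
        using V unfolding ops by blast
    qed
  qed (use sub in blast)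
  then show ?thesis
    by (subst eq) (rule lsubmodule_left_module[OF P])
qed

text \<open>Finitely many of the neighborhoods given by local finiteness cover \<open>K\<close>.
  Applied to the compact image of a single simplex, this makes the sums defining boundary
  coefficients finite.\<close>

lemma finite_chain_simplices_meeting_compact:
  assumes \<xi>: "\<xi> \<in> carrier (lf_chains X G i)" and K: "compactin (fs_top X) K"
  shows "finite {\<sigma> \<in> chain_simplices X G i \<xi>. \<sigma> ` standard_simplex (nat i) \<inter> K \<noteq> {}}"
proof -
  define \<U> where "\<U> = {V. openin (fs_top X) V \<and>
    finite {\<sigma> \<in> chain_simplices X G i \<xi>. \<sigma> ` standard_simplex (nat i) \<inter> V \<noteq> {}}}"
  have "K \<subseteq> \<Union>\<U>"
    using \<xi> compactin_subset_topspace[OF K] by (auto simp: \<U>_def lf_chains_iff subset_iff)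
  then obtain \<F> where \<F>: "finite \<F>" "\<F> \<subseteq> \<U>" "K \<subseteq> \<Union>\<F>"
    using K unfolding compactin_def by (metis (no_types, lifting) \<U>_def mem_Collect_eq)
  have "finite (\<Union>V\<in>\<F>. {\<sigma> \<in> chain_simplices X G i \<xi>. \<sigma> ` standard_simplex (nat i) \<inter> V \<noteq> {}})"
    using \<F> by (auto simp: \<U>_def)
  then show ?thesis
    by (rule finite_subset[rotated]) (use \<F>(3) in blast)
qed

section \<open>Faces and boundary coefficients\<close>

lemma face_simplex:
  "\<sigma> \<in> simplices X i \<Longrightarrow> 1 \<le> i \<Longrightarrow> j \<le> nat i \<Longrightarrow> singular_face (nat i) j \<sigma> \<in> simplices X (i - 1)"
  using singular_simplex_singular_face[of "nat i" "fs_top X" \<sigma> j]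
  by (auto simp: simplices_def nat_diff_distrib)

lemma simplices_ge1: "\<tau> \<in> simplices X (i - 1) \<Longrightarrow> 1 \<le> i"
  by (simp add: simplices_def)

lemma face_point:
  assumes "\<tau> \<in> simplices X (i - 1)" "j \<le> nat i" "singular_face (nat i) j \<sigma> = \<tau>"
    and "t \<in> standard_simplex (nat (i - 1))"
  shows "simplical_face j t \<in> standard_simplex (nat i)" "\<sigma> (simplical_face j t) = \<tau> t"
proof -
  \<comment> \<open>Degrees are integers, but faces are indexed by natural numbers. Existence of a
    simplex of degree \<open>i - 1\<close> is what makes \<open>nat (i - 1)\<close> the predecessor
    of \<open>nat i\<close>.\<close>
  have "1 \<le> i" using simplices_ge1[OF assms(1)] .
  then have t: "t \<in> standard_simplex (nat i - Suc 0)" "1 \<le> nat i"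
    using assms(4) by (auto simp: nat_diff_distrib)
  show "simplical_face j t \<in> standard_simplex (nat i)"
    using simplical_face_in_standard_simplex[OF t(2) assms(2) t(1)] .
  show "\<sigma> (simplical_face j t) = \<tau> t"
    using singular_face_apply[OF t(1)] assms(3) by metis
qed

lemma face_image:
  assumes "\<tau> \<in> simplices X (i - 1)" "j \<le> nat i" "singular_face (nat i) j \<sigma> = \<tau>"
  shows "\<tau> ` standard_simplex (nat (i - 1)) \<subseteq> \<sigma> ` standard_simplex (nat i)"
  using face_point[OF assms] by (metis image_subsetI rev_image_eqI)

lemma face_regular:
  assumes "\<tau> \<in> simplices X (i - 1)" "j \<le> nat i" "singular_face (nat i) j \<sigma> = \<tau>"
    and "t \<in> regular_part X (i - 1) \<tau>"
  shows "simplical_face j t \<in> regular_part X i \<sigma>" "\<sigma> (simplical_face j t) = \<tau> t"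
  using face_point[OF assms(1-3), of t] assms(4) by (auto simp: regular_part_def)

lemma face_value:
  assumes "\<xi> \<in> carrier (lf_chains X G i)" "\<sigma> \<in> simplices X i"
    and "\<tau> \<in> simplices X (i - 1)" "j \<le> nat i" "singular_face (nat i) j \<sigma> = \<tau>"
    and "t \<in> regular_part X (i - 1) \<tau>"
  shows "\<xi> \<sigma> (simplical_face j t) \<in> carrier (fibre G (\<tau> t))"
  using lf_chain_value[OF assms(1,2), of "simplical_face j t"] face_regular[OF assms(3-6)] by simp

lemma face_lift:
  assumes \<xi>: "\<xi> \<in> carrier (lf_chains X G i)" and \<sigma>: "\<sigma> \<in> simplices X i"
    and \<tau>: "\<tau> \<in> simplices X (i - 1)" "j \<le> nat i" "singular_face (nat i) j \<sigma> = \<tau>"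
  shows "is_lift (regular_top (i - 1) \<tau>) \<tau> (\<lambda>t. \<xi> \<sigma> (simplical_face j t))"
proof -
  have "continuous_map (regular_top (i - 1) \<tau>) (regular_top i \<sigma>) (simplical_face j)"
    using face_regular(1)[OF \<tau>]
    by (auto simp: continuous_map_in_subtopology intro: continuous_map_from_subtopology continuous_map_simplical_face)
  moreover have "continuous_map (regular_top i \<sigma>) (total G) (\<xi> \<sigma>)"
    using lf_chain_coeff[OF \<xi> \<sigma>] by (simp add: coeff_carrier_iff is_lift_def)
  ultimately have "continuous_map (regular_top (i - 1) \<tau>) (total G) (\<xi> \<sigma> \<circ> simplical_face j)"
    by (rule continuous_map_compose)
  then show ?thesis
    using face_value[OF \<xi> \<sigma> \<tau>] by (auto simp: is_lift_def o_def)
qed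

definition incident :: "int \<Rightarrow> ('a, 'e) lf_chain \<Rightarrow> 'a simplex \<Rightarrow> ('a simplex \<times> nat) set" where
  "incident i \<xi> \<tau> = {(\<sigma>, j). \<sigma> \<in> chain_simplices X G i \<xi> \<and> j \<le> nat i \<and> singular_face (nat i) j \<sigma> = \<tau>}"

text \<open>Unlike \<open>incident\<close>, this set does not depend on a chain and may be infinite.
  It is the ambient set inside which the finite index sets of different chains are enlarged and
  compared.\<close>

definition cofaces :: "int \<Rightarrow> 'a simplex \<Rightarrow> ('a simplex \<times> nat) set" where
  "cofaces i \<tau> = {(\<sigma>, j). \<sigma> \<in> simplices X i \<and> j \<le> nat i \<and> singular_face (nat i) j \<sigma> = \<tau>}"

lemma incident_cofaces: "incident i \<xi> \<tau> \<subseteq> cofaces i \<tau>"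
  using chain_simplices_subset by (auto simp: incident_def cofaces_def)

lemma incidentE:
  assumes "x \<in> incident i \<xi> \<tau>"
  obtains \<sigma> j where "x = (\<sigma>, j)" "\<sigma> \<in> simplices X i" "j \<le> nat i" "singular_face (nat i) j \<sigma> = \<tau>"
  using assms that by (auto simp: incident_def chain_simplices_def)

lemma finite_incident:
  assumes \<xi>: "\<xi> \<in> carrier (lf_chains X G i)" and \<tau>: "\<tau> \<in> simplices X (i - 1)"
  shows "finite (incident i \<xi> \<tau>)"
proof (rule finite_subset)
  let ?S = "{\<sigma> \<in> chain_simplices X G i \<xi>. \<sigma> ` standard_simplex (nat i) \<inter> \<tau> ` standard_simplex (nat (i - 1)) \<noteq> {}}"
  show "finite (?S \<times> {..nat i})"
    using finite_chain_simplices_meeting_compact[OF \<xi> simplex_compact[OF \<tau>]] by simp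
  show "incident i \<xi> \<tau> \<subseteq> ?S \<times> {..nat i}"
    using face_image[OF \<tau>] nonempty_standard_simplex by (fastforce simp: incident_def)
qed

definition face_term where
  "face_term \<xi> \<tau> t = (\<lambda>(\<sigma>, j). alt_sign (fibre G (\<tau> t)) j (\<xi> \<sigma> (simplical_face j t)))"

lemma face_term_closed:
  assumes "\<xi> \<in> carrier (lf_chains X G i)" "\<tau> \<in> simplices X (i - 1)" "t \<in> regular_part X (i - 1) \<tau>"
  shows "face_term \<xi> \<tau> t \<in> cofaces i \<tau> \<rightarrow> carrier (fibre G (\<tau> t))"
  using face_value[OF assms(1) _ assms(2) _ _ assms(3)] left_module.alt_sign_closed[OF regular_fibre[OF assms(2,3)]]
  by (auto simp: face_term_def cofaces_def)

lemma lf_boundary_apply: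
  assumes "\<tau> \<in> simplices X (i - 1)" "t \<in> regular_part X (i - 1) \<tau>"
  shows "lf_boundary X G i \<xi> \<tau> t = finsum (fibre G (\<tau> t)) (face_term \<xi> \<tau> t) (incident i \<xi> \<tau>)"
  using assms by (simp add: lf_boundary_def face_term_def incident_def)

text \<open>The boundary sums over an index set that depends on the chain, which is inconvenient for
  comparing chains. A coface outside \<open>incident\<close> has coefficient zero, so enlarging the
  index set to any finite set of cofaces changes nothing.\<close>

lemma lf_boundary_sum:
  assumes \<xi>: "\<xi> \<in> carrier (lf_chains X G i)" and \<tau>: "\<tau> \<in> simplices X (i - 1)" "t \<in> regular_part X (i - 1) \<tau>"
    and A: "finite A" "A \<subseteq> cofaces i \<tau>" "incident i \<xi> \<tau> \<subseteq> A"
  shows "lf_boundary X G i \<xi> \<tau> t = finsum (fibre G (\<tau> t)) (face_term \<xi> \<tau> t) A"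
proof -
  interpret left_module R "fibre G (\<tau> t)" using regular_fibre[OF \<tau>] .
  have "face_term \<xi> \<tau> t x = \<zero>\<^bsub>fibre G (\<tau> t)\<^esub>" if x: "x \<in> A - incident i \<xi> \<tau>" for x
  proof -
    obtain \<sigma> j where x': "x = (\<sigma>, j)" by (cases x)
    with x A(2) have \<sigma>: "\<sigma> \<in> simplices X i" "j \<le> nat i" "singular_face (nat i) j \<sigma> = \<tau>"
      and "\<xi> \<sigma> = \<zero>\<^bsub>coeff_module X G i \<sigma>\<^esub>"
      by (auto simp: cofaces_def incident_def chain_simplices_def)
    then show ?thesis
      using face_regular[OF \<tau>(1) \<sigma>(2,3) \<tau>(2)] by (simp add: x' face_term_def coeff_ops alt_sign_zero)
  qed
  then have "finsum (fibre G (\<tau> t)) (face_term \<xi> \<tau> t) (incident i \<xi> \<tau>) = finsum (fibre G (\<tau> t)) (face_term \<xi> \<tau> t) A"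
    using finite_incident[OF \<xi> \<tau>(1)] A incident_cofaces face_term_closed[OF \<xi> \<tau>]
    by (intro M.add.finprod_mono_neutral_cong) auto
  then show ?thesis using lf_boundary_apply[OF \<tau>] by simp
qed

lemma chain_simplices_boundary:
  assumes "\<tau> \<in> chain_simplices X G (i - 1) (lf_boundary X G i \<xi>)"
  obtains \<sigma> j where "\<sigma> \<in> chain_simplices X G i \<xi>" "j \<le> nat i" "singular_face (nat i) j \<sigma> = \<tau>"
proof -
  have \<tau>: "\<tau> \<in> simplices X (i - 1)" using assms by (simp add: chain_simplices_def)
  have "incident i \<xi> \<tau> \<noteq> {}"
  proof
    assume e: "incident i \<xi> \<tau> = {}"
    have "finsum (fibre G (\<tau> t)) (face_term \<xi> \<tau> t) {} = \<zero>\<^bsub>fibre G (\<tau> t)\<^esub>" if "t \<in> regular_part X (i - 1) \<tau>" for t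
    proof -
      interpret left_module R "fibre G (\<tau> t)" using regular_fibre[OF \<tau> that] .
      show ?thesis by simp
    qed
    then have "lf_boundary X G i \<xi> \<tau> = \<zero>\<^bsub>coeff_module X G (i - 1) \<tau>\<^esub>"
      using lf_boundary_apply[OF \<tau>, of _ \<xi>] \<tau> unfolding e
      by (intro extensionalityI[of _ "regular_part X (i - 1) \<tau>"]) (auto simp: coeff_ops lf_boundary_def)
    then show False using assms by (simp add: chain_simplices_def)
  qed
  then show ?thesis using that by (auto simp: incident_def)
qed

text \<open>Each coefficient is a finite sum of signed restrictions of lifts, hence a lift. For
  local finiteness, a simplex of the boundary meeting \<open>V\<close> is a face of a simplex of
  \<open>\<xi>\<close> meeting \<open>V\<close>, and every simplex has finitely many faces.\<close>

lemma lf_boundary_closed: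
  assumes \<xi>: "\<xi> \<in> carrier (lf_chains X G i)"
  shows "lf_boundary X G i \<xi> \<in> carrier (lf_chains X G (i - 1))"
  unfolding lf_chains_iff
proof (intro conjI ballI)
  have "lf_boundary X G i \<xi> \<tau> \<in> carrier (coeff_module X G (i - 1) \<tau>)" if \<tau>: "\<tau> \<in> simplices X (i - 1)" for \<tau>
    unfolding coeff_carrier_iff
  proof
    show "lf_boundary X G i \<xi> \<tau> \<in> extensional (regular_part X (i - 1) \<tau>)"
      using \<tau> by (simp add: lf_boundary_def)
    have "is_lift (regular_top (i - 1) \<tau>) \<tau>
        (\<lambda>t. finsum (fibre G (\<tau> t)) (\<lambda>x. face_term \<xi> \<tau> t x) (incident i \<xi> \<tau>))"
    proof (rule lift_finsum[OF regular_continuous[OF \<tau>]])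
      fix x assume "x \<in> incident i \<xi> \<tau>"
      then obtain \<sigma> j where "x = (\<sigma>, j)" "\<sigma> \<in> simplices X i" "j \<le> nat i" "singular_face (nat i) j \<sigma> = \<tau>"
        by (rule incidentE)
      then show "is_lift (regular_top (i - 1) \<tau>) \<tau> (\<lambda>t. face_term \<xi> \<tau> t x)"
        using lift_alt_sign[OF regular_continuous[OF \<tau>] face_lift[OF \<xi> _ \<tau>]] by (simp add: face_term_def)
    qed
    then show "is_lift (regular_top (i - 1) \<tau>) \<tau> (lf_boundary X G i \<xi> \<tau>)"
      by (rule lift_cong) (simp add: lf_boundary_apply[OF \<tau>])
  qed
  then show "lf_boundary X G i \<xi> \<in> (\<Pi>\<^sub>E \<sigma>\<in>simplices X (i - 1). carrier (coeff_module X G (i - 1) \<sigma>))"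
    by (auto simp: lf_boundary_def)
  fix x assume "x \<in> topspace (fs_top X)"
  then obtain V where V: "openin (fs_top X) V" "x \<in> V"
      "finite {\<sigma> \<in> chain_simplices X G i \<xi>. \<sigma> ` standard_simplex (nat i) \<inter> V \<noteq> {}}" (is "finite ?S")
    using \<xi> unfolding lf_chains_iff by blast
  have "{\<tau> \<in> chain_simplices X G (i - 1) (lf_boundary X G i \<xi>). \<tau> ` standard_simplex (nat (i - 1)) \<inter> V \<noteq> {}}
      \<subseteq> (\<lambda>(\<sigma>, j). singular_face (nat i) j \<sigma>) ` (?S \<times> {..nat i})" (is "?T \<subseteq> _")
  proof
    fix \<tau> assume \<tau>: "\<tau> \<in> ?T"
    then obtain \<sigma> j where \<sigma>: "\<sigma> \<in> chain_simplices X G i \<xi>" "j \<le> nat i" "singular_face (nat i) j \<sigma> = \<tau>"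
      using chain_simplices_boundary by blast
    have "\<tau> \<in> simplices X (i - 1)" using \<tau> chain_simplices_subset by blast
    from face_image[OF this \<sigma>(2,3)] \<tau> \<sigma>(1) have "\<sigma> \<in> ?S" by blast
    then show "\<tau> \<in> (\<lambda>(\<sigma>, j). singular_face (nat i) j \<sigma>) ` (?S \<times> {..nat i})"
      using \<sigma> by (intro rev_image_eqI[of "(\<sigma>, j)"]) auto
  qed
  then have "finite ?T"
    by (rule finite_subset) (use V in simp)
  then show "\<exists>V. openin (fs_top X) V \<and> x \<in> V \<and>
      finite {\<sigma> \<in> chain_simplices X G (i - 1) (lf_boundary X G i \<xi>). \<sigma> ` standard_simplex (nat (i - 1)) \<inter> V \<noteq> {}}"
    using V by blast
qed

lemma lf_boundary_eqI:
  assumes "\<xi> \<in> carrier (lf_chains X G i)" "\<eta> \<in> carrier (lf_chains X G (i - 1))"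
    and "\<And>\<tau> t. \<tau> \<in> simplices X (i - 1) \<Longrightarrow> t \<in> regular_part X (i - 1) \<tau> \<Longrightarrow> lf_boundary X G i \<xi> \<tau> t = \<eta> \<tau> t"
  shows "lf_boundary X G i \<xi> = \<eta>"
proof (rule lf_chain_eqI[OF lf_boundary_closed[OF assms(1)] assms(2)])
  fix \<tau> assume \<tau>: "\<tau> \<in> simplices X (i - 1)"
  show "lf_boundary X G i \<xi> \<tau> = \<eta> \<tau>"
    by (rule extensionalityI[of _ "regular_part X (i - 1) \<tau>"])
      (use assms(3)[OF \<tau>] lf_chain_coeff[OF assms(2) \<tau>] \<tau> in \<open>auto simp: coeff_carrier_iff lf_boundary_def\<close>)
qed

lemma lf_boundary_add:
  assumes \<xi>: "\<xi> \<in> carrier (lf_chains X G i)" and \<eta>: "\<eta> \<in> carrier (lf_chains X G i)"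
  shows "lf_boundary X G i (\<xi> \<oplus>\<^bsub>lf_chains X G i\<^esub> \<eta>) =
    lf_boundary X G i \<xi> \<oplus>\<^bsub>lf_chains X G (i - 1)\<^esub> lf_boundary X G i \<eta>"
proof -
  interpret L: left_module R "lf_chains X G i" by (rule lf_chains_left_module)
  interpret L1: left_module R "lf_chains X G (i - 1)" by (rule lf_chains_left_module)
  have s: "\<xi> \<oplus>\<^bsub>lf_chains X G i\<^esub> \<eta> \<in> carrier (lf_chains X G i)"
    using \<xi> \<eta> by (rule L.M.a_closed)
  show ?thesis
  proof (rule lf_boundary_eqI[OF s L1.M.a_closed])
    fix \<tau> t assume \<tau>: "\<tau> \<in> simplices X (i - 1)" "t \<in> regular_part X (i - 1) \<tau>"
    interpret left_module R "fibre G (\<tau> t)" using regular_fibre[OF \<tau>] .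
    \<comment> \<open>One index set serves all three boundaries; cancellation can make the set
      belonging to the sum of the chains strictly smaller.\<close>
    define A where "A = incident i \<xi> \<tau> \<union> incident i \<eta> \<tau>"
    have A: "finite A" "A \<subseteq> cofaces i \<tau>" "incident i \<xi> \<tau> \<subseteq> A" "incident i \<eta> \<tau> \<subseteq> A"
      using finite_incident[OF \<xi> \<tau>(1)] finite_incident[OF \<eta> \<tau>(1)] incident_cofaces
      by (auto simp: A_def)
    have A': "incident i (\<xi> \<oplus>\<^bsub>lf_chains X G i\<^esub> \<eta>) \<tau> \<subseteq> A"
      using chain_simplices_add[of i \<xi> \<eta>] by (auto simp: A_def incident_def)
    have cl: "face_term \<xi> \<tau> t \<in> A \<rightarrow> carrier (fibre G (\<tau> t))" "face_term \<eta> \<tau> t \<in> A \<rightarrow> carrier (fibre G (\<tau> t))"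
      using face_term_closed[OF \<xi> \<tau>] face_term_closed[OF \<eta> \<tau>] A(2) by auto
    have "face_term (\<xi> \<oplus>\<^bsub>lf_chains X G i\<^esub> \<eta>) \<tau> t x = face_term \<xi> \<tau> t x \<oplus>\<^bsub>fibre G (\<tau> t)\<^esub> face_term \<eta> \<tau> t x"
      if x: "x \<in> A" for x
    proof -
      obtain \<sigma> j where x': "x = (\<sigma>, j)" by (cases x)
      with x A(2) have \<sigma>: "\<sigma> \<in> simplices X i" "j \<le> nat i" "singular_face (nat i) j \<sigma> = \<tau>"
        by (auto simp: cofaces_def)
      show ?thesis
        using face_value[OF \<xi> \<sigma>(1) \<tau>(1) \<sigma>(2,3) \<tau>(2)] face_value[OF \<eta> \<sigma>(1) \<tau>(1) \<sigma>(2,3) \<tau>(2)]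
          face_regular[OF \<tau>(1) \<sigma>(2,3) \<tau>(2)] \<sigma>(1)
        by (simp add: x' face_term_def lf_chains_ops coeff_ops alt_sign_add)
    qed
    then have "finsum (fibre G (\<tau> t)) (face_term (\<xi> \<oplus>\<^bsub>lf_chains X G i\<^esub> \<eta>) \<tau> t) A =
        finsum (fibre G (\<tau> t)) (\<lambda>x. face_term \<xi> \<tau> t x \<oplus>\<^bsub>fibre G (\<tau> t)\<^esub> face_term \<eta> \<tau> t x) A"
      using cl by (intro M.finsum_cong') auto
    also have "\<dots> = lf_boundary X G i \<xi> \<tau> t \<oplus>\<^bsub>fibre G (\<tau> t)\<^esub> lf_boundary X G i \<eta> \<tau> t"
      using M.finsum_addf[OF cl] by (simp add: lf_boundary_sum[OF \<xi> \<tau> A(1-3)] lf_boundary_sum[OF \<eta> \<tau> A(1,2,4)])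
    finally show "lf_boundary X G i (\<xi> \<oplus>\<^bsub>lf_chains X G i\<^esub> \<eta>) \<tau> t =
        (lf_boundary X G i \<xi> \<oplus>\<^bsub>lf_chains X G (i - 1)\<^esub> lf_boundary X G i \<eta>) \<tau> t"
      using \<tau> lf_boundary_sum[OF s \<tau> A(1,2) A'] by (simp add: lf_chains_ops coeff_ops)
  qed (use lf_boundary_closed \<xi> \<eta> in auto)
qed

lemma lf_boundary_smult:
  assumes \<xi>: "\<xi> \<in> carrier (lf_chains X G i)" and r: "r \<in> carrier R"
  shows "lf_boundary X G i (r \<odot>\<^bsub>lf_chains X G i\<^esub> \<xi>) = r \<odot>\<^bsub>lf_chains X G (i - 1)\<^esub> lf_boundary X G i \<xi>"
proof -
  interpret L: left_module R "lf_chains X G i" by (rule lf_chains_left_module)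
  interpret L1: left_module R "lf_chains X G (i - 1)" by (rule lf_chains_left_module)
  have s: "r \<odot>\<^bsub>lf_chains X G i\<^esub> \<xi> \<in> carrier (lf_chains X G i)"
    using r \<xi> by (rule L.smult_closed)
  show ?thesis
  proof (rule lf_boundary_eqI[OF s L1.smult_closed[OF r]])
    fix \<tau> t assume \<tau>: "\<tau> \<in> simplices X (i - 1)" "t \<in> regular_part X (i - 1) \<tau>"
    interpret left_module R "fibre G (\<tau> t)" using regular_fibre[OF \<tau>] .
    let ?A = "incident i \<xi> \<tau>"
    have A': "incident i (r \<odot>\<^bsub>lf_chains X G i\<^esub> \<xi>) \<tau> \<subseteq> ?A"
      using chain_simplices_smult[OF r, of i \<xi>] by (auto simp: incident_def)
    have cl: "face_term \<xi> \<tau> t \<in> ?A \<rightarrow> carrier (fibre G (\<tau> t))"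
      using face_term_closed[OF \<xi> \<tau>] incident_cofaces by blast
    have "face_term (r \<odot>\<^bsub>lf_chains X G i\<^esub> \<xi>) \<tau> t x = r \<odot>\<^bsub>fibre G (\<tau> t)\<^esub> face_term \<xi> \<tau> t x"
      if x: "x \<in> ?A" for x
    proof -
      obtain \<sigma> j where x': "x = (\<sigma>, j)"
        and \<sigma>: "\<sigma> \<in> simplices X i" "j \<le> nat i" "singular_face (nat i) j \<sigma> = \<tau>"
        using x by (rule incidentE)
      show ?thesis
        using face_value[OF \<xi> \<sigma>(1) \<tau>(1) \<sigma>(2,3) \<tau>(2)] face_regular[OF \<tau>(1) \<sigma>(2,3) \<tau>(2)] \<sigma>(1) r
        by (simp add: x' face_term_def lf_chains_ops coeff_ops alt_sign_smult)
    qed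
    then have "finsum (fibre G (\<tau> t)) (face_term (r \<odot>\<^bsub>lf_chains X G i\<^esub> \<xi>) \<tau> t) ?A =
        finsum (fibre G (\<tau> t)) (\<lambda>x. r \<odot>\<^bsub>fibre G (\<tau> t)\<^esub> face_term \<xi> \<tau> t x) ?A"
      using cl r by (intro M.finsum_cong') (auto simp: smult_closed Pi_iff)
    then show "lf_boundary X G i (r \<odot>\<^bsub>lf_chains X G i\<^esub> \<xi>) \<tau> t =
        (r \<odot>\<^bsub>lf_chains X G (i - 1)\<^esub> lf_boundary X G i \<xi>) \<tau> t"
      using \<tau> smult_finsum[OF r cl] lf_boundary_sum[OF s \<tau> finite_incident[OF \<xi> \<tau>(1)] incident_cofaces A']
      by (simp add: lf_boundary_apply lf_chains_ops coeff_ops)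
  qed (use lf_boundary_closed \<xi> in auto)
qed

section \<open>The square of the boundary\<close>

lemma alt_sign_face_swap:
  assumes M: "left_module R M" and "j < k" "x \<in> carrier M"
  shows "alt_sign M (k - 1) (alt_sign M j x) = \<ominus>\<^bsub>M\<^esub> alt_sign M j (alt_sign M k x)"
proof -
  interpret left_module R M by fact
  \<comment> \<open>As \<open>k\<close> is positive, \<open>k - 1\<close> is a true predecessor and
    has the opposite parity. This is the source of the opposite signs for the two orders of taking
    faces.\<close>
  obtain m where "k = Suc m" using \<open>j < k\<close> by (cases k) auto
  then show ?thesis using \<open>x \<in> carrier M\<close> by (simp add: alt_sign_def)
qed

text \<open>At a point \<open>t\<close> of \<open>\<rho>\<close> the iterated boundary is a sum of
  signed values of \<open>\<xi>\<close> over triples \<open>(\<sigma>, k, j)\<close>, standing for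
  face \<open>j\<close> of face \<open>k\<close> of \<open>\<sigma>\<close>. Compactness of the
  image of \<open>\<rho>\<close> leaves finitely many triples, which makes the rearrangement
  legitimate.\<close>

lemma lf_boundary_boundary:
  assumes \<xi>: "\<xi> \<in> carrier (lf_chains X G i)"
  shows "lf_boundary X G (i - 1) (lf_boundary X G i \<xi>) = \<zero>\<^bsub>lf_chains X G (i - 1 - 1)\<^esub>"
proof -
  let ?\<eta> = "lf_boundary X G i \<xi>"
  have \<eta>: "?\<eta> \<in> carrier (lf_chains X G (i - 1))" by (rule lf_boundary_closed[OF \<xi>])
  interpret L: left_module R "lf_chains X G (i - 1 - 1)" by (rule lf_chains_left_module)
  show ?thesis
  proof (rule lf_boundary_eqI[OF \<eta> L.M.zero_closed])
    fix \<rho> t assume \<rho>: "\<rho> \<in> simplices X (i - 1 - 1)" "t \<in> regular_part X (i - 1 - 1) \<rho>"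
    have i: "2 \<le> i" using simplices_ge1[OF \<rho>(1)] by simp
    interpret left_module R "fibre G (\<rho> t)" using regular_fibre[OF \<rho>] .
    define F where "F = fibre G (\<rho> t)"
    define S where "S = {\<sigma> \<in> chain_simplices X G i \<xi>.
      \<sigma> ` standard_simplex (nat i) \<inter> \<rho> ` standard_simplex (nat (i - 1 - 1)) \<noteq> {}}"
    have S: "finite S" "S \<subseteq> chain_simplices X G i \<xi>"
      using finite_chain_simplices_meeting_compact[OF \<xi> simplex_compact[OF \<rho>(1)]] by (auto simp: S_def)
    have Ss: "\<sigma> \<in> simplices X i" if "\<sigma> \<in> S" for \<sigma>
      using S(2) that chain_simplices_subset by blast
    have S_mem: "\<sigma> \<in> S" if "\<sigma> \<in> chain_simplices X G i \<xi>" "k \<le> nat i" "j \<le> nat (i - 1)"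
      "singular_face (nat i) k \<sigma> = \<tau>" "singular_face (nat (i - 1)) j \<tau> = \<rho>" for \<sigma> \<tau> k j
    proof -
      have \<sigma>: "\<sigma> \<in> simplices X i" using that(1) chain_simplices_subset by blast
      then have \<tau>: "\<tau> \<in> simplices X (i - 1)" using face_simplex[of \<sigma> i k] that i by auto
      have "\<rho> ` standard_simplex (nat (i - 1 - 1)) \<subseteq> \<sigma> ` standard_simplex (nat i)"
        using face_image[OF \<rho>(1) that(3,5)] face_image[OF \<tau> that(2,4)] by blast
      then show ?thesis
        using that(1) nonempty_standard_simplex[of "nat (i - 1 - 1)"] unfolding S_def by blast
    qed
    define D where "D = {(\<sigma>, k, j). \<sigma> \<in> S \<and> k \<le> nat i \<and> j \<le> nat (i - 1) \<and>
      singular_face (nat (i - 1)) j (singular_face (nat i) k \<sigma>) = \<rho>}"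
    \<comment> \<open>\<open>h\<close> keeps only the intermediate face and the outer index, so its
      fibres are the index sets of the inner boundary sums.\<close>
    define h where "h = (\<lambda>(\<sigma> :: 'a simplex, k :: nat, j :: nat). (singular_face (nat i) k \<sigma>, j))"
    define g where "g = (\<lambda>(\<sigma>, k, j). alt_sign F j (alt_sign F k (\<xi> \<sigma> (simplical_face k (simplical_face j t)))))"
    have "D \<subseteq> S \<times> {..nat i} \<times> {..nat (i - 1)}" by (auto simp: D_def)
    then have fD: "finite D" by (rule finite_subset) (simp add: S(1))
    have val: "\<xi> \<sigma> (simplical_face k (simplical_face j t)) \<in> carrier F" if "(\<sigma>, k, j) \<in> D" for \<sigma> k j
    proof -
      have d: "\<sigma> \<in> simplices X i" "k \<le> nat i" "j \<le> nat (i - 1)"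
          "singular_face (nat (i - 1)) j (singular_face (nat i) k \<sigma>) = \<rho>"
        using that Ss by (auto simp: D_def)
      have \<tau>: "singular_face (nat i) k \<sigma> \<in> simplices X (i - 1)" using face_simplex d i by auto
      show ?thesis
        using face_value[OF \<xi> d(1) \<tau> d(2) refl face_regular(1)[OF \<rho>(1) d(3,4) \<rho>(2)]]
          face_regular(2)[OF \<rho>(1) d(3,4) \<rho>(2)] by (simp add: F_def)
    qed
    have gD: "g \<in> D \<rightarrow> carrier F"
      using val by (auto simp: g_def F_def alt_sign_closed)
    have inner: "face_term ?\<eta> \<rho> t y = finsum F g {x \<in> D. h x = y}" if y: "y \<in> h ` D" for y
    proof -
      obtain \<tau> j where y': "y = (\<tau>, j)" by (cases y)
      obtain \<sigma>0 k0 where x0: "(\<sigma>0, k0, j) \<in> D" "\<tau> = singular_face (nat i) k0 \<sigma>0"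
        using y y' by (auto simp: h_def)
      then have d: "\<sigma>0 \<in> simplices X i" "k0 \<le> nat i" and j: "j \<le> nat (i - 1)"
          "singular_face (nat (i - 1)) j \<tau> = \<rho>"
        using Ss by (auto simp: D_def)
      have \<tau>: "\<tau> \<in> simplices X (i - 1)" using face_simplex d i x0 by auto
      define B where "B = {(\<sigma>, k). \<sigma> \<in> S \<and> k \<le> nat i \<and> singular_face (nat i) k \<sigma> = \<tau>}"
      have "B \<subseteq> S \<times> {..nat i}" by (auto simp: B_def)
      then have B: "finite B" by (rule finite_subset) (simp add: S(1))
      have Bc: "B \<subseteq> cofaces i \<tau>" using Ss by (auto simp: B_def cofaces_def)
      have Bi: "incident i \<xi> \<tau> \<subseteq> B" using S_mem j by (auto simp: B_def incident_def)
      have t: "simplical_face j t \<in> regular_part X (i - 1) \<tau>" "\<tau> (simplical_face j t) = \<rho> t"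
        using face_regular[OF \<rho>(1) j \<rho>(2)] by auto
      have cl: "face_term \<xi> \<tau> (simplical_face j t) \<in> B \<rightarrow> carrier F"
        using face_term_closed[OF \<xi> \<tau> t(1)] Bc t(2) by (auto simp: F_def)
      \<comment> \<open>With the intermediate face fixed, the triples correspond to pairs in
        \<open>B\<close>, a finite set of cofaces containing all incident ones. This matches a fibre
        of \<open>h\<close> with the boundary coefficient of \<open>\<tau>\<close>.\<close>
      have eq: "{x \<in> D. h x = y} = (\<lambda>(\<sigma>, k). (\<sigma>, k, j)) ` B"
        using j by (auto simp: D_def h_def B_def y' image_iff)
      have "face_term ?\<eta> \<rho> t y = alt_sign F j (?\<eta> \<tau> (simplical_face j t))"
        by (simp add: y' face_term_def F_def)
      also have "\<dots> = alt_sign F j (finsum F (face_term \<xi> \<tau> (simplical_face j t)) B)"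
        using lf_boundary_sum[OF \<xi> \<tau> t(1) B Bc Bi] t(2) by (simp add: F_def)
      also have "\<dots> = finsum F (\<lambda>b. alt_sign F j (face_term \<xi> \<tau> (simplical_face j t) b)) B"
        using alt_sign_finsum cl by (simp add: F_def)
      also have "\<dots> = finsum F (\<lambda>b. g ((\<lambda>(\<sigma>, k). (\<sigma>, k, j)) b)) B"
      proof -
        have "(\<lambda>(\<sigma>, k). (\<sigma>, k, j)) b \<in> D" if "b \<in> B" for b
          using that eq by blast
        then have "(\<lambda>b. g ((\<lambda>(\<sigma>, k). (\<sigma>, k, j)) b)) \<in> B \<rightarrow> carrier F"
          using gD by blast
        moreover have "alt_sign F j (face_term \<xi> \<tau> (simplical_face j t) b) = g ((\<lambda>(\<sigma>, k). (\<sigma>, k, j)) b)" for b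
          using t(2) by (simp add: g_def face_term_def F_def split_def)
        ultimately show ?thesis
          unfolding F_def by (intro M.finsum_cong') auto
      qed
      also have "\<dots> = finsum F g ((\<lambda>(\<sigma>, k). (\<sigma>, k, j)) ` B)"
        unfolding F_def
        by (rule M.finsum_reindex[symmetric]) (use gD eq in \<open>auto simp: inj_on_def F_def\<close>)
      finally show ?thesis using eq by simp
    qed
    have hD: "h ` D \<subseteq> cofaces (i - 1) \<rho>"
      using Ss face_simplex i by (auto simp: h_def D_def cofaces_def)
    \<comment> \<open>Only an inclusion holds: an intermediate face whose coefficients cancel occurs
      in the image of \<open>D\<close> without being incident. \<open>lf_boundary_sum\<close>
      permits such surplus terms.\<close>
    have inc: "incident (i - 1) ?\<eta> \<rho> \<subseteq> h ` D"
    proof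
      fix y assume "y \<in> incident (i - 1) ?\<eta> \<rho>"
      then obtain \<tau> j where y: "y = (\<tau>, j)" "\<tau> \<in> chain_simplices X G (i - 1) ?\<eta>" "j \<le> nat (i - 1)"
          "singular_face (nat (i - 1)) j \<tau> = \<rho>"
        by (auto simp: incident_def)
      obtain \<sigma> k where \<sigma>: "\<sigma> \<in> chain_simplices X G i \<xi>" "k \<le> nat i" "singular_face (nat i) k \<sigma> = \<tau>"
        using chain_simplices_boundary[OF y(2)] .
      have "(\<sigma>, k, j) \<in> D" using S_mem[OF \<sigma>(1,2) y(3) \<sigma>(3) y(4)] \<sigma> y by (auto simp: D_def)
      moreover have "y = h (\<sigma>, k, j)" using \<sigma> y by (simp add: h_def)
      ultimately show "y \<in> h ` D" by blast
    qed
    have "lf_boundary X G (i - 1) ?\<eta> \<rho> t = finsum F (face_term ?\<eta> \<rho> t) (h ` D)"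
      using lf_boundary_sum[OF \<eta> \<rho> _ hD inc] fD by (simp add: F_def)
    also have "\<dots> = finsum F (\<lambda>y. finsum F g {x \<in> D. h x = y}) (h ` D)"
      unfolding F_def
      by (rule M.finsum_cong') (use inner gD in \<open>auto simp: F_def intro!: M.finsum_closed\<close>)
    also have "\<dots> = finsum F g D"
      using M.finsum_fibres[OF fD, of g h] gD by (simp add: F_def)
    also have "\<dots> = \<zero>\<^bsub>F\<^esub>"
    proof -
      \<comment> \<open>The terms cancel in pairs: the face \<open>j\<close> of the face \<open>k\<close> is the face \<open>k - 1\<close> of the
        face \<open>j\<close> for \<open>j < k\<close>, with opposite sign.\<close>
      define D1 where "D1 = {(\<sigma>, k, j) \<in> D. j < k}"
      define \<phi> where "\<phi> = (\<lambda>(\<sigma> :: 'a simplex, k :: nat, j :: nat). (\<sigma>, j, k - 1))"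
      have swap: "singular_face (nat (i - 1)) (k - 1) (singular_face (nat i) j \<sigma>) =
          singular_face (nat (i - 1)) j (singular_face (nat i) k \<sigma>)"
        if "j < k" "k \<le> nat i" for \<sigma> :: "'a simplex" and j k
      proof
        fix s
        have n: "nat (i - 1) = nat i - Suc 0" "1 \<le> nat i - Suc 0" using i by auto
        show "singular_face (nat (i - 1)) (k - 1) (singular_face (nat i) j \<sigma>) s =
          singular_face (nat (i - 1)) j (singular_face (nat i) k \<sigma>) s"
        proof (cases "s \<in> standard_simplex (nat i - Suc 0 - Suc 0)")
          case True
          then have "simplical_face (k - 1) s \<in> standard_simplex (nat i - Suc 0)"
              "simplical_face j s \<in> standard_simplex (nat i - Suc 0)"
            using that n by (auto intro!: simplical_face_in_standard_simplex)
          then show ?thesis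
            unfolding n(1) using True simplical_face_simplical_face[OF that(1), of s]
            by (simp add: singular_face_apply)
        next
          case False
          then show ?thesis unfolding n(1) by (simp add: singular_face_def)
        qed
      qed
      \<comment> \<open>From \<open>j < k\<close> the image has \<open>k - 1\<close> as its outer
        index, which is at least \<open>j\<close>, so it lands in the complementary half. The
        preimage of \<open>(\<sigma>, k, j)\<close> there is
        \<open>(\<sigma>, Suc j, k)\<close>.\<close>
      have phiD: "\<phi> ` D1 = {(\<sigma>, k, j) \<in> D. k \<le> j}"
      proof (intro equalityI subsetI)
        fix x assume "x \<in> \<phi> ` D1"
        then show "x \<in> {(\<sigma>, k, j) \<in> D. k \<le> j}"
          using swap by (auto simp: \<phi>_def D1_def D_def)
      next
        fix x assume x: "x \<in> {(\<sigma>, k, j) \<in> D. k \<le> j}"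
        then obtain \<sigma> k j where x': "x = (\<sigma>, k, j)" by (cases x)
        have "(\<sigma>, Suc j, k) \<in> D1"
          using x swap[of k "Suc j" \<sigma>] i by (auto simp: x' D1_def D_def)
        then show "x \<in> \<phi> ` D1" by (rule rev_image_eqI) (simp add: x' \<phi>_def)
      qed
      have "finsum F g (D1 \<union> \<phi> ` D1) = \<zero>\<^bsub>F\<^esub>"
        unfolding F_def
      proof (rule finsum_cancel)
        show "finite D1" using fD by (rule finite_subset[rotated]) (auto simp: D1_def)
        show "D1 \<inter> \<phi> ` D1 = {}" unfolding phiD by (auto simp: D1_def)
        show "inj_on \<phi> D1" by (auto simp: inj_on_def \<phi>_def D1_def)
        show "g x \<in> carrier (fibre G (\<rho> t))" if "x \<in> D1" for x
          using gD that by (auto simp: D1_def F_def)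
        show "g (\<phi> x) = \<ominus>\<^bsub>fibre G (\<rho> t)\<^esub> g x" if "x \<in> D1" for x
        proof -
          obtain \<sigma> k j where x: "x = (\<sigma>, k, j)" by (cases x)
          then have jk: "j < k" "(\<sigma>, k, j) \<in> D" using that by (auto simp: D1_def)
          show ?thesis
            using alt_sign_face_swap[OF left_module_axioms jk(1), of "\<xi> \<sigma> (simplical_face k (simplical_face j t))"]
              val[OF jk(2)] simplical_face_simplical_face[OF jk(1), of t]
            by (simp add: x \<phi>_def g_def F_def)
        qed
      qed
      moreover have "D1 \<union> \<phi> ` D1 = D" unfolding phiD by (auto simp: D1_def)
      ultimately show ?thesis by simp
    qed
    finally show "lf_boundary X G (i - 1) ?\<eta> \<rho> t = \<zero>\<^bsub>lf_chains X G (i - 1 - 1)\<^esub> \<rho> t"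
      using \<rho> by (simp add: lf_chains_ops coeff_ops F_def)
  qed
qed

end

section \<open>Germs of intersection chains\<close>

text \<open>The perversity enters here, and the topology enters as regularity, the form used in
  \<open>agree_iff\<close>.\<close>

locale intersection_sheaf = filtered_coefficients R X G
  for R :: "('r, 'k) ring_scheme" and X :: "'a filtered_space" and G :: "('a, 'r, 'e) module_bundle" +
  fixes p :: perversity
  assumes regular: "regular_space (fs_top X)"
begin

abbreviation IC where "IC i \<equiv> intersection_chains X p G i"
abbreviation IC_outside where "IC_outside i U \<equiv> supported_chains X p G i (outside X U)"

lemma IC_carrier_iff: "\<xi> \<in> carrier (IC i) \<longleftrightarrow> \<xi> \<in> carrier (lf_chains X G i) \<and> allowable_chain X p G i \<xi>"
  by (simp add: intersection_chains_def)

lemma IC_ops: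
  "\<zero>\<^bsub>IC i\<^esub> = \<zero>\<^bsub>lf_chains X G i\<^esub>"
  "\<xi> \<oplus>\<^bsub>IC i\<^esub> \<eta> = \<xi> \<oplus>\<^bsub>lf_chains X G i\<^esub> \<eta>"
  "r \<odot>\<^bsub>IC i\<^esub> \<xi> = r \<odot>\<^bsub>lf_chains X G i\<^esub> \<xi>"
  by (simp_all add: intersection_chains_def)

lemma lf_boundary_zero: "lf_boundary X G i \<zero>\<^bsub>lf_chains X G i\<^esub> = \<zero>\<^bsub>lf_chains X G (i - 1)\<^esub>"
proof -
  interpret L: left_module R "lf_chains X G i" by (rule lf_chains_left_module)
  interpret L1: left_module R "lf_chains X G (i - 1)" by (rule lf_chains_left_module)
  show ?thesis
    using lf_boundary_smult[OF L.M.zero_closed L.R.zero_closed] lf_boundary_closed[OF L.M.zero_closed]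
    by (simp add: L.zero_smult L1.zero_smult)
qed

text \<open>Allowability restricts only which simplices occur in a chain and in its boundary. The
  boundary is linear, and sums and multiples bring in no new simplices.\<close>

lemma IC_left_module: "left_module R (IC i)"
proof -
  interpret L: left_module R "lf_chains X G i" by (rule lf_chains_left_module)
  have eq: "IC i = lf_chains X G i\<lparr>carrier := carrier (IC i)\<rparr>"
    by (simp add: intersection_chains_def)
  have "lsubmodule R (carrier (IC i)) (lf_chains X G i)"
    unfolding lsubmodule_def
  proof (intro conjI ballI)
    show "carrier (IC i) \<subseteq> carrier (lf_chains X G i)" by (auto simp: IC_carrier_iff)
    show "\<zero>\<^bsub>lf_chains X G i\<^esub> \<in> carrier (IC i)"
      by (simp add: IC_carrier_iff allowable_chain_def lf_boundary_zero chain_simplices_zero)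
    show "\<xi> \<oplus>\<^bsub>lf_chains X G i\<^esub> \<eta> \<in> carrier (IC i)"
      if "\<xi> \<in> carrier (IC i)" "\<eta> \<in> carrier (IC i)" for \<xi> \<eta>
    proof -
      have *: "\<xi> \<in> carrier (lf_chains X G i)" "\<eta> \<in> carrier (lf_chains X G i)"
        using that by (auto simp: IC_carrier_iff)
      then show ?thesis
        using that chain_simplices_add[of i \<xi> \<eta>]
          chain_simplices_add[of "i - 1" "lf_boundary X G i \<xi>" "lf_boundary X G i \<eta>"]
        unfolding IC_carrier_iff allowable_chain_def lf_boundary_add[OF *] by blast
    qed
    show "r \<odot>\<^bsub>lf_chains X G i\<^esub> \<xi> \<in> carrier (IC i)"
      if r: "r \<in> carrier R" and "\<xi> \<in> carrier (IC i)" for \<xi> r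
    proof -
      have *: "\<xi> \<in> carrier (lf_chains X G i)"
        using that by (auto simp: IC_carrier_iff)
      then show ?thesis
        using that chain_simplices_smult[OF r, of i \<xi>] L.smult_closed
          chain_simplices_smult[OF r, of "i - 1" "lf_boundary X G i \<xi>"]
        unfolding IC_carrier_iff allowable_chain_def lf_boundary_smult[OF * r] by blast
    qed
  qed
  then show ?thesis
    by (subst eq) (rule lsubmodule_left_module[OF lf_chains_left_module])
qed

text \<open>The boundary of an allowable chain is allowable: its simplices are allowable by
  assumption on the chain, and its own boundary is zero, hence has no simplices.\<close>

lemma lf_boundary_hom: "lf_boundary X G i \<in> lmod_hom R (IC i) (IC (i - 1))"
proof -
  have "lf_boundary X G i \<xi> \<in> carrier (IC (i - 1))" if "\<xi> \<in> carrier (IC i)" for \<xi>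
    using that lf_boundary_closed[of \<xi> i] lf_boundary_boundary[of \<xi> i]
    by (simp add: IC_carrier_iff allowable_chain_def chain_simplices_zero)
  then show ?thesis
    by (auto simp: lmod_hom_def IC_ops lf_boundary_add lf_boundary_smult IC_carrier_iff)
qed

lemma lf_boundary_IC: "\<xi> \<in> carrier (IC i) \<Longrightarrow> lf_boundary X G i \<xi> \<in> carrier (IC (i - 1))"
  using lf_boundary_hom[of i] by (auto simp: lmod_hom_def Pi_iff)

lemma supported_left_submodule: "left_submodule R (IC i) (supported_chains X p G i S)"
proof -
  interpret left_module R "IC i" by (rule IC_left_module)
  have "lsubmodule R (supported_chains X p G i S) (IC i)"
    unfolding lsubmodule_def
  proof (intro conjI ballI)
    show "\<zero>\<^bsub>IC i\<^esub> \<in> supported_chains X p G i S"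
      using M.zero_closed by (simp add: supported_chains_def chain_support_def IC_ops chain_simplices_zero)
    show "\<xi> \<oplus>\<^bsub>IC i\<^esub> \<eta> \<in> supported_chains X p G i S"
      if "\<xi> \<in> supported_chains X p G i S" "\<eta> \<in> supported_chains X p G i S" for \<xi> \<eta>
      using that M.a_closed[of \<xi> \<eta>] chain_simplices_add[of i \<xi> \<eta>]
      unfolding supported_chains_def chain_support_def IC_ops by blast
    show "r \<odot>\<^bsub>IC i\<^esub> \<xi> \<in> supported_chains X p G i S"
      if "r \<in> carrier R" "\<xi> \<in> supported_chains X p G i S" for \<xi> r
      using that smult_closed[of r \<xi>] chain_simplices_smult[of r i \<xi>]
      unfolding supported_chains_def chain_support_def IC_ops by blast
  qed (auto simp: supported_chains_def)
  then show ?thesis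
    by (intro left_submodule.intro left_submodule_axioms.intro left_module_axioms)
qed

lemma lf_boundary_supported:
  assumes \<xi>: "\<xi> \<in> supported_chains X p G i S"
  shows "lf_boundary X G i \<xi> \<in> supported_chains X p G (i - 1) S"
proof -
  have "chain_support X G (i - 1) (lf_boundary X G i \<xi>) \<subseteq> S"
  proof
    fix x assume "x \<in> chain_support X G (i - 1) (lf_boundary X G i \<xi>)"
    then obtain \<tau> where \<tau>: "\<tau> \<in> chain_simplices X G (i - 1) (lf_boundary X G i \<xi>)"
        "x \<in> \<tau> ` standard_simplex (nat (i - 1))"
      by (auto simp: chain_support_def)
    obtain \<sigma> j where \<sigma>: "\<sigma> \<in> chain_simplices X G i \<xi>" "j \<le> nat i" "singular_face (nat i) j \<sigma> = \<tau>"
      using chain_simplices_boundary[OF \<tau>(1)] .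
    have "\<tau> \<in> simplices X (i - 1)" using \<tau>(1) chain_simplices_subset by blast
    from face_image[OF this \<sigma>(2,3)] \<tau>(2) \<sigma>(1) have "x \<in> chain_support X G i \<xi>"
      unfolding chain_support_def by blast
    then show "x \<in> S" using \<xi> by (auto simp: supported_chains_def)
  qed
  then show ?thesis using \<xi> lf_boundary_IC by (simp add: supported_chains_def)
qed

text \<open>A smaller open set has a larger outside, so restriction divides out more chains.\<close>

lemma IC_outside_mono: "V \<subseteq> U \<Longrightarrow> IC_outside i U \<subseteq> IC_outside i V"
  using closure_of_mono[of V U "fs_top X"] by (fastforce simp: supported_chains_def outside_def)

text \<open>The difference is written with the scalar \<open>-1\<close> because negation, unlike sums and scalar
  multiples, is not defined coefficientwise.\<close>

definition chain_diff where
  "chain_diff i \<xi> \<eta> = \<xi> \<oplus>\<^bsub>IC i\<^esub> ((\<ominus>\<^bsub>R\<^esub> \<one>\<^bsub>R\<^esub>) \<odot>\<^bsub>IC i\<^esub> \<eta>)"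

lemma chain_diff_closed:
  assumes "\<xi> \<in> carrier (IC i)" "\<eta> \<in> carrier (IC i)"
  shows "chain_diff i \<xi> \<eta> \<in> carrier (IC i)"
proof -
  interpret left_module R "IC i" by (rule IC_left_module)
  show ?thesis using assms by (simp add: chain_diff_def smult_closed)
qed

lemma chain_simplices_diff:
  assumes "\<xi> \<in> carrier (IC i)" "\<eta> \<in> carrier (IC i)"
  shows "chain_simplices X G i (chain_diff i \<xi> \<eta>) = {\<sigma> \<in> simplices X i. \<xi> \<sigma> \<noteq> \<eta> \<sigma>}"
proof -
  have "chain_diff i \<xi> \<eta> \<sigma> = \<zero>\<^bsub>coeff_module X G i \<sigma>\<^esub> \<longleftrightarrow> \<xi> \<sigma> = \<eta> \<sigma>" if \<sigma>: "\<sigma> \<in> simplices X i" for \<sigma>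
  proof -
    interpret left_module R "coeff_module X G i \<sigma>" using coeff_left_module[OF \<sigma>] .
    have "\<xi> \<sigma> \<in> carrier (coeff_module X G i \<sigma>)" "\<eta> \<sigma> \<in> carrier (coeff_module X G i \<sigma>)"
      using assms \<sigma> lf_chain_coeff by (auto simp: IC_carrier_iff)
    moreover from this have "chain_diff i \<xi> \<eta> \<sigma> = \<xi> \<sigma> \<ominus>\<^bsub>coeff_module X G i \<sigma>\<^esub> \<eta> \<sigma>"
      using \<sigma> by (simp add: chain_diff_def IC_ops lf_chains_ops smult_minus_one a_minus_def)
    ultimately show ?thesis
      by (metis M.r_neg M.a_comm M.add.inv_closed M.minus_eq M.minus_equality M.minus_minus)
  qed
  then show ?thesis by (auto simp: chain_simplices_def)
qed

section \<open>Agreement of chains at a point\<close>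

definition agree :: "int \<Rightarrow> 'a \<Rightarrow> ('a, 'e) lf_chain \<Rightarrow> ('a, 'e) lf_chain \<Rightarrow> bool" where
  "agree i x \<xi> \<eta> \<longleftrightarrow> (\<forall>\<sigma>\<in>simplices X i. x \<in> \<sigma> ` standard_simplex (nat i) \<longrightarrow> \<xi> \<sigma> = \<eta> \<sigma>)"

text \<open>If the chains agree at \<open>x\<close>, no simplex of their difference passes through
  \<open>x\<close>. Only finitely many such simplices meet some \<open>V\<close> around
  \<open>x\<close>, and their union \<open>Z\<close> is closed, so regularity yields
  \<open>W\<close> with closure inside \<open>V\<close> and off \<open>Z\<close>. Conversely
  \<open>x\<close> lies in the closure of \<open>W\<close>, which the support of the difference
  avoids.\<close>

lemma agree_iff:
  assumes \<xi>: "\<xi> \<in> carrier (IC i)" and \<eta>: "\<eta> \<in> carrier (IC i)"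
    and U: "openin (fs_top X) U" "x \<in> U"
  shows "agree i x \<xi> \<eta> \<longleftrightarrow>
    (\<exists>W. openin (fs_top X) W \<and> x \<in> W \<and> W \<subseteq> U \<and> chain_diff i \<xi> \<eta> \<in> IC_outside i W)"
proof
  assume *: "agree i x \<xi> \<eta>"
  have dlf: "chain_diff i \<xi> \<eta> \<in> carrier (lf_chains X G i)"
    using chain_diff_closed[OF \<xi> \<eta>] by (simp add: IC_carrier_iff)
  have "x \<in> topspace (fs_top X)" using U openin_subset by blast
  then obtain V where V: "openin (fs_top X) V" "x \<in> V"
      "finite {\<sigma> \<in> chain_simplices X G i (chain_diff i \<xi> \<eta>). \<sigma> ` standard_simplex (nat i) \<inter> V \<noteq> {}}" (is "finite ?S")
    using dlf unfolding lf_chains_iff by blast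
  define Z where "Z = (\<Union>\<sigma>\<in>?S. \<sigma> ` standard_simplex (nat i))"
  have "closedin (fs_top X) Z"
    unfolding Z_def
  proof (rule closedin_Union)
    fix T assume "T \<in> (\<lambda>\<sigma>. \<sigma> ` standard_simplex (nat i)) ` ?S"
    then show "closedin (fs_top X) T"
      using chain_simplices_subset simplex_closed by blast
  qed (use V(3) in blast)
  moreover have xZ: "x \<notin> Z"
    using * chain_simplices_diff[OF \<xi> \<eta>] by (auto simp: Z_def agree_def)
  \<comment> \<open>The factor \<open>U\<close> gives the required inclusion, removing
    \<open>Z\<close> handles the finitely many simplices meeting \<open>V\<close>, and all other
    simplices of the difference miss \<open>V\<close> and with it the closure of
    \<open>W\<close>.\<close>
  ultimately obtain W where W: "openin (fs_top X) W" "x \<in> W" "fs_top X closure_of W \<subseteq> U \<inter> V - Z"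
    using regular_space_closure_nbhd[OF regular, of "U \<inter> V - Z" x] U V
    by (metis Diff_iff IntI openin_Int openin_diff)
  have WU: "W \<subseteq> U" using W closure_of_subset[OF openin_subset[OF W(1)]] by blast
  have "chain_support X G i (chain_diff i \<xi> \<eta>) \<subseteq> outside X W"
  proof
    fix y assume "y \<in> chain_support X G i (chain_diff i \<xi> \<eta>)"
    then obtain \<sigma> where \<sigma>: "\<sigma> \<in> chain_simplices X G i (chain_diff i \<xi> \<eta>)" "y \<in> \<sigma> ` standard_simplex (nat i)"
      by (auto simp: chain_support_def)
    then have "y \<in> topspace (fs_top X)"
      using simplex_mem chain_simplices_subset by blast
    moreover have "y \<notin> fs_top X closure_of W"
    proof
      assume "y \<in> fs_top X closure_of W"
      then have "y \<in> V" "y \<notin> Z" using W by auto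
      then show False using \<sigma> by (auto simp: Z_def)
    qed
    ultimately show "y \<in> outside X W" by (simp add: outside_def)
  qed
  then have "chain_diff i \<xi> \<eta> \<in> IC_outside i W"
    using chain_diff_closed[OF \<xi> \<eta>] by (simp add: supported_chains_def)
  then show "\<exists>W. openin (fs_top X) W \<and> x \<in> W \<and> W \<subseteq> U \<and> chain_diff i \<xi> \<eta> \<in> IC_outside i W"
    using W WU by blast
next
  assume "\<exists>W. openin (fs_top X) W \<and> x \<in> W \<and> W \<subseteq> U \<and> chain_diff i \<xi> \<eta> \<in> IC_outside i W"
  then obtain W where W: "openin (fs_top X) W" "x \<in> W" "chain_diff i \<xi> \<eta> \<in> IC_outside i W" by blast
  have "x \<in> fs_top X closure_of W" using closure_of_subset[OF openin_subset[OF W(1)]] W(2) by blast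
  then have "x \<notin> chain_support X G i (chain_diff i \<xi> \<eta>)"
    using W(3) by (auto simp: supported_chains_def outside_def)
  then show "agree i x \<xi> \<eta>"
    by (auto simp: agree_def chain_support_def chain_simplices_diff[OF \<xi> \<eta>])
qed

lemma agree_refl: "agree i x \<xi> \<xi>" by (simp add: agree_def)

lemma agree_add:
  "agree i x \<xi> \<xi>' \<Longrightarrow> agree i x \<eta> \<eta>' \<Longrightarrow> agree i x (\<xi> \<oplus>\<^bsub>IC i\<^esub> \<eta>) (\<xi>' \<oplus>\<^bsub>IC i\<^esub> \<eta>')"
  by (simp add: agree_def IC_ops lf_chains_ops)

lemma agree_smult: "agree i x \<xi> \<xi>' \<Longrightarrow> agree i x (r \<odot>\<^bsub>IC i\<^esub> \<xi>) (r \<odot>\<^bsub>IC i\<^esub> \<xi>')"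
  by (simp add: agree_def IC_ops lf_chains_ops)

text \<open>Only simplices having \<open>\<tau>\<close> as a face contribute to its coefficient, and
  their images contain the image of \<open>\<tau>\<close>. This locality makes the boundary act on
  germs and lets a glued chain inherit allowability of its boundary.\<close>

lemma lf_boundary_cong:
  assumes \<tau>: "\<tau> \<in> simplices X (i - 1)"
    and *: "\<And>\<sigma>. \<sigma> \<in> simplices X i \<Longrightarrow>
      \<tau> ` standard_simplex (nat (i - 1)) \<subseteq> \<sigma> ` standard_simplex (nat i) \<Longrightarrow> \<xi> \<sigma> = \<eta> \<sigma>"
    and \<eta>: "\<eta> \<in> carrier (lf_chains X G i)"
  shows "lf_boundary X G i \<xi> \<tau> = lf_boundary X G i \<eta> \<tau>"
proof (rule extensionalityI[of _ "regular_part X (i - 1) \<tau>"])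
  fix t assume t: "t \<in> regular_part X (i - 1) \<tau>"
  interpret left_module R "fibre G (\<tau> t)" using regular_fibre[OF \<tau> t] .
  have eq: "\<xi> \<sigma> = \<eta> \<sigma>" if "\<sigma> \<in> simplices X i" "j \<le> nat i" "singular_face (nat i) j \<sigma> = \<tau>" for \<sigma> j
    using *[OF that(1)] face_image[OF \<tau> that(2,3)] by blast
  have "incident i \<xi> \<tau> = incident i \<eta> \<tau>"
    using eq by (auto simp: incident_def chain_simplices_def)
  moreover have "finsum (fibre G (\<tau> t)) (face_term \<xi> \<tau> t) (incident i \<eta> \<tau>) =
      finsum (fibre G (\<tau> t)) (face_term \<eta> \<tau> t) (incident i \<eta> \<tau>)"
  proof (rule M.finsum_cong')
    show "face_term \<eta> \<tau> t \<in> incident i \<eta> \<tau> \<rightarrow> carrier (fibre G (\<tau> t))"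
      using face_term_closed[OF \<eta> \<tau> t] incident_cofaces by blast
    fix x assume "x \<in> incident i \<eta> \<tau>"
    then obtain \<sigma> j where "x = (\<sigma>, j)" "\<sigma> \<in> simplices X i" "j \<le> nat i" "singular_face (nat i) j \<sigma> = \<tau>"
      by (rule incidentE)
    then show "face_term \<xi> \<tau> t x = face_term \<eta> \<tau> t x"
      using eq by (simp add: face_term_def)
  qed simp
  ultimately show "lf_boundary X G i \<xi> \<tau> t = lf_boundary X G i \<eta> \<tau> t"
    by (simp add: lf_boundary_apply[OF \<tau> t])
qed (use \<tau> in \<open>simp_all add: lf_boundary_def\<close>)

text \<open>If \<open>\<tau>\<close> passes through \<open>x\<close>, so does every simplex having
  \<open>\<tau>\<close> as a face.\<close>

lemma agree_boundary:
  assumes "agree i x \<xi> \<eta>" "\<eta> \<in> carrier (IC i)"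
  shows "agree (i - 1) x (lf_boundary X G i \<xi>) (lf_boundary X G i \<eta>)"
  unfolding agree_def
proof (intro ballI impI)
  fix \<tau> assume "\<tau> \<in> simplices X (i - 1)" "x \<in> \<tau> ` standard_simplex (nat (i - 1))"
  then show "lf_boundary X G i \<xi> \<tau> = lf_boundary X G i \<eta> \<tau>"
    using assms by (intro lf_boundary_cong) (auto simp: agree_def IC_carrier_iff)
qed

section \<open>The presheaf of relative chains, its germs and its stalks\<close>

definition IC_coset :: "int \<Rightarrow> 'a set \<Rightarrow> ('a, 'e) lf_chain \<Rightarrow> ('a, 'e) lf_chain set" where
  "IC_coset i U \<xi> = IC_outside i U +>\<^bsub>IC i\<^esub> \<xi>"

abbreviation IS where "IS j \<equiv> IS_presheaf X p G j"
abbreviation deg where "deg j \<equiv> int (fs_dim X) - j"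

lemma IS_carrier: "carrier (sec (IS j) U) = {IC_coset (deg j) U \<xi> | \<xi>. \<xi> \<in> carrier (IC (deg j))}"
  by (simp add: IS_presheaf_def relative_intersection_chains_def IC_coset_def
      left_submodule.quot_module_carrier[OF supported_left_submodule])

lemma IS_ops:
  "\<zero>\<^bsub>sec (IS j) U\<^esub> = IC_coset (deg j) U \<zero>\<^bsub>IC (deg j)\<^esub>"
  "\<xi> \<in> carrier (IC (deg j)) \<Longrightarrow> \<eta> \<in> carrier (IC (deg j)) \<Longrightarrow>
    IC_coset (deg j) U \<xi> \<oplus>\<^bsub>sec (IS j) U\<^esub> IC_coset (deg j) U \<eta> = IC_coset (deg j) U (\<xi> \<oplus>\<^bsub>IC (deg j)\<^esub> \<eta>)"
  "r \<in> carrier R \<Longrightarrow> \<xi> \<in> carrier (IC (deg j)) \<Longrightarrow>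
    r \<odot>\<^bsub>sec (IS j) U\<^esub> IC_coset (deg j) U \<xi> = IC_coset (deg j) U (r \<odot>\<^bsub>IC (deg j)\<^esub> \<xi>)"
    using left_submodule.coset_zero[OF supported_left_submodule]
      left_submodule.quot_module_add[OF supported_left_submodule]
      left_submodule.quot_module_smult[OF supported_left_submodule]
  by (simp_all add: IS_presheaf_def relative_intersection_chains_def IC_coset_def)
    (simp add: quot_module_def)

lemma IS_res:
  assumes "V \<subseteq> U" "\<xi> \<in> carrier (IC (deg j))"
  shows "res (IS j) U V (IC_coset (deg j) U \<xi>) = IC_coset (deg j) V \<xi>"
proof -
  have "(\<lambda>\<xi>. \<xi>) \<in> lmod_hom R (IC (deg j)) (IC (deg j))" by (simp add: lmod_hom_def)
  then show ?thesis
    using left_submodule.quot_map_coset[OF supported_left_submodule supported_left_submodule assms(2)]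
      IC_outside_mono[OF assms(1)]
    by (simp add: IS_presheaf_def IC_coset_def subset_iff)
qed

lemma IC_coset_eq_iff:
  assumes "\<xi> \<in> carrier (IC i)" "\<eta> \<in> carrier (IC i)"
  shows "IC_coset i U \<xi> = IC_coset i U \<eta> \<longleftrightarrow> chain_diff i \<xi> \<eta> \<in> IC_outside i U"
  using left_submodule.coset_eq_iff[OF supported_left_submodule assms]
  by (simp add: IC_coset_def chain_diff_def)

text \<open>The germ at \<open>x\<close> of the chain \<open>\<xi>\<close>. By regularity of the space it only records the
  coefficients of the simplices passing through \<open>x\<close>.\<close>

definition chain_germ ::
    "int \<Rightarrow> 'a \<Rightarrow> ('a, 'e) lf_chain \<Rightarrow> ('a set \<times> ('a, 'e) lf_chain set) set" where
  "chain_germ i x \<xi> = {(V, IC_coset i V \<eta>) | V \<eta>.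
     openin (fs_top X) V \<and> x \<in> V \<and> \<eta> \<in> carrier (IC i) \<and> agree i x \<xi> \<eta>}"

text \<open>Restrictions to \<open>W\<close> are equal iff the difference of the chains is supported
  outside the closure of \<open>W\<close>. Existence of such \<open>W\<close> inside the
  intersection of \<open>U\<close> and \<open>V\<close> is the condition of
  \<open>agree_iff\<close>. In particular the germ no longer depends on \<open>U\<close>.\<close>

lemma germ_eq:
  assumes U: "openin (fs_top X) U" "x \<in> U" and \<xi>: "\<xi> \<in> carrier (IC (deg j))"
  shows "germ (fs_top X) (IS j) x U (IC_coset (deg j) U \<xi>) = chain_germ (deg j) x \<xi>"
proof -
  have "(\<exists>W. openin (fs_top X) W \<and> x \<in> W \<and> W \<subseteq> U \<inter> V \<and>
      res (IS j) U W (IC_coset (deg j) U \<xi>) = res (IS j) V W (IC_coset (deg j) V \<eta>)) \<longleftrightarrow> agree (deg j) x \<xi> \<eta>"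
    if "openin (fs_top X) V" "x \<in> V" "\<eta> \<in> carrier (IC (deg j))" for V \<eta>
  proof -
    have "openin (fs_top X) (U \<inter> V)" "x \<in> U \<inter> V" using U that by auto
    note * = agree_iff[OF \<xi> that(3) this]
    have "res (IS j) U W (IC_coset (deg j) U \<xi>) = res (IS j) V W (IC_coset (deg j) V \<eta>) \<longleftrightarrow>
        chain_diff (deg j) \<xi> \<eta> \<in> IC_outside (deg j) W" if "W \<subseteq> U \<inter> V" for W
      using that \<xi> \<open>\<eta> \<in> _\<close> by (simp add: IS_res IC_coset_eq_iff)
    then show ?thesis unfolding * by blast
  qed
  then show ?thesis
    unfolding germ_def chain_germ_def IS_carrier by blast
qed

lemma chain_germ_self:
  "openin (fs_top X) U \<Longrightarrow> x \<in> U \<Longrightarrow> \<xi> \<in> carrier (IC i) \<Longrightarrow> (U, IC_coset i U \<xi>) \<in> chain_germ i x \<xi>"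
  using agree_refl by (auto simp: chain_germ_def)

lemma chain_germ_cong: "agree i x \<xi> \<eta> \<Longrightarrow> chain_germ i x \<xi> = chain_germ i x \<eta>"
  unfolding chain_germ_def agree_def by (rule Collect_cong) metis

lemma chain_germ_eq_iff:
  assumes "x \<in> topspace (fs_top X)" "\<xi> \<in> carrier (IC i)" "\<eta> \<in> carrier (IC i)"
  shows "chain_germ i x \<xi> = chain_germ i x \<eta> \<longleftrightarrow> agree i x \<xi> \<eta>"
proof
  assume "chain_germ i x \<xi> = chain_germ i x \<eta>"
  \<comment> \<open>Membership of a pair is tested over the whole space. It gives a chain
    \<open>\<zeta>\<close> that agrees with \<open>\<xi>\<close> at \<open>x\<close> and lies in the
    same global coset as \<open>\<eta>\<close>.\<close>
  then have "(topspace (fs_top X), IC_coset i (topspace (fs_top X)) \<eta>) \<in> chain_germ i x \<xi>"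
    using chain_germ_self[of "topspace (fs_top X)" x \<eta> i] assms by simp
  then obtain \<zeta> where \<zeta>: "\<zeta> \<in> carrier (IC i)" "agree i x \<xi> \<zeta>"
      "IC_coset i (topspace (fs_top X)) \<eta> = IC_coset i (topspace (fs_top X)) \<zeta>"
    by (auto simp: chain_germ_def)
  then have "agree i x \<eta> \<zeta>"
    using agree_iff[OF assms(3) \<zeta>(1) openin_topspace assms(1)] IC_coset_eq_iff[OF assms(3) \<zeta>(1)] assms(1)
    by blast
  then show "agree i x \<xi> \<eta>" using \<zeta>(2) by (simp add: agree_def)
qed (rule chain_germ_cong)

lemma chain_germE:
  assumes "a \<in> chain_germ i x \<xi>"
  obtains V \<eta> where "a = (V, IC_coset i V \<eta>)" "openin (fs_top X) V" "x \<in> V" "\<eta> \<in> carrier (IC i)" "agree i x \<xi> \<eta>"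
  using assms by (auto simp: chain_germ_def)

lemma stalk_carrier:
  assumes "x \<in> topspace (fs_top X)"
  shows "carrier (stalk (fs_top X) (IS j) x) = chain_germ (deg j) x ` carrier (IC (deg j))"
proof (intro equalityI subsetI)
  fix a assume "a \<in> carrier (stalk (fs_top X) (IS j) x)"
  then obtain U s where "a = germ (fs_top X) (IS j) x U s" "openin (fs_top X) U" "x \<in> U" "s \<in> carrier (sec (IS j) U)"
    by (auto simp: stalk_def)
  \<comment> \<open>Sections over every open set are cosets of chains on all of \<open>X\<close>, so
    each germ comes from a global chain.\<close>
  then show "a \<in> chain_germ (deg j) x ` carrier (IC (deg j))"
    unfolding IS_carrier using germ_eq by blast
next
  fix a assume "a \<in> chain_germ (deg j) x ` carrier (IC (deg j))"
  then obtain \<xi> where \<xi>: "\<xi> \<in> carrier (IC (deg j))" "a = chain_germ (deg j) x \<xi>" by blast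
  then have "a = germ (fs_top X) (IS j) x (topspace (fs_top X)) (IC_coset (deg j) (topspace (fs_top X)) \<xi>)"
    "IC_coset (deg j) (topspace (fs_top X)) \<xi> \<in> carrier (sec (IS j) (topspace (fs_top X)))"
    using germ_eq[OF openin_topspace assms] by (auto simp: IS_carrier)
  then show "a \<in> carrier (stalk (fs_top X) (IS j) x)"
    using assms openin_topspace by (fastforce simp: stalk_def)
qed

lemma stalk_zero:
  assumes "x \<in> topspace (fs_top X)"
  shows "\<zero>\<^bsub>stalk (fs_top X) (IS j) x\<^esub> = chain_germ (deg j) x \<zero>\<^bsub>IC (deg j)\<^esub>"
proof -
  interpret left_module R "IC (deg j)" by (rule IC_left_module)
  show ?thesis
    using germ_eq[OF openin_topspace assms M.zero_closed] by (simp add: stalk_def IS_ops)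
qed

text \<open>Restriction keeps the chain and enlarges only the submodule divided out. The sum taken
  over the intersection is therefore the coset of the sum of the representing chains, and
  \<open>agree_add\<close> removes the dependence on them.\<close>

lemma stalk_add:
  assumes x: "x \<in> topspace (fs_top X)" and \<xi>: "\<xi> \<in> carrier (IC (deg j))" and \<eta>: "\<eta> \<in> carrier (IC (deg j))"
  shows "chain_germ (deg j) x \<xi> \<oplus>\<^bsub>stalk (fs_top X) (IS j) x\<^esub> chain_germ (deg j) x \<eta> =
    chain_germ (deg j) x (\<xi> \<oplus>\<^bsub>IC (deg j)\<^esub> \<eta>)"
proof -
  interpret left_module R "IC (deg j)" by (rule IC_left_module)
  have "(case a of (U, s) \<Rightarrow> case b of (V, t) \<Rightarrow> germ (fs_top X) (IS j) x (U \<inter> V)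
      (res (IS j) U (U \<inter> V) s \<oplus>\<^bsub>sec (IS j) (U \<inter> V)\<^esub> res (IS j) V (U \<inter> V) t)) =
      chain_germ (deg j) x (\<xi> \<oplus>\<^bsub>IC (deg j)\<^esub> \<eta>)"
    if a: "a \<in> chain_germ (deg j) x \<xi>" and b: "b \<in> chain_germ (deg j) x \<eta>" for a b
  proof -
    obtain U \<xi>' where U: "a = (U, IC_coset (deg j) U \<xi>')" "openin (fs_top X) U" "x \<in> U"
        "\<xi>' \<in> carrier (IC (deg j))" "agree (deg j) x \<xi> \<xi>'"
      using a by (rule chain_germE)
    obtain V \<eta>' where V: "b = (V, IC_coset (deg j) V \<eta>')" "openin (fs_top X) V" "x \<in> V"
        "\<eta>' \<in> carrier (IC (deg j))" "agree (deg j) x \<eta> \<eta>'"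
      using b by (rule chain_germE)
    have UV: "openin (fs_top X) (U \<inter> V)" "x \<in> U \<inter> V" using U V by auto
    show ?thesis
      using germ_eq[OF UV M.a_closed[OF U(4) V(4)]] chain_germ_cong[OF agree_add[OF U(5) V(5)]]
      by (simp add: U(1) V(1) IS_res IS_ops U(4) V(4))
  qed
  note * = this
  have "chain_germ (deg j) x \<xi> \<oplus>\<^bsub>stalk (fs_top X) (IS j) x\<^esub> chain_germ (deg j) x \<eta> =
    (\<Union>a\<in>chain_germ (deg j) x \<xi>. \<Union>b\<in>chain_germ (deg j) x \<eta>.
      case a of (U, s) \<Rightarrow> case b of (V, t) \<Rightarrow> germ (fs_top X) (IS j) x (U \<inter> V)
      (res (IS j) U (U \<inter> V) s \<oplus>\<^bsub>sec (IS j) (U \<inter> V)\<^esub> res (IS j) V (U \<inter> V) t))"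
    by (simp add: stalk_def split_def)
  also have "\<dots> = chain_germ (deg j) x (\<xi> \<oplus>\<^bsub>IC (deg j)\<^esub> \<eta>)"
    by (rule UN_eq_constant[OF chain_germ_self[OF openin_topspace x \<xi>]],
        rule UN_eq_constant[OF chain_germ_self[OF openin_topspace x \<eta>]], rule *)
  finally show ?thesis .
qed

lemma stalk_smult:
  assumes x: "x \<in> topspace (fs_top X)" and \<xi>: "\<xi> \<in> carrier (IC (deg j))" and r: "r \<in> carrier R"
  shows "r \<odot>\<^bsub>stalk (fs_top X) (IS j) x\<^esub> chain_germ (deg j) x \<xi> = chain_germ (deg j) x (r \<odot>\<^bsub>IC (deg j)\<^esub> \<xi>)"
proof -
  interpret left_module R "IC (deg j)" by (rule IC_left_module)
  have "(case a of (U, s) \<Rightarrow> germ (fs_top X) (IS j) x U (r \<odot>\<^bsub>sec (IS j) U\<^esub> s)) =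
      chain_germ (deg j) x (r \<odot>\<^bsub>IC (deg j)\<^esub> \<xi>)"
    if a: "a \<in> chain_germ (deg j) x \<xi>" for a
  proof -
    obtain U \<xi>' where U: "a = (U, IC_coset (deg j) U \<xi>')" "openin (fs_top X) U" "x \<in> U"
        "\<xi>' \<in> carrier (IC (deg j))" "agree (deg j) x \<xi> \<xi>'"
      using a by (rule chain_germE)
    show ?thesis
      using germ_eq[OF U(2,3) smult_closed[OF r U(4)]] chain_germ_cong[OF agree_smult[OF U(5)]]
      by (simp add: U(1) IS_ops U(4) r)
  qed
  then have "(\<Union>a\<in>chain_germ (deg j) x \<xi>. case a of (U, s) \<Rightarrow> germ (fs_top X) (IS j) x U (r \<odot>\<^bsub>sec (IS j) U\<^esub> s)) =
      chain_germ (deg j) x (r \<odot>\<^bsub>IC (deg j)\<^esub> \<xi>)"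
    by (rule UN_eq_constant[OF chain_germ_self[OF openin_topspace x \<xi>]])
  then show ?thesis by (simp add: stalk_def)
qed

text \<open>Different representatives of the germ have boundaries with the same germ by
  \<open>agree_boundary\<close>.\<close>

lemma stalk_map_boundary:
  assumes x: "x \<in> topspace (fs_top X)" and \<xi>: "\<xi> \<in> carrier (IC (deg j))"
  shows "stalk_map (fs_top X) (IS (j + 1)) (IS_presheaf_diff X p G j) x (chain_germ (deg j) x \<xi>) =
    chain_germ (deg (j + 1)) x (lf_boundary X G (deg j) \<xi>)"
proof -
  have d: "deg (j + 1) = deg j - 1" by simp
  have "(case a of (U, s) \<Rightarrow> germ (fs_top X) (IS (j + 1)) x U (IS_presheaf_diff X p G j U s)) =
      chain_germ (deg (j + 1)) x (lf_boundary X G (deg j) \<xi>)"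
    if a: "a \<in> chain_germ (deg j) x \<xi>" for a
  proof -
    obtain U \<xi>' where U: "a = (U, IC_coset (deg j) U \<xi>')" "openin (fs_top X) U" "x \<in> U"
        "\<xi>' \<in> carrier (IC (deg j))" "agree (deg j) x \<xi> \<xi>'"
      using a by (rule chain_germE)
    have "IS_presheaf_diff X p G j U (IC_coset (deg j) U \<xi>') = IC_coset (deg (j + 1)) U (lf_boundary X G (deg j) \<xi>')"
      unfolding IS_presheaf_diff_def IC_coset_def d
      by (rule left_submodule.quot_map_coset[OF supported_left_submodule supported_left_submodule U(4)])
        (rule lf_boundary_hom, rule lf_boundary_supported)
    moreover have b: "lf_boundary X G (deg j) \<xi>' \<in> carrier (IC (deg (j + 1)))"
      unfolding d using lf_boundary_IC[OF U(4)] .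
    ultimately show ?thesis
      using germ_eq[OF U(2,3) b] chain_germ_cong[OF agree_boundary[OF U(5,4)]]
      by (simp add: U(1) d)
  qed
  then show ?thesis
    unfolding stalk_map_def by (rule UN_eq_constant[OF chain_germ_self[OF openin_topspace x \<xi>]])
qed

end

section \<open>Global sections\<close>

text \<open>The isomorphism is direct image of cosets under \<open>\<Phi>M\<close>. Cosets, their
  sums and their multiples are unions of singletons built from the operations, and direct images
  commute with unions. The primed side thus enters only through its operations, so global sections
  need no separate proof of the module axioms.\<close>

lemma homology_at_isomorphic:
  assumes M: "left_module R M"
    and \<Phi>L: "\<Phi>L \<in> lmod_iso R L L'" and \<Phi>M: "\<Phi>M \<in> lmod_iso R M M'" and \<Phi>N: "\<Phi>N \<in> lmod_iso R N N'"
    and f: "f \<in> carrier L \<rightarrow> carrier M" and g: "g \<in> carrier M \<rightarrow> carrier N"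
    and zero: "\<zero>\<^bsub>N\<^esub> \<in> carrier N" "\<Phi>N \<zero>\<^bsub>N\<^esub> = \<zero>\<^bsub>N'\<^esub>"
    and f': "\<And>x. x \<in> carrier L \<Longrightarrow> f' (\<Phi>L x) = \<Phi>M (f x)"
    and g': "\<And>x. x \<in> carrier M \<Longrightarrow> g' (\<Phi>M x) = \<Phi>N (g x)"
  shows "lmod_isomorphic R (homology_at L f M g N) (homology_at L' f' M' g' N')"
proof -
  interpret left_module R M by fact
  define B where "B = f ` carrier L"
  define B' where "B' = f' ` carrier L'"
  define K where "K = {x \<in> carrier M. g x = \<zero>\<^bsub>N\<^esub>}"
  define K' where "K' = {x \<in> carrier M'. g' x = \<zero>\<^bsub>N'\<^esub>}"
  have bL: "\<Phi>L ` carrier L = carrier L'" and bM: "\<Phi>M ` carrier M = carrier M'"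
    using \<Phi>L \<Phi>M by (auto simp: lmod_iso_def bij_betw_def)
  have inj: "inj_on \<Phi>M (carrier M)" "inj_on \<Phi>N (carrier N)"
    using \<Phi>M \<Phi>N by (auto simp: lmod_iso_def bij_betw_def)
  have add: "\<Phi>M (x \<oplus>\<^bsub>M\<^esub> y) = \<Phi>M x \<oplus>\<^bsub>M'\<^esub> \<Phi>M y" if "x \<in> carrier M" "y \<in> carrier M" for x y
    using \<Phi>M that by (auto simp: lmod_iso_def lmod_hom_def)
  have sm: "\<Phi>M (r \<odot>\<^bsub>M\<^esub> x) = r \<odot>\<^bsub>M'\<^esub> \<Phi>M x" if "r \<in> carrier R" "x \<in> carrier M" for r x
    using \<Phi>M that by (auto simp: lmod_iso_def lmod_hom_def)
  have BM: "B \<subseteq> carrier M" using f by (auto simp: B_def)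
  have B': "B' = \<Phi>M ` B"
    unfolding B'_def B_def bL[symmetric] image_image by (rule image_cong) (auto simp: f')
  have K': "K' = \<Phi>M ` K"
  proof -
    have "g' (\<Phi>M x) = \<zero>\<^bsub>N'\<^esub> \<longleftrightarrow> g x = \<zero>\<^bsub>N\<^esub>" if "x \<in> carrier M" for x
    proof -
      have "g x \<in> carrier N" using g that by blast
      then show ?thesis
        using g'[OF that] zero inj_on_eq_iff[OF inj(2) _ zero(1), of "g x"] by simp
    qed
    then show ?thesis unfolding K'_def K_def bM[symmetric] by blast
  qed
  \<comment> \<open>The coset of \<open>a\<close> is written as a union of singletons, a form that
    an image passes through.\<close>
  define c where "c = (\<lambda>a. (\<Union>b\<in>B. {b \<oplus>\<^bsub>M\<^esub> a}))"
  define c' where "c' = (\<lambda>a. (\<Union>b\<in>B'. {b \<oplus>\<^bsub>M'\<^esub> a}))"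
  have cM: "c a \<subseteq> carrier M" if "a \<in> carrier M" for a
    using BM that by (auto simp: c_def)
  have c_image: "\<Phi>M ` c a = c' (\<Phi>M a)" if "a \<in> carrier M" for a
  proof -
    have "\<Phi>M ` c a = (\<Union>b\<in>B. {\<Phi>M (b \<oplus>\<^bsub>M\<^esub> a)})" by (auto simp: c_def)
    also have "\<dots> = (\<Union>b\<in>B. {\<Phi>M b \<oplus>\<^bsub>M'\<^esub> \<Phi>M a})"
      by (rule SUP_cong) (use BM that add in auto)
    finally show ?thesis by (simp add: c'_def B')
  qed
  have KM: "K \<subseteq> carrier M" by (auto simp: K_def)
  have H: "carrier (homology_at L f M g N) = c ` K"
    "\<And>C D. C \<oplus>\<^bsub>homology_at L f M g N\<^esub> D = (\<Union>x\<in>C. \<Union>y\<in>D. {x \<oplus>\<^bsub>M\<^esub> y})"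
    "\<And>r C. r \<odot>\<^bsub>homology_at L f M g N\<^esub> C = (\<Union>x\<in>C. c (r \<odot>\<^bsub>M\<^esub> x))"
    by (auto simp: homology_at_def quot_module_def ker_mod_def A_RCOSETS_def' set_add_def'
        a_r_coset_def' c_def B_def K_def)
  have H': "carrier (homology_at L' f' M' g' N') = c' ` K'"
    "\<And>C D. C \<oplus>\<^bsub>homology_at L' f' M' g' N'\<^esub> D = (\<Union>x\<in>C. \<Union>y\<in>D. {x \<oplus>\<^bsub>M'\<^esub> y})"
    "\<And>r C. r \<odot>\<^bsub>homology_at L' f' M' g' N'\<^esub> C = (\<Union>x\<in>C. c' (r \<odot>\<^bsub>M'\<^esub> x))"
    by (auto simp: homology_at_def quot_module_def ker_mod_def A_RCOSETS_def' set_add_def'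
        a_r_coset_def' c'_def B'_def K'_def)
  have CM: "C \<subseteq> carrier M" if "C \<in> c ` K" for C
    using that cM KM by blast
  have "(\<lambda>C. \<Phi>M ` C) \<in> lmod_hom R (homology_at L f M g N) (homology_at L' f' M' g' N')"
    unfolding lmod_hom_def mem_Collect_eq H H'
  proof (intro conjI ballI)
    show "(\<lambda>C. \<Phi>M ` C) \<in> c ` K \<rightarrow> c' ` K'"
      using c_image KM unfolding K' by blast
    show "\<Phi>M ` (\<Union>x\<in>C. \<Union>y\<in>D. {x \<oplus>\<^bsub>M\<^esub> y}) = (\<Union>x\<in>\<Phi>M ` C. \<Union>y\<in>\<Phi>M ` D. {x \<oplus>\<^bsub>M'\<^esub> y})"
      if "C \<in> c ` K" "D \<in> c ` K" for C D
      using CM[OF that(1)] CM[OF that(2)] add by (auto simp: image_UN subset_iff)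
    show "\<Phi>M ` (\<Union>x\<in>C. c (r \<odot>\<^bsub>M\<^esub> x)) = (\<Union>x\<in>\<Phi>M ` C. c' (r \<odot>\<^bsub>M'\<^esub> x))"
      if "r \<in> carrier R" "C \<in> c ` K" for r C
    proof -
      have "\<Phi>M ` c (r \<odot>\<^bsub>M\<^esub> x) = c' (r \<odot>\<^bsub>M'\<^esub> \<Phi>M x)" if "x \<in> C" for x
      proof -
        have "x \<in> carrier M" using CM \<open>C \<in> c ` K\<close> that by blast
        then show ?thesis using c_image[of "r \<odot>\<^bsub>M\<^esub> x"] sm \<open>r \<in> carrier R\<close> smult_closed by simp
      qed
      then show ?thesis by (simp add: image_UN)
    qed
  qed
  moreover have "bij_betw (\<lambda>C. \<Phi>M ` C) (c ` K) (c' ` K')"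
    unfolding bij_betw_def
  proof
    show "inj_on (\<lambda>C. \<Phi>M ` C) (c ` K)"
      using CM inj_on_image_eq_iff[OF inj(1)] by (auto intro!: inj_onI)
    show "(\<lambda>C. \<Phi>M ` C) ` c ` K = c' ` K'"
      unfolding K' image_image using c_image KM by (intro image_cong) auto
  qed
  ultimately have "(\<lambda>C. \<Phi>M ` C) \<in> lmod_iso R (homology_at L f M g N) (homology_at L' f' M' g' N')"
    by (simp add: lmod_iso_def H H')
  then show ?thesis by (auto simp: lmod_isomorphic_def)
qed

text \<open>The neighborhoods of points with value \<open>f x\<close> and those of points with
  another value form two open sets that would separate \<open>C\<close>. The values of
  \<open>f\<close> carry no topology, and constancy is asked only along \<open>C\<close>.\<close>

lemma locally_constant_on_connected:
  assumes "connectedin X C" "x \<in> C" "y \<in> C"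
    and "\<And>z. z \<in> C \<Longrightarrow> \<exists>V. openin X V \<and> z \<in> V \<and> (\<forall>w\<in>V \<inter> C. f w = f z)"
  shows "f x = f y"
proof (rule ccontr)
  assume ne: "f x \<noteq> f y"
  define V where "V = (\<lambda>z. SOME V. openin X V \<and> z \<in> V \<and> (\<forall>w\<in>V \<inter> C. f w = f z))"
  have "openin X (V z) \<and> z \<in> V z \<and> (\<forall>w\<in>V z \<inter> C. f w = f z)" if "z \<in> C" for z
    unfolding V_def by (rule someI_ex[OF assms(4)[OF that]])
  then have V: "openin X (V z)" "z \<in> V z" "\<And>w. w \<in> V z \<inter> C \<Longrightarrow> f w = f z" if "z \<in> C" for z
    using that by blast+
  define A where "A = (\<Union>z\<in>{z \<in> C. f z = f x}. V z)"
  define B where "B = (\<Union>z\<in>{z \<in> C. f z \<noteq> f x}. V z)"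
  have "openin X A" "openin X B" using V(1) by (auto simp: A_def B_def)
  moreover have "C \<subseteq> A \<union> B" using V(2) by (auto simp: A_def B_def)
  moreover have "A \<inter> B \<inter> C = {}"
  proof -
    have "w \<notin> V z'" if "w \<in> C" "w \<in> V z" "z \<in> C" "z' \<in> C" "f z = f x" "f z' \<noteq> f x" for w z z'
      using V(3)[of z w] V(3)[of z' w] that by auto
    then show ?thesis unfolding A_def B_def by blast
  qed
  moreover have "A \<inter> C \<noteq> {}" "B \<inter> C \<noteq> {}"
    using V(2) assms(2,3) ne by (force simp: A_def B_def)+
  ultimately show False
    using assms(1) unfolding connectedin by blast
qed

section \<open>Sections formed by the germs of a chain\<close>

context intersection_sheaf
begin

definition chain_section :: "int \<Rightarrow> ('a, 'e) lf_chain \<Rightarrow> 'a \<Rightarrow> ('a set \<times> ('a, 'e) lf_chain set) set" where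
  "chain_section i \<xi> = (\<lambda>x\<in>topspace (fs_top X). chain_germ i x \<xi>)"

text \<open>Local sections over \<open>V\<close> are represented by chains on the whole space, so
  the local description of a section can be given by chains directly.\<close>

lemma global_sections_carrier:
  "s \<in> carrier (IS_global_sections X p G j) \<longleftrightarrow>
    s \<in> extensional (topspace (fs_top X)) \<and>
    (\<forall>x\<in>topspace (fs_top X). \<exists>V \<xi>. openin (fs_top X) V \<and> x \<in> V \<and> \<xi> \<in> carrier (IC (deg j)) \<and>
      (\<forall>y\<in>V. s y = chain_germ (deg j) y \<xi>))" (is "?L \<longleftrightarrow> ?R")
proof
  assume L: ?L
  have "\<exists>V \<xi>. openin (fs_top X) V \<and> x \<in> V \<and> \<xi> \<in> carrier (IC (deg j)) \<and>
      (\<forall>y\<in>V. s y = chain_germ (deg j) y \<xi>)" if x: "x \<in> topspace (fs_top X)" for x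
  proof -
    obtain V t where V: "openin (fs_top X) V" "x \<in> V" "t \<in> carrier (sec (IS j) V)"
        "\<forall>y\<in>V. s y = germ (fs_top X) (IS j) y V t"
      using L x by (auto simp: IS_global_sections_def IS_sheaf_def sheafify_def)
    obtain \<xi> where \<xi>: "\<xi> \<in> carrier (IC (deg j))" "t = IC_coset (deg j) V \<xi>"
      using V(3) by (auto simp: IS_carrier)
    then have "\<forall>y\<in>V. s y = chain_germ (deg j) y \<xi>"
      using V(4) germ_eq[OF V(1) _ \<xi>(1)] by simp
    then show ?thesis using V \<xi> by blast
  qed
  then show ?R
    using L by (auto simp: IS_global_sections_def IS_sheaf_def sheafify_def PiE_iff)
next
  assume R: ?R
  have "s x \<in> carrier (stalk (fs_top X) (IS j) x)" if x: "x \<in> topspace (fs_top X)" for x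
  proof -
    obtain V \<xi> where "x \<in> V" "\<xi> \<in> carrier (IC (deg j))" "\<forall>y\<in>V. s y = chain_germ (deg j) y \<xi>"
      using bspec[OF conjunct2[OF R] x] by (elim exE conjE)
    then have "\<xi> \<in> carrier (IC (deg j))" "s x = chain_germ (deg j) x \<xi>" by simp_all
    then show ?thesis using stalk_carrier[OF x] by simp
  qed
  moreover have "\<exists>V t. openin (fs_top X) V \<and> x \<in> V \<and> V \<subseteq> topspace (fs_top X) \<and> t \<in> carrier (sec (IS j) V) \<and>
      (\<forall>y\<in>V. s y = germ (fs_top X) (IS j) y V t)" if x: "x \<in> topspace (fs_top X)" for x
  proof -
    obtain V \<xi> where V: "openin (fs_top X) V" "x \<in> V" "\<xi> \<in> carrier (IC (deg j))"
        "\<forall>y\<in>V. s y = chain_germ (deg j) y \<xi>"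
      using bspec[OF conjunct2[OF R] x] by (elim exE conjE)
    then have "\<forall>y\<in>V. s y = germ (fs_top X) (IS j) y V (IC_coset (deg j) V \<xi>)"
      using germ_eq[OF V(1) _ V(3)] by simp
    moreover have "IC_coset (deg j) V \<xi> \<in> carrier (sec (IS j) V)"
      using V(3) by (auto simp: IS_carrier)
    ultimately show ?thesis using V(1,2) openin_subset[OF V(1)] by (intro exI conjI)
  qed
  ultimately show ?L
    using R by (auto simp: IS_global_sections_def IS_sheaf_def sheafify_def PiE_iff)
qed

lemma global_sections_ops:
  "\<zero>\<^bsub>IS_global_sections X p G j\<^esub> = (\<lambda>x\<in>topspace (fs_top X). \<zero>\<^bsub>stalk (fs_top X) (IS j) x\<^esub>)"
  "s \<oplus>\<^bsub>IS_global_sections X p G j\<^esub> t = (\<lambda>x\<in>topspace (fs_top X). s x \<oplus>\<^bsub>stalk (fs_top X) (IS j) x\<^esub> t x)"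
  "r \<odot>\<^bsub>IS_global_sections X p G j\<^esub> s = (\<lambda>x\<in>topspace (fs_top X). r \<odot>\<^bsub>stalk (fs_top X) (IS j) x\<^esub> s x)"
  by (simp_all add: IS_global_sections_def IS_sheaf_def sheafify_def prod_module_def)

lemma chain_section_closed:
  "\<xi> \<in> carrier (IC (deg j)) \<Longrightarrow> chain_section (deg j) \<xi> \<in> carrier (IS_global_sections X p G j)"
  unfolding global_sections_carrier chain_section_def
  using openin_topspace by fastforce

lemma chain_section_zero: "chain_section (deg j) \<zero>\<^bsub>IC (deg j)\<^esub> = \<zero>\<^bsub>IS_global_sections X p G j\<^esub>"
  by (simp add: chain_section_def global_sections_ops stalk_zero cong: restrict_cong)

lemma chain_section_inj: "inj_on (chain_section i) (carrier (IC i))"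
proof (rule inj_onI)
  fix \<xi> \<eta> assume *: "\<xi> \<in> carrier (IC i)" "\<eta> \<in> carrier (IC i)" "chain_section i \<xi> = chain_section i \<eta>"
  have "\<xi> \<sigma> = \<eta> \<sigma>" if \<sigma>: "\<sigma> \<in> simplices X i" for \<sigma>
  proof -
    obtain x where x: "x \<in> \<sigma> ` standard_simplex (nat i)" using nonempty_standard_simplex by blast
    then have xX: "x \<in> topspace (fs_top X)" using simplex_image_mem[OF \<sigma>] by blast
    then have "chain_germ i x \<xi> = chain_germ i x \<eta>"
      using fun_cong[OF *(3), of x] by (simp add: chain_section_def)
    then show ?thesis using chain_germ_eq_iff[OF xX *(1,2)] x \<sigma> by (auto simp: agree_def)
  qed
  then show "\<xi> = \<eta>" using * by (intro lf_chain_eqI[of _ i]) (auto simp: IC_carrier_iff)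
qed

text \<open>Properties of the glued chain are read off from local representatives. Near each point
  it has the coefficients of one allowable chain on every simplex meeting a neighborhood, which
  gives local finiteness; comparison at one point of a simplex or of a face gives
  allowability.\<close>

lemma chain_section_surj:
  assumes s: "s \<in> carrier (IS_global_sections X p G j)"
  shows "\<exists>\<xi>\<in>carrier (IC (deg j)). s = chain_section (deg j) \<xi>"
proof -
  define i where "i = deg j"
  \<comment> \<open>The chain \<open>r x\<close> is required to represent the section at
    \<open>x\<close> only; nothing links the choices at nearby points.\<close>
  define r where "r = (\<lambda>x. SOME \<eta>. \<eta> \<in> carrier (IC i) \<and> s x = chain_germ i x \<eta>)"
  have loc: "\<exists>V \<eta>. openin (fs_top X) V \<and> x \<in> V \<and> \<eta> \<in> carrier (IC i) \<and>
      (\<forall>y\<in>V. s y = chain_germ i y \<eta>)" if "x \<in> topspace (fs_top X)" for x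
    using s that by (simp add: global_sections_carrier i_def)
  have r: "r x \<in> carrier (IC i)" "s x = chain_germ i x (r x)" if "x \<in> topspace (fs_top X)" for x
  proof -
    have "\<exists>\<eta>. \<eta> \<in> carrier (IC i) \<and> s x = chain_germ i x \<eta>" using loc[OF that] by blast
    from someI_ex[OF this] show "r x \<in> carrier (IC i)" "s x = chain_germ i x (r x)"
      by (auto simp: r_def)
  qed
  \<comment> \<open>The choice becomes harmless on simplices through \<open>y\<close>, since chains
    with equal germs at \<open>y\<close> have equal coefficients there.\<close>
  have r_agree: "r y \<sigma> = \<eta> \<sigma>"
    if "y \<in> topspace (fs_top X)" "s y = chain_germ i y \<eta>" "\<eta> \<in> carrier (IC i)" "\<sigma> \<in> simplices X i"
      "y \<in> \<sigma> ` standard_simplex (nat i)" for y \<eta> \<sigma>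
    using chain_germ_eq_iff[OF that(1) r(1)[OF that(1)] that(3)] r(2)[OF that(1)] that by (auto simp: agree_def)
  define pt where "pt = (\<lambda>\<sigma> :: 'a simplex. SOME x. x \<in> \<sigma> ` standard_simplex (nat i))"
  have pt: "pt \<sigma> \<in> \<sigma> ` standard_simplex (nat i)" for \<sigma>
    using nonempty_standard_simplex some_in_eq[of "\<sigma> ` standard_simplex (nat i)"] by (auto simp: pt_def)
  define \<xi> where "\<xi> = (\<lambda>\<sigma>\<in>simplices X i. r (pt \<sigma>) \<sigma>)"
  \<comment> \<open>The base point \<open>pt \<sigma>\<close> in the definition is replaced by any
    point of the image, and the chosen chain by any representative there. This is where
    connectedness of the image is used.\<close>
  have \<xi>: "\<xi> \<sigma> = \<eta> \<sigma>"
    if \<sigma>: "\<sigma> \<in> simplices X i" and x: "x \<in> \<sigma> ` standard_simplex (nat i)"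
      and \<eta>: "s x = chain_germ i x \<eta>" "\<eta> \<in> carrier (IC i)" for \<sigma> x \<eta>
  proof -
    have in_top: "y \<in> topspace (fs_top X)" if "y \<in> \<sigma> ` standard_simplex (nat i)" for y
      using simplex_image_mem[OF \<sigma> that] .
    have "r (pt \<sigma>) \<sigma> = r x \<sigma>"
    proof (rule locally_constant_on_connected[where f="\<lambda>y. r y \<sigma>", OF simplex_connected[OF \<sigma>] pt x])
      fix z assume z: "z \<in> \<sigma> ` standard_simplex (nat i)"
      obtain V \<zeta> where V: "openin (fs_top X) V" "z \<in> V" "\<zeta> \<in> carrier (IC i)" "\<forall>y\<in>V. s y = chain_germ i y \<zeta>"
        using loc[OF in_top[OF z]] by blast
      have "r w \<sigma> = \<zeta> \<sigma>" if "w \<in> V" "w \<in> \<sigma> ` standard_simplex (nat i)" for w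
        using r_agree[OF in_top[OF that(2)] _ V(3) \<sigma> that(2)] V(4) that(1) by blast
      then show "\<exists>V. openin (fs_top X) V \<and> z \<in> V \<and>
          (\<forall>w\<in>V \<inter> \<sigma> ` standard_simplex (nat i). r w \<sigma> = r z \<sigma>)"
        using V z by (intro exI[of _ V]) auto
    qed
    then show ?thesis using r_agree[OF in_top[OF x] \<eta> \<sigma> x] \<sigma> by (simp add: \<xi>_def)
  qed
  \<comment> \<open>One chain \<open>\<eta>\<close> works for all simplices meeting
    \<open>V\<close>: such a simplex has a point in \<open>V\<close>, where \<open>\<eta>\<close>
    represents the section.\<close>
  have loc_eq: "\<exists>V \<eta>. openin (fs_top X) V \<and> x \<in> V \<and> \<eta> \<in> carrier (IC i) \<and> s x = chain_germ i x \<eta> \<and>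
      (\<forall>\<sigma>\<in>simplices X i. \<sigma> ` standard_simplex (nat i) \<inter> V \<noteq> {} \<longrightarrow> \<xi> \<sigma> = \<eta> \<sigma>)"
    if "x \<in> topspace (fs_top X)" for x
    using loc[OF that] \<xi> by (metis (no_types, lifting) disjoint_iff)
  have lf: "\<xi> \<in> carrier (lf_chains X G i)"
    unfolding lf_chains_iff
  proof (intro conjI ballI)
    have "r (pt \<sigma>) \<sigma> \<in> carrier (coeff_module X G i \<sigma>)" if \<sigma>: "\<sigma> \<in> simplices X i" for \<sigma>
    proof -
      have "pt \<sigma> \<in> topspace (fs_top X)" by (rule simplex_image_mem[OF \<sigma> pt])
      then show ?thesis using r(1) lf_chain_coeff \<sigma> by (simp add: IC_carrier_iff)
    qed
    then show "\<xi> \<in> (\<Pi>\<^sub>E \<sigma>\<in>simplices X i. carrier (coeff_module X G i \<sigma>))" by (simp add: \<xi>_def)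
    fix x assume x: "x \<in> topspace (fs_top X)"
    obtain V \<eta> where V: "openin (fs_top X) V" "x \<in> V" "\<eta> \<in> carrier (IC i)"
        "\<forall>\<sigma>\<in>simplices X i. \<sigma> ` standard_simplex (nat i) \<inter> V \<noteq> {} \<longrightarrow> \<xi> \<sigma> = \<eta> \<sigma>"
      using loc_eq[OF x] by blast
    obtain W where W: "openin (fs_top X) W" "x \<in> W"
        "finite {\<sigma> \<in> chain_simplices X G i \<eta>. \<sigma> ` standard_simplex (nat i) \<inter> W \<noteq> {}}"
      using V(3) x unfolding IC_carrier_iff lf_chains_iff by blast
    \<comment> \<open>Inside \<open>V\<close> the simplices of \<open>\<xi>\<close> are simplices of
      \<open>\<eta>\<close>, and \<open>W\<close> bounds the number of those.\<close>
    have "finite {\<sigma> \<in> chain_simplices X G i \<xi>. \<sigma> ` standard_simplex (nat i) \<inter> (V \<inter> W) \<noteq> {}}"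
      by (rule finite_subset[OF _ W(3)]) (use V(4) in \<open>fastforce simp: chain_simplices_def\<close>)
    then show "\<exists>V. openin (fs_top X) V \<and> x \<in> V \<and>
        finite {\<sigma> \<in> chain_simplices X G i \<xi>. \<sigma> ` standard_simplex (nat i) \<inter> V \<noteq> {}}"
      using V W by (intro exI[of _ "V \<inter> W"]) auto
  qed
  have "allowable_chain X p G i \<xi>"
    unfolding allowable_chain_def
  proof (intro conjI ballI)
    fix \<sigma> assume \<sigma>: "\<sigma> \<in> chain_simplices X G i \<xi>"
    then have \<sigma>': "\<sigma> \<in> simplices X i" using chain_simplices_subset by blast
    have x: "pt \<sigma> \<in> topspace (fs_top X)" by (rule simplex_image_mem[OF \<sigma>' pt])
    have "\<sigma> \<in> chain_simplices X G i (r (pt \<sigma>))"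
      using \<sigma> by (auto simp: chain_simplices_def \<xi>_def)
    then show "allowable_simplex X p i \<sigma>"
      using r(1)[OF x] by (simp add: IC_carrier_iff allowable_chain_def)
  next
    fix \<tau> assume \<tau>: "\<tau> \<in> chain_simplices X G (i - 1) (lf_boundary X G i \<xi>)"
    then have \<tau>': "\<tau> \<in> simplices X (i - 1)" using chain_simplices_subset by blast
    obtain x where x: "x \<in> \<tau> ` standard_simplex (nat (i - 1))" using nonempty_standard_simplex by blast
    then have xX: "x \<in> topspace (fs_top X)" using simplex_image_mem[OF \<tau>'] by blast
    \<comment> \<open>Every simplex with \<open>\<tau>\<close> as a face passes through
      \<open>x\<close>, where the glued chain has the coefficients of \<open>r x\<close>. The
      boundary coefficients at \<open>\<tau>\<close> are thus the same, and \<open>r x\<close> is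
      allowable.\<close>
    have "lf_boundary X G i \<xi> \<tau> = lf_boundary X G i (r x) \<tau>"
      using \<xi>[OF _ _ r(2)[OF xX] r(1)[OF xX]] x r(1)[OF xX]
      by (intro lf_boundary_cong[OF \<tau>']) (auto simp: IC_carrier_iff)
    then have "\<tau> \<in> chain_simplices X G (i - 1) (lf_boundary X G i (r x))"
      using \<tau> by (simp add: chain_simplices_def)
    then show "allowable_simplex X p (i - 1) \<tau>"
      using r(1)[OF xX] by (simp add: IC_carrier_iff allowable_chain_def)
  qed
  with lf have ic: "\<xi> \<in> carrier (IC i)" by (simp add: IC_carrier_iff)
  have "s = chain_section i \<xi>"
  proof (rule extensionalityI[of _ "topspace (fs_top X)"])
    show "s \<in> extensional (topspace (fs_top X))" using s by (simp add: global_sections_carrier)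
    fix x assume x: "x \<in> topspace (fs_top X)"
    have "agree i x \<xi> (r x)"
      using \<xi>[OF _ _ r(2)[OF x] r(1)[OF x]] by (simp add: agree_def)
    then show "s x = chain_section i \<xi> x"
      using chain_germ_cong r(2)[OF x] x by (simp add: chain_section_def)
  qed (simp add: chain_section_def)
  with ic show ?thesis by (auto simp: i_def)
qed

lemma chain_section_iso:
  "chain_section (deg j) \<in> lmod_iso R (IC (deg j)) (IS_global_sections X p G j)"
proof -
  have "chain_section (deg j) \<in> lmod_hom R (IC (deg j)) (IS_global_sections X p G j)"
    unfolding lmod_hom_def
    by (auto simp: chain_section_closed)
      (auto simp: chain_section_def global_sections_ops stalk_add stalk_smult intro!: restrict_ext)
  moreover have "bij_betw (chain_section (deg j)) (carrier (IC (deg j))) (carrier (IS_global_sections X p G j))"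
    unfolding bij_betw_def using chain_section_inj chain_section_surj chain_section_closed by blast
  ultimately show ?thesis by (simp add: lmod_iso_def)
qed

lemma chain_section_boundary:
  assumes "\<xi> \<in> carrier (IC (deg j))"
  shows "IS_sheaf_diff X p G j (topspace (fs_top X)) (chain_section (deg j) \<xi>) =
    chain_section (deg (j + 1)) (lf_boundary X G (deg j) \<xi>)"
  unfolding IS_sheaf_diff_def sheafify_map_def chain_section_def
  by (rule restrict_ext) (simp add: stalk_map_boundary[OF _ assms])

lemma intersection_homology_iso:
  "lmod_isomorphic R (intersection_homology X p G (deg j)) (IS_global_cohomology X p G j)"
proof -
  interpret N: left_module R "IC (deg j - 1)" by (rule IC_left_module)
  \<comment> \<open>Raising the cohomological degree lowers the degree of chains, so the incoming
    and outgoing maps of the two complexes correspond.\<close>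
  have d: "deg (j - 1) = deg j + 1" "deg (j + 1) = deg j - 1" by simp_all
  show ?thesis
    unfolding intersection_homology_def IS_global_cohomology_def
  proof (rule homology_at_isomorphic[OF IC_left_module])
    show "chain_section (deg j + 1) \<in> lmod_iso R (IC (deg j + 1)) (IS_global_sections X p G (j - 1))"
      using chain_section_iso[of "j - 1"] unfolding d .
    show "chain_section (deg j) \<in> lmod_iso R (IC (deg j)) (IS_global_sections X p G j)"
      by (rule chain_section_iso)
    show "chain_section (deg j - 1) \<in> lmod_iso R (IC (deg j - 1)) (IS_global_sections X p G (j + 1))"
      using chain_section_iso[of "j + 1"] unfolding d .
    show "lf_boundary X G (deg j + 1) \<in> carrier (IC (deg j + 1)) \<rightarrow> carrier (IC (deg j))"
      using lf_boundary_IC[of _ "deg j + 1"] by simp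
    show "lf_boundary X G (deg j) \<in> carrier (IC (deg j)) \<rightarrow> carrier (IC (deg j - 1))"
      using lf_boundary_IC by simp
    show "\<zero>\<^bsub>IC (deg j - 1)\<^esub> \<in> carrier (IC (deg j - 1))" by simp
    show "chain_section (deg j - 1) \<zero>\<^bsub>IC (deg j - 1)\<^esub> = \<zero>\<^bsub>IS_global_sections X p G (j + 1)\<^esub>"
      using chain_section_zero[of "j + 1"] unfolding d .
    show "IS_sheaf_diff X p G (j - 1) (topspace (fs_top X)) (chain_section (deg j + 1) \<xi>) =
        chain_section (deg j) (lf_boundary X G (deg j + 1) \<xi>)" if "\<xi> \<in> carrier (IC (deg j + 1))" for \<xi>
      using chain_section_boundary[of \<xi> "j - 1"] that unfolding d by simp
    show "IS_sheaf_diff X p G j (topspace (fs_top X)) (chain_section (deg j) \<xi>) =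
        chain_section (deg j - 1) (lf_boundary X G (deg j) \<xi>)" if "\<xi> \<in> carrier (IC (deg j))" for \<xi>
      using chain_section_boundary[OF that] unfolding d .
  qed
qed

end

theorem corollary3p4:
  fixes R :: "('r, 'k) ring_scheme"
    and X :: "'a filtered_space"
    and p :: perversity
    and G :: "('a, 'r, 'e) module_bundle"
  assumes "ring R"
    and "is_filtered_space X"
    and "paracompact_space (fs_top X)"
    and "Hausdorff_space (fs_top X)"
    and "finite_cohomological_dimension TYPE(('a, 'r, 'e) stalk_universe) R (fs_top X)"
    and "traditional_perversity p \<or> superperversity p"
    and "local_coefficient_system R
           (subtopology (fs_top X) (topspace (fs_top X) - sing_set X)) G"
  shows "\<forall>j :: int. lmod_isomorphic R
           (intersection_homology X p G (int (fs_dim X) - j))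
           (IS_global_cohomology X p G j)"
proof -
  interpret intersection_sheaf R X G p
    by (intro intersection_sheaf.intro filtered_coefficients.intro intersection_sheaf_axioms.intro assms
        paracompact_Hausdorff_imp_regular_space)
  show ?thesis using intersection_homology_iso by blast
qed

end
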